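(* Let $G_0$ be an infinite, connected, quasi-transitive, cubic graph, let $\phi$ be a local transformation and $G_1=\phi(G_0)$ (assumed connected). Let $W_0$ be a minimal fundamental domain of $G_0$ and $W_1$ the set of all vertices of the gadgets $\phi(v)$, $v\in W_0$ (a fundamental domain of $G_1$), with $X_k$ the set of edges of $G_k$ incident to vertices in $W_k$. Assume $|\gamma(G_0)|<\infty$. Then $\gamma(G_1)=\gamma(G_0)$. Moreover, if $\eta(G_1)$ exists, then $\eta(G_0)$ exists and $\eta(G_0)=\eta(G_1)$.
   Context: All graphs are simple (no loops, no multiple edges). A graph $G=(V,E)$ is quasi-transitive if there is a finite $W\subseteq V$ such that every vertex is mapped into $W$ by some automorphism of $G$ (such $W$ is a fundamental domain); it is cubic if every vertex has degree $3$. Local transformation: a local transformation $\phi$ acts at a degree-$3$ vertex $v$ of a simple graph by replacing $v$ with a finite connected graph (the gadget) $\phi(v)$ having three distinct distinguished outer vertices (ports) $w_1,w_2,w_3$, each port being attached to exactly one of the three edges formerly incident to $v$ (one port per edge). It is required that (i) all gadgets $\phi(v)$ are isomorphic via isomorphisms sending ports to ports, and (ii) some subgroup of the automorphism group of $\phi(v)$ preserves the set $\{w_1,w_2,w_3\}$ and acts transitively on it. $\phi(G)$ denotes the graph obtained by applying $\phi$ at every degree-$3$ vertex of $G$. Automorphisms of $G_0$ induce automorphisms of $G_1$. Mid-edge convention: each edge $e$ is identified with a point at its middle (also denoted $e$). Walks may start and end at mid-edges; such a walk is self-avoiding (a SAW) if it visits no vertex and no mid-edge more than once, and its length $|\pi|$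 is the number of vertices it visits. For quasi-transitive $G$, $\mu(G)$ denotes the connective constant $\lim_n \sigma_n(v)^{1/n}$ ($\sigma_n(v)$ the number of $n$-step SAWs from a vertex $v$). Exponents: for an infinite, connected, quasi-transitive graph $G$ with connective constant $\mu$, fundamental domain $W$, and $X$ the set of edges incident to vertices in $W$, let $\Sigma$ be the set of SAWs on $G$ starting at mid-edges in $X$. Set $Y(x,y)=\sum_{\pi\in\Sigma}x^{|\pi|}/|\pi|^{y}$ ($x>0$, $y\in\mathbb R$; denominator $1$ if $|\pi|=0$), and let $\gamma(G)\in[-\infty,\infty]$ be such that $Y(\mu^{-1},y)=\infty$ for $y<\gamma$ and $Y(\mu^{-1},y)<\infty$ for $y>\gamma$. For an automorphism $\alpha$ of $G$ let $Z_\alpha(x)=\sum_{\pi\in\Sigma(\alpha)}x^{|\pi|}$, where $\Sigma(\alpha)\subseteq\Sigma$ consists of SAWs ending at mid-edges in $\alpha X$. We say $\eta=\eta(G)\in[-\infty,\infty]$ exists if for every sequence of automorphisms $\alpha$ with $d_G(W,\alpha W)\to\infty$, $Z_\alpha(\mu^{-1})\,d_G(W,\alpha W)^{w}\to0$ for $w<\eta$ and $\to\infty$ for $w>\eta$. Here $d_G$ is graph distance. These exponents do not depend on the choice of $W$. *)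

theory Defs
  imports "HOL-Analysis.Analysis"
begin

section \<open>Simple graphs\<close>

text \<open>A simple graph is given by a vertex set V and a symmetric irreflexive
  adjacency relation E supported on V.\<close>

definition simple_graph :: "'v set \<Rightarrow> ('v \<Rightarrow> 'v \<Rightarrow> bool) \<Rightarrow> bool" where
  "simple_graph V E \<longleftrightarrow>
     (\<forall>u v. E u v \<longrightarrow> u \<in> V \<and> v \<in> V) \<and> (\<forall>u v. E u v \<longrightarrow> E v u) \<and> (\<forall>u. \<not> E u u)"

definition connected_graph :: "'v set \<Rightarrow> ('v \<Rightarrow> 'v \<Rightarrow> bool) \<Rightarrow> bool" where
  "connected_graph V E \<longleftrightarrow> (\<forall>u\<in>V. \<forall>v\<in>V. (u, v) \<in> {(a, b). E a b}\<^sup>*)"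

definition cubic :: "'v set \<Rightarrow> ('v \<Rightarrow> 'v \<Rightarrow> bool) \<Rightarrow> bool" where
  "cubic V E \<longleftrightarrow> (\<forall>v\<in>V. finite {u. E v u} \<and> card {u. E v u} = 3)"

definition aut :: "'v set \<Rightarrow> ('v \<Rightarrow> 'v \<Rightarrow> bool) \<Rightarrow> ('v \<Rightarrow> 'v) \<Rightarrow> bool" where
  "aut V E f \<longleftrightarrow> bij_betw f V V \<and> (\<forall>u\<in>V. \<forall>v\<in>V. E (f u) (f v) \<longleftrightarrow> E u v)"

definition fund_domain :: "'v set \<Rightarrow> ('v \<Rightarrow> 'v \<Rightarrow> bool) \<Rightarrow> 'v set \<Rightarrow> bool" where
  "fund_domain V E W \<longleftrightarrow> finite W \<and> W \<subseteq> V \<and> (\<forall>v\<in>V. \<exists>f. aut V E f \<and> f v \<in> W)"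

definition quasi_transitive :: "'v set \<Rightarrow> ('v \<Rightarrow> 'v \<Rightarrow> bool) \<Rightarrow> bool" where
  "quasi_transitive V E \<longleftrightarrow> (\<exists>W. fund_domain V E W)"

text \<open>Minimal fundamental domain: minimal with respect to inclusion.\<close>
definition min_fund_domain :: "'v set \<Rightarrow> ('v \<Rightarrow> 'v \<Rightarrow> bool) \<Rightarrow> 'v set \<Rightarrow> bool" where
  "min_fund_domain V E W \<longleftrightarrow> fund_domain V E W \<and> (\<forall>W'. W' \<subset> W \<longrightarrow> \<not> fund_domain V E W')"

text \<open>Edges are two-element sets; the edges incident to vertices of W.\<close>
definition edge_set :: "('v \<Rightarrow> 'v \<Rightarrow> bool) \<Rightarrow> 'v set set" where
  "edge_set E = {{u, v} | u v. E u v}"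

definition inc_edges :: "('v \<Rightarrow> 'v \<Rightarrow> bool) \<Rightarrow> 'v set \<Rightarrow> 'v set set" where
  "inc_edges E W = {e \<in> edge_set E. \<exists>w\<in>W. w \<in> e}"

text \<open>Graph distance and distance between vertex sets.\<close>
definition gdist :: "('v \<Rightarrow> 'v \<Rightarrow> bool) \<Rightarrow> 'v \<Rightarrow> 'v \<Rightarrow> nat" where
  "gdist E u v = (LEAST n. (u, v) \<in> {(a, b). E a b} ^^ n)"

definition setdist :: "('v \<Rightarrow> 'v \<Rightarrow> bool) \<Rightarrow> 'v set \<Rightarrow> 'v set \<Rightarrow> nat" where
  "setdist E A B = Inf {gdist E u v | u v. u \<in> A \<and> v \<in> B}"

section \<open>Self-avoiding walks and the connective constant\<close>

text \<open>Number of n-step SAWs from vertex v (lists of n+1 distinct vertices,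
  consecutive ones adjacent).\<close>
definition saw_count :: "('v \<Rightarrow> 'v \<Rightarrow> bool) \<Rightarrow> 'v \<Rightarrow> nat \<Rightarrow> nat" where
  "saw_count E v n = card {p. length p = Suc n \<and> hd p = v \<and> distinct p \<and> successively E p}"

definition conn_const :: "'v set \<Rightarrow> ('v \<Rightarrow> 'v \<Rightarrow> bool) \<Rightarrow> real" where
  "conn_const V E = (THE m. \<forall>v\<in>V. (\<lambda>n. root n (real (saw_count E v n))) \<longlonglongrightarrow> m)"

text \<open>Mid-edge convention: positions are vertices or (middles of) edges.\<close>
datatype 'v pos = Vx 'v | Md "'v set"

fun is_Vx :: "'v pos \<Rightarrow> bool" where
  "is_Vx (Vx _) = True"
| "is_Vx (Md _) = False"

fun step_ok :: "('v \<Rightarrow> 'v \<Rightarrow> bool) \<Rightarrow> 'v pos \<Rightarrow> 'v pos \<Rightarrow> bool" where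
  "step_ok E (Md e) (Vx v) = (e \<in> edge_set E \<and> v \<in> e)"
| "step_ok E (Vx v) (Md e) = (e \<in> edge_set E \<and> v \<in> e)"
| "step_ok E _ _ = False"

text \<open>A walk (possibly starting/ending at mid-edges) that is self-avoiding:
  it visits no vertex and no mid-edge twice.\<close>
definition mid_saw :: "('v \<Rightarrow> 'v \<Rightarrow> bool) \<Rightarrow> 'v pos list \<Rightarrow> bool" where
  "mid_saw E p \<longleftrightarrow> p \<noteq> [] \<and> distinct p \<and> successively (step_ok E) p"

text \<open>Length = number of vertices visited.\<close>
definition wlen :: "'v pos list \<Rightarrow> nat" where
  "wlen p = length (filter is_Vx p)"

text \<open>Sigma: SAWs starting at mid-edges in X (edges incident to W).\<close>
definition Sig :: "('v \<Rightarrow> 'v \<Rightarrow> bool) \<Rightarrow> 'v set \<Rightarrow> 'v pos list set" where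
  "Sig E W = {p. mid_saw E p \<and> (\<exists>e\<in>inc_edges E W. hd p = Md e)}"

definition Yfun :: "('v \<Rightarrow> 'v \<Rightarrow> bool) \<Rightarrow> 'v set \<Rightarrow> real \<Rightarrow> real \<Rightarrow> ennreal" where
  "Yfun E W x y = (\<Sum>\<^sub>\<infinity>p\<in>Sig E W.
      ennreal (x ^ wlen p / (if wlen p = 0 then 1 else real (wlen p) powr y)))"

definition gamma_exp :: "'v set \<Rightarrow> ('v \<Rightarrow> 'v \<Rightarrow> bool) \<Rightarrow> 'v set \<Rightarrow> ereal \<Rightarrow> bool" where
  "gamma_exp V E W g \<longleftrightarrow>
     (\<forall>y::real. ereal y < g \<longrightarrow> Yfun E W (1 / conn_const V E) y = \<infinity>) \<and>
     (\<forall>y::real. g < ereal y \<longrightarrow> Yfun E W (1 / conn_const V E) y < \<infinity>)"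

text \<open>Sigma(alpha): SAWs in Sigma ending at mid-edges in alpha X.\<close>
definition Zfun :: "('v \<Rightarrow> 'v \<Rightarrow> bool) \<Rightarrow> 'v set \<Rightarrow> ('v \<Rightarrow> 'v) \<Rightarrow> real \<Rightarrow> ennreal" where
  "Zfun E W \<alpha> x = (\<Sum>\<^sub>\<infinity>p\<in>{p \<in> Sig E W. \<exists>e\<in>inc_edges E W. last p = Md (\<alpha> ` e)}.
      ennreal (x ^ wlen p))"

definition eta_exp :: "'v set \<Rightarrow> ('v \<Rightarrow> 'v \<Rightarrow> bool) \<Rightarrow> 'v set \<Rightarrow> ereal \<Rightarrow> bool" where
  "eta_exp V E W \<eta> \<longleftrightarrow>
     (\<forall>\<alpha> :: nat \<Rightarrow> 'v \<Rightarrow> 'v.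
        (\<forall>k. aut V E (\<alpha> k)) \<and>
        filterlim (\<lambda>k. real (setdist E W (\<alpha> k ` W))) at_top sequentially \<longrightarrow>
        (\<forall>w::real. ereal w < \<eta> \<longrightarrow>
           ((\<lambda>k. Zfun E W (\<alpha> k) (1 / conn_const V E) *
                  ennreal (real (setdist E W (\<alpha> k ` W)) powr w)) \<longlongrightarrow> 0) sequentially) \<and>
        (\<forall>w::real. \<eta> < ereal w \<longrightarrow>
           ((\<lambda>k. Zfun E W (\<alpha> k) (1 / conn_const V E) *
                  ennreal (real (setdist E W (\<alpha> k ` W)) powr w)) \<longlongrightarrow> \<infinity>) sequentially))"

section \<open>Local transformations\<close>

text \<open>The gadget: a finite connected simple graph with three distinct ports
  w1 w2 w3, such that the automorphisms of the gadget preserving the port set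
  act transitively on it (equivalently: some subgroup of the automorphism group
  preserves the port set and acts transitively on it).\<close>
definition gadget :: "'g set \<Rightarrow> ('g \<Rightarrow> 'g \<Rightarrow> bool) \<Rightarrow> 'g \<Rightarrow> 'g \<Rightarrow> 'g \<Rightarrow> bool" where
  "gadget Gv Ge w1 w2 w3 \<longleftrightarrow>
     finite Gv \<and> simple_graph Gv Ge \<and> connected_graph Gv Ge \<and>
     {w1, w2, w3} \<subseteq> Gv \<and> w1 \<noteq> w2 \<and> w1 \<noteq> w3 \<and> w2 \<noteq> w3 \<and>
     (\<forall>a\<in>{w1, w2, w3}. \<forall>b\<in>{w1, w2, w3}.
        \<exists>f. aut Gv Ge f \<and> f ` {w1, w2, w3} = {w1, w2, w3} \<and> f a = b)"

text \<open>phi(G): each vertex v of G0 is replaced by a copy {v} x Gv of the gadget;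
  the edge {v,u} of G0 becomes the edge between port sigma v u of the copy at v
  and port sigma u v of the copy at u.\<close>
definition phi_V :: "'v set \<Rightarrow> 'g set \<Rightarrow> ('v \<times> 'g) set" where
  "phi_V V0 Gv = V0 \<times> Gv"

definition phi_E :: "'v set \<Rightarrow> ('v \<Rightarrow> 'v \<Rightarrow> bool) \<Rightarrow> ('g \<Rightarrow> 'g \<Rightarrow> bool) \<Rightarrow> ('v \<Rightarrow> 'v \<Rightarrow> 'g)
                     \<Rightarrow> 'v \<times> 'g \<Rightarrow> 'v \<times> 'g \<Rightarrow> bool" where
  "phi_E V0 E0 Ge \<sigma> x y \<longleftrightarrow>
     (fst x = fst y \<and> fst x \<in> V0 \<and> Ge (snd x) (snd y)) \<or>
     (E0 (fst x) (fst y) \<and> snd x = \<sigma> (fst x) (fst y) \<and> snd y = \<sigma> (fst y) (fst x))"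

end

theory Submission
  imports Defs
begin

text \<open>
  Let \<open>g x\<close> be the sum of \<open>x ^ length\<close> over the self-avoiding paths of the gadget between two distinct
  ports; by the symmetry of the gadget it does not depend on the ports. Since each passage through a
  gadget uses two of its three ports, a self-avoiding walk of \<open>G1\<close> that starts and ends at edges
  inherited from \<open>G0\<close> crosses each gadget at most once, so it is a walk of \<open>G0\<close> with a gadget path
  substituted for each vertex. Hence the walk generating functions satisfy \<open>Z1(x) = Z0(g x)\<close> on such
  walks. Every walk of \<open>G1\<close> that leaves its initial gadget is one of these walks with a piece inside
  one gadget attached at either end, and there are boundedly many such pieces. Comparing the radii
  of convergence gives \<open>g (1 / \<mu>1) = 1 / \<mu>0\<close>, and at the critical point the two families of sums
  agree up to constant factors, as do walk lengths and graph distances.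
\<close>

section \<open>Sums and limits of extended nonnegative reals\<close>

lemma summable_on_to_ennreal [simp]:
  fixes f :: "'a \<Rightarrow> ennreal"
  shows "f summable_on A"
  by (simp add: nonneg_summable_on_complete)

lemma infsum_mono_set_ennreal:
  fixes f :: "'a \<Rightarrow> ennreal"
  assumes "A \<subseteq> B"
  shows "infsum f A \<le> infsum f B"
  by (rule infsum_mono_neutral) (use assms in auto)

lemma infsum_cmult_ennreal:
  fixes f :: "'a \<Rightarrow> ennreal"
  shows "(\<Sum>\<^sub>\<infinity>x\<in>A. c * f x) = c * infsum f A"
  by (simp add: nonneg_infsum_complete SUP_mult_left_ennreal sum_distrib_left[symmetric])

lemma infsum_ennreal_eq:
  assumes "f summable_on A" "\<And>x. x \<in> A \<Longrightarrow> 0 \<le> f x"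
  shows "(\<Sum>\<^sub>\<infinity>x\<in>A. ennreal (f x)) = ennreal (infsum f A)"
proof -
  have "sum (\<lambda>x. ennreal (f x)) F = ennreal (sum f F)" if "F \<subseteq> A" for F
    using assms(2) that by (intro sum_ennreal) auto
  then show ?thesis
    by (simp add: infsum_nonneg_is_SUPREMUM_ennreal[OF assms] nonneg_infsum_complete)
qed

lemma infsum_UN_disjoint_ennreal:
  fixes f :: "'a \<Rightarrow> ennreal"
  assumes disj: "disjoint_family_on L B"
  shows "infsum f (\<Union>b\<in>B. L b) = (\<Sum>\<^sub>\<infinity>b\<in>B. infsum f (L b))"
proof (rule antisym)
  have finite_case: "(\<Sum>b\<in>F. infsum f (L b)) = infsum f (\<Union>b\<in>F. L b)" if "finite F" "F \<subseteq> B" for F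
    using disj that by (intro sum_infsum) (auto simp: disjoint_family_on_def subset_iff)
  show "infsum f (\<Union>b\<in>B. L b) \<le> (\<Sum>\<^sub>\<infinity>b\<in>B. infsum f (L b))"
    unfolding nonneg_infsum_complete[of "\<Union>b\<in>B. L b" f, simplified]
  proof (rule SUP_least)
    fix F assume F: "F \<in> {F. finite F \<and> F \<subseteq> (\<Union>b\<in>B. L b)}"
    then have "\<forall>a\<in>F. \<exists>b. b \<in> B \<and> a \<in> L b" by blast
    then obtain b where b: "\<And>a. a \<in> F \<Longrightarrow> b a \<in> B \<and> a \<in> L (b a)" by metis
    have "sum f F = infsum f F" using F by simp
    also have "\<dots> \<le> infsum f (\<Union>b\<in>b ` F. L b)" using b by (intro infsum_mono_set_ennreal) auto
    also have "\<dots> = (\<Sum>\<^sub>\<infinity>b\<in>b ` F. infsum f (L b))"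
      using F b finite_case[of "b ` F"] by (auto simp: image_subset_iff)
    also have "\<dots> \<le> (\<Sum>\<^sub>\<infinity>b\<in>B. infsum f (L b))" using b by (intro infsum_mono_set_ennreal) auto
    finally show "sum f F \<le> (\<Sum>\<^sub>\<infinity>b\<in>B. infsum f (L b))" .
  qed
  show "(\<Sum>\<^sub>\<infinity>b\<in>B. infsum f (L b)) \<le> infsum f (\<Union>b\<in>B. L b)"
    unfolding nonneg_infsum_complete[of B "\<lambda>b. infsum f (L b)", simplified]
    by (rule SUP_least) (auto simp: finite_case intro!: infsum_mono_set_ennreal)
qed

lemma infsum_fibres_ennreal:
  fixes f :: "'a \<Rightarrow> ennreal"
  assumes "h ` A \<subseteq> B"
  shows "infsum f A = (\<Sum>\<^sub>\<infinity>b\<in>B. infsum f {a \<in> A. h a = b})"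
proof -
  have "A = (\<Union>b\<in>B. {a \<in> A. h a = b})" using assms by auto
  moreover have "disjoint_family_on (\<lambda>b. {a \<in> A. h a = b}) B" by (auto simp: disjoint_family_on_def)
  ultimately show ?thesis by (metis infsum_UN_disjoint_ennreal)
qed

lemma infsum_le_bounded_fibres_ennreal:
  fixes f :: "'a \<Rightarrow> ennreal" and g :: "'b \<Rightarrow> ennreal"
  assumes h: "h ` A \<subseteq> B"
    and finite_fibres: "\<And>b. b \<in> B \<Longrightarrow> finite {a \<in> A. h a = b}"
    and card_fibres: "\<And>b. b \<in> B \<Longrightarrow> card {a \<in> A. h a = b} \<le> K"
    and le: "\<And>a. a \<in> A \<Longrightarrow> f a \<le> c * g (h a)"
  shows "infsum f A \<le> of_nat K * c * infsum g B"
proof -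
  have "infsum f {a \<in> A. h a = b} \<le> of_nat K * c * g b" if b: "b \<in> B" for b
  proof -
    have "infsum f {a \<in> A. h a = b} \<le> of_nat (card {a \<in> A. h a = b}) * (c * g b)"
      using finite_fibres[OF b] le by (auto intro!: sum_bounded_above)
    also have "\<dots> \<le> of_nat K * (c * g b)"
      using card_fibres[OF b] by (intro mult_right_mono) auto
    finally show ?thesis by (simp add: mult.assoc)
  qed
  then have "(\<Sum>\<^sub>\<infinity>b\<in>B. infsum f {a \<in> A. h a = b}) \<le> (\<Sum>\<^sub>\<infinity>b\<in>B. of_nat K * c * g b)"
    by (intro infsum_mono) auto
  then show ?thesis by (simp add: infsum_fibres_ennreal[OF h] infsum_cmult_ennreal)
qed

lemma ennreal_tendsto_0_le:
  fixes f h :: "'a \<Rightarrow> ennreal" and c :: real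
  assumes "(h \<longlongrightarrow> 0) F" "\<forall>\<^sub>F k in F. f k \<le> ennreal c * h k"
  shows "(f \<longlongrightarrow> 0) F"
proof (rule tendsto_sandwich[OF _ assms(2) tendsto_const])
  show "((\<lambda>k. ennreal c * h k) \<longlongrightarrow> 0) F"
    using ennreal_tendsto_cmult[OF _ assms(1), of "ennreal c"] by simp
qed simp

lemma ennreal_tendsto_top_ge:
  fixes f h :: "'a \<Rightarrow> ennreal" and c :: real
  assumes h: "(h \<longlongrightarrow> \<infinity>) F" and le: "\<forall>\<^sub>F k in F. h k \<le> ennreal c * f k" and c: "c \<ge> 0"
  shows "(f \<longlongrightarrow> \<infinity>) F"
  unfolding infinity_ennreal_def tendsto_top_iff_ennreal
proof (intro allI impI)
  fix l :: real assume l: "0 \<le> l"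
  have "\<forall>\<^sub>F k in F. ennreal (c * l) < h k"
    using h c l unfolding infinity_ennreal_def tendsto_top_iff_ennreal by simp
  with le show "\<forall>\<^sub>F k in F. ennreal l < f k"
  proof eventually_elim
    case (elim k)
    show ?case
    proof (rule ccontr)
      assume "\<not> ennreal l < f k"
      then have "ennreal c * f k \<le> ennreal (c * l)"
        using c l by (simp add: ennreal_mult mult_left_mono)
      then show False using elim by simp
    qed
  qed
qed

section \<open>Growth of submultiplicative sequences\<close>

locale submultiplicative_seq =
  fixes s :: "nat \<Rightarrow> real"
  assumes seq_pos: "0 < s n" and submult: "s (m + n) \<le> s m * s n"
begin

definition growth_rate :: real where
  "growth_rate = (INF n\<in>{1..}. root n (s n))"

lemma bdd_below_roots: "bdd_below ((\<lambda>n. root n (s n)) ` {1..})"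
  using seq_pos by (intro bdd_belowI[of _ 0]) (auto intro: less_imp_le)

lemma growth_rate_nonneg: "0 \<le> growth_rate"
  unfolding growth_rate_def using seq_pos by (intro cINF_greatest) (auto intro: less_imp_le)

lemma growth_rate_power_le: "growth_rate ^ n \<le> s n"
proof (cases "n = 0")
  case True
  have "1 \<le> s 0" using submult[of 0 0] seq_pos[of 0] by simp
  then show ?thesis using True by simp
next
  case False
  then have "growth_rate \<le> root n (s n)"
    unfolding growth_rate_def by (intro cINF_lower bdd_below_roots) auto
  then have "growth_rate ^ n \<le> root n (s n) ^ n" using growth_rate_nonneg by (intro power_mono)
  then show ?thesis using False seq_pos[of n] by simp
qed

lemma growth_bound:
  assumes "growth_rate < l"
  obtains C where "C > 0" "\<And>n. s n \<le> C * l ^ n"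
proof -
  have l: "l > 0" using assms growth_rate_nonneg by simp
  obtain m where m: "m \<ge> 1" "root m (s m) < l"
    using assms bdd_below_roots unfolding growth_rate_def by (subst (asm) cINF_less_iff) auto
  have "root m (s m) ^ m \<le> l ^ m" using m seq_pos[of m] by (intro power_mono) auto
  then have sm: "s m \<le> l ^ m" using m seq_pos[of m] by simp
  define C where "C = (\<Sum>r<m. s r / l ^ r)"
  have below_m: "s r \<le> C * l ^ r" if "r < m" for r
  proof -
    have "s r / l ^ r \<le> C"
      unfolding C_def using l that seq_pos by (intro member_le_sum) (auto intro: less_imp_le)
    then show ?thesis using l by (simp add: field_simps)
  qed
  have "s n \<le> C * l ^ n" for n
  proof (induction n rule: less_induct)
    case (less n)
    show ?case
    proof (cases "n < m")
      case False
      have "s n \<le> s m * s (n - m)" using submult[of m "n - m"] False by simp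
      also have "\<dots> \<le> l ^ m * (C * l ^ (n - m))"
        using False m l seq_pos by (intro mult_mono sm less) (auto intro: less_imp_le)
      also have "\<dots> = C * l ^ n" using False by (simp flip: power_add)
      finally show ?thesis .
    qed (rule below_m)
  qed
  moreover have "C > 0" using below_m[of 0] seq_pos[of 0] m by simp
  ultimately show ?thesis using that by blast
qed

end

lemma root_tendsto_growthI:
  fixes s :: "nat \<Rightarrow> real"
  assumes "0 < \<mu>"
    and upper: "\<And>l. \<mu> < l \<Longrightarrow> \<exists>C>0. \<forall>n. s n \<le> C * l ^ n"
    and lower: "\<And>r. 0 < r \<Longrightarrow> r < \<mu> \<Longrightarrow> \<exists>K>0. \<forall>n. K * r ^ n \<le> s n"
  shows "(\<lambda>n. root n (s n)) \<longlonglongrightarrow> \<mu>"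
proof (rule order_tendstoI)
  have root_geometric: "(\<lambda>n. root n (C * l ^ n)) \<longlonglongrightarrow> l" if "C > 0" "l > 0" for C l :: real
  proof (rule Lim_transform_eventually)
    show "(\<lambda>n. root n C * l) \<longlonglongrightarrow> l"
      using tendsto_mult[OF LIMSEQ_root_const[OF that(1)] tendsto_const[of l]] by simp
    show "\<forall>\<^sub>F n in sequentially. root n C * l = root n (C * l ^ n)"
      using eventually_gt_at_top[of 0]
      by eventually_elim (use that in \<open>simp add: real_root_mult real_root_power_cancel\<close>)
  qed
  fix a
  show "\<forall>\<^sub>F n in sequentially. root n (s n) < a" if a: "\<mu> < a"
  proof -
    obtain l where l: "\<mu> < l" "l < a" using a dense by blast
    then obtain C where C: "C > 0" "\<And>n. s n \<le> C * l ^ n" using upper by blast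
    have "\<forall>\<^sub>F n in sequentially. root n (C * l ^ n) < a"
      using l assms(1) C(1) by (intro order_tendstoD(2)[OF root_geometric]) auto
    then show ?thesis using eventually_gt_at_top[of 0]
      by eventually_elim (use C(2) in \<open>auto intro: le_less_trans[OF real_root_le_mono]\<close>)
  qed
  show "\<forall>\<^sub>F n in sequentially. a < root n (s n)" if a: "a < \<mu>"
  proof -
    obtain r where r: "max 0 a < r" "r < \<mu>" using a assms(1) dense[of "max 0 a" \<mu>] by auto
    then obtain K where K: "K > 0" "\<And>n. K * r ^ n \<le> s n" using lower[of r] by auto
    have "\<forall>\<^sub>F n in sequentially. a < root n (K * r ^ n)"
      using r K(1) by (intro order_tendstoD(1)[OF root_geometric]) auto
    then show ?thesis using eventually_gt_at_top[of 0]
      by eventually_elim (use K(2) in \<open>auto intro: less_le_trans[OF _ real_root_le_mono]\<close>)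
  qed
qed

section \<open>Self-avoiding walks and the connective constant\<close>

lemma successively_invariant:
  assumes "successively R xs" "xs \<noteq> [] \<Longrightarrow> P (hd xs)"
    and "\<And>x y. x \<in> set xs \<Longrightarrow> y \<in> set xs \<Longrightarrow> R x y \<Longrightarrow> P x \<Longrightarrow> P y"
  shows "\<forall>x\<in>set xs. P x"
  using assms
proof (induction xs rule: induct_list012)
  case (3 x y zs)
  have "P x" "R x y" using "3.prems"(1,2) by auto
  then have "P y" by (intro "3.prems"(3)[of x y]) auto
  then have "\<forall>z\<in>set (y # zs). P z" using "3.prems" by (intro "3.IH"(2)) auto
  with \<open>P x\<close> show ?case by simp
qed auto

definition saws :: "('v \<Rightarrow> 'v \<Rightarrow> bool) \<Rightarrow> 'v \<Rightarrow> nat \<Rightarrow> 'v list set" where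
  "saws E v n = {p. length p = Suc n \<and> hd p = v \<and> distinct p \<and> successively E p}"

definition saws_between :: "('v \<Rightarrow> 'v \<Rightarrow> bool) \<Rightarrow> 'v \<Rightarrow> 'v \<Rightarrow> 'v list set" where
  "saws_between E u v = {p. p \<noteq> [] \<and> hd p = u \<and> last p = v \<and> distinct p \<and> successively E p}"

lemma saw_count_eq_card: "saw_count E v n = card (saws E v n)"
  by (simp add: saw_count_def saws_def)

lemma saws_between_iff:
  "p \<in> saws_between E u v \<longleftrightarrow> p \<noteq> [] \<and> p \<in> saws E u (length p - 1) \<and> last p = v"
  by (auto simp: saws_between_def saws_def)

lemma saws_between_in_saws: "p \<in> saws_between E u v \<Longrightarrow> p \<in> saws E u (length p - 1)"
  by (simp add: saws_between_iff)

lemma saws_between_nonempty: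
  assumes "(u, v) \<in> {(a, b). E a b}\<^sup>*"
  shows "saws_between E u v \<noteq> {}"
  using assms
proof (induction rule: rtrancl_induct)
  case base
  have "[u] \<in> saws_between E u u" by (simp add: saws_between_def)
  then show ?case by blast
next
  case (step y z)
  then obtain p where p: "p \<in> saws_between E u y" by blast
  show ?case
  proof (cases "z \<in> set p")
    case False
    then have "p @ [z] \<in> saws_between E u z"
      using p step(2) by (auto simp: saws_between_def successively_append_iff)
    then show ?thesis by blast
  next
    case True
    then obtain q r where "p = q @ z # r" by (meson split_list)
    then have "q @ [z] \<in> saws_between E u z"
      using p by (cases q)
        (auto simp: saws_between_def successively_append_iff successively_Cons hd_append)
    then show ?thesis by blast
  qed
qed

lemma saws_take: "p \<in> saws E v n \<Longrightarrow> m \<le> n \<Longrightarrow> take (Suc m) p \<in> saws E v m"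
  using successively_append_iff[of E "take (Suc m) p" "drop (Suc m) p"] by (auto simp: saws_def)

lemma saws_drop: "p \<in> saws E v n \<Longrightarrow> m \<le> n \<Longrightarrow> drop m p \<in> saws E (p ! m) (n - m)"
  using successively_append_iff[of E "take m p" "drop m p"]
  by (auto simp: saws_def hd_drop_conv_nth)

lemma saws_0: "saws E v 0 = {[v]}"
  by (auto simp: saws_def length_Suc_conv)

lemma saws_Suc_subset: "saws E v (Suc n) \<subseteq> (\<Union>u\<in>{u. E v u}. Cons v ` saws E u n)"
  by (auto simp: saws_def length_Suc_conv)

lemma simple_graphD:
  assumes "simple_graph V E" "E u v"
  shows "u \<in> V" "v \<in> V" "E v u" "u \<noteq> v"
  using assms unfolding simple_graph_def by blast+

lemma successively_subset_verts:
  assumes "simple_graph V E" "successively E p" "p \<noteq> []" "hd p \<in> V"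
  shows "set p \<subseteq> V"
proof -
  have "\<forall>x\<in>set p. x \<in> V"
    using assms(2)
    by (rule successively_invariant) (use assms(4) simple_graphD(2)[OF assms(1)] in auto)
  then show ?thesis by blast
qed

lemma saws_subset_verts:
  assumes "simple_graph V E" "p \<in> saws E v n" "v \<in> V"
  shows "set p \<subseteq> V"
  using assms successively_subset_verts[of V E p] by (cases p) (auto simp: saws_def)

lemma map_aut_saws:
  assumes G: "simple_graph V E" and f: "aut V E f" and v: "v \<in> V" and p: "p \<in> saws E v n"
  shows "map f p \<in> saws E (f v) n"
proof -
  have pV: "set p \<subseteq> V" using G p v by (rule saws_subset_verts)
  have "successively E (map f p)"
    unfolding successively_map
    by (rule successively_mono[of E]) (use p pV f in \<open>auto simp: saws_def aut_def\<close>)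
  moreover have "inj_on f (set p)"
    using f pV by (auto simp: aut_def bij_betw_def intro: inj_on_subset)
  ultimately show ?thesis using p by (cases p) (auto simp: saws_def distinct_map)
qed

text \<open>Cut a walk from \<open>u\<close> at the first vertex \<open>x\<close> of a path from \<open>v\<close> to \<open>u\<close> that lies on it: the path
  up to \<open>x\<close> extends along either half of the walk to a self-avoiding walk from \<open>v\<close>.\<close>

lemma saws_recut:
  assumes G: "simple_graph V E" and P: "P \<in> saws_between E v u" and p: "p \<in> saws E u n"
  obtains i k a b where "i < length P" "k \<le> n" "a \<in> saws E v (i + k)" "b \<in> saws E v (i + (n - k))"
    "p = rev (drop i a) @ tl (drop i b)"
proof -
  have "u \<in> set P" using P by (auto simp: saws_between_def)
  moreover have "u \<in> set p" using p by (cases p) (auto simp: saws_def)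
  ultimately have "\<exists>x\<in>set P. x \<in> set p" by blast
  then obtain A x A' where A: "P = A @ x # A'" "x \<in> set p" "\<forall>y\<in>set A. y \<notin> set p"
    using split_list_first_prop[of P "\<lambda>x. x \<in> set p"] by blast
  obtain B C where B: "p = B @ x # C" using A(2) split_list by metis
  have "hd (A @ [x]) = v" using P A(1) by (cases A) (auto simp: saws_between_def)
  then have head: "hd (A @ x # D) = v" for D by (cases A) auto
  have saw_P: "distinct (A @ [x])" "successively E (A @ [x])"
    using P A(1) by (auto simp: saws_between_def successively_append_iff)
  have saw_p: "successively E (B @ [x])" "successively E (x # C)" "distinct p" "length p = Suc n"
    using p B by (auto simp: saws_def successively_append_iff)
  have "successively E (rev (B @ [x]))"
    unfolding successively_rev using saw_p(1)
    by (rule successively_mono) (rule simple_graphD(3)[OF G])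
  then have saw_back: "A @ x # rev B \<in> saws E v (length A + length B)"
    using head saw_P saw_p(3) A(3) B by (auto simp: saws_def successively_append_iff)
  have saw_on: "A @ x # C \<in> saws E v (length A + (n - length B))"
    using head saw_P saw_p(2-4) A(3) B by (auto simp: saws_def successively_append_iff)
  show ?thesis
    by (rule that[OF _ _ saw_back saw_on]) (use A(1) B saw_p(4) in auto)
qed

locale quasi_transitive_graph =
  fixes V :: "'v set" and E :: "'v \<Rightarrow> 'v \<Rightarrow> bool" and W :: "'v set"
  assumes simple: "simple_graph V E" and infinite_verts: "infinite V"
    and connected: "connected_graph V E" and fundamental: "fund_domain V E W"
    and locally_finite: "\<And>v. v \<in> V \<Longrightarrow> finite {u. E v u}"
begin

lemma adj_verts: "E u v \<Longrightarrow> u \<in> V" "E u v \<Longrightarrow> v \<in> V"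
  and adj_sym: "E u v \<Longrightarrow> E v u"
  using simple_graphD[OF simple] by blast+

lemma finite_W: "finite W" and W_subset: "W \<subseteq> V"
  using fundamental by (auto simp: fund_domain_def)

lemma W_nonempty: "W \<noteq> {}"
  using fundamental infinite_verts by (auto simp: fund_domain_def)

lemma last_saw_in_verts: "p \<in> saws E v n \<Longrightarrow> v \<in> V \<Longrightarrow> last p \<in> V"
  using saws_subset_verts[OF simple, of p v n] last_in_set[of p] by (cases p) (auto simp: saws_def)

lemma finite_saws: "v \<in> V \<Longrightarrow> finite (saws E v n)"
proof (induction n arbitrary: v)
  case (Suc n)
  then have "finite (\<Union>u\<in>{u. E v u}. Cons v ` saws E u n)"
    using locally_finite adj_verts by auto
  then show ?case by (rule finite_subset[OF saws_Suc_subset])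
qed (simp add: saws_0)

lemma saw_count_pos:
  assumes v: "v \<in> V"
  shows "saw_count E v n > 0"
proof (rule ccontr)
  assume "\<not> saw_count E v n > 0"
  then have none: "saws E v n = {}" using finite_saws[OF v] by (simp add: saw_count_eq_card)
  have "V \<subseteq> (\<Union>k<n. last ` saws E v k)"
  proof
    fix u assume "u \<in> V"
    then obtain p where p: "p \<in> saws_between E v u"
      using connected v saws_between_nonempty[of v u E] by (auto simp: connected_graph_def)
    then have "length p - 1 < n"
      using saws_take[OF saws_between_in_saws[OF p], of n] none by (metis empty_iff not_le)
    moreover have "u = last p" using p by (simp add: saws_between_def)
    ultimately show "u \<in> (\<Union>k<n. last ` saws E v k)" using saws_between_in_saws[OF p] by blast
  qed
  moreover have "finite (\<Union>k<n. last ` saws E v k)" using finite_saws[OF v] by auto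
  ultimately show False using infinite_verts finite_subset by blast
qed

lemma saw_count_le_aut:
  assumes f: "aut V E f" and v: "v \<in> V"
  shows "saw_count E v n \<le> saw_count E (f v) n"
proof -
  have inj: "inj_on f V" and fv: "f v \<in> V" using f v by (auto simp: aut_def bij_betw_def)
  have "inj_on (map f) (saws E v n)"
    using saws_subset_verts[OF simple _ v] by (intro inj_on_mapI inj_on_subset[OF inj]) blast
  then show ?thesis
    unfolding saw_count_eq_card
    using map_aut_saws[OF simple f v] by (intro card_inj_on_le[of "map f"] finite_saws fv) auto
qed

definition max_saw_count :: "nat \<Rightarrow> nat" where
  "max_saw_count n = (MAX w\<in>W. saw_count E w n)"

lemma saw_count_le_max:
  assumes "v \<in> V"
  shows "saw_count E v n \<le> max_saw_count n"
proof -
  obtain f where f: "aut V E f" "f v \<in> W" using fundamental assms by (auto simp: fund_domain_def)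
  have "saw_count E v n \<le> saw_count E (f v) n" using f(1) assms by (rule saw_count_le_aut)
  also have "\<dots> \<le> max_saw_count n" unfolding max_saw_count_def
    using f finite_W by (intro Max_ge) auto
  finally show ?thesis .
qed

lemma max_saw_count_attained:
  obtains u where "u \<in> W" "max_saw_count n = saw_count E u n"
proof -
  have "max_saw_count n \<in> (\<lambda>w. saw_count E w n) ` W"
    unfolding max_saw_count_def using finite_W W_nonempty by (intro Max_in) auto
  then show ?thesis using that by blast
qed

lemma saw_count_add_le:
  assumes v: "v \<in> V"
  shows "saw_count E v (m + n) \<le> saw_count E v m * max_saw_count n"
proof -
  let ?split = "\<lambda>p. (take (Suc m) p, drop m p)"
  let ?S = "SIGMA p:saws E v m. saws E (last p) n"
  have last_V: "last p \<in> V" if "p \<in> saws E v m" for p using that v by (rule last_saw_in_verts)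
  have finite_S: "finite ?S" using last_V finite_saws v by auto
  have "inj_on ?split (saws E v (m + n))"
  proof (rule inj_onI)
    fix p q :: "'v list" assume eq: "?split p = ?split q"
    then have "drop (Suc m) p = drop (Suc m) q" by (metis drop_Suc prod.inject tl_drop)
    with eq show "p = q" by (metis append_take_drop_id prod.inject)
  qed
  moreover have "?split ` saws E v (m + n) \<subseteq> ?S"
  proof clarify
    fix p assume p: "p \<in> saws E v (m + n)"
    then have "last (take (Suc m) p) = p ! m" by (auto simp: saws_def take_Suc_conv_app_nth)
    then show "take (Suc m) p \<in> saws E v m \<and> drop m p \<in> saws E (last (take (Suc m) p)) n"
      using saws_take[OF p, of m] saws_drop[OF p, of m] by simp
  qed
  ultimately have "saw_count E v (m + n) \<le> card ?S"
    unfolding saw_count_eq_card by (intro card_inj_on_le finite_S)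
  also have "\<dots> = (\<Sum>p\<in>saws E v m. saw_count E (last p) n)"
    using last_V finite_saws v by (subst card_SigmaI) (auto simp: saw_count_eq_card)
  also have "\<dots> \<le> (\<Sum>p\<in>saws E v m. max_saw_count n)" using last_V by (intro sum_mono saw_count_le_max)
  finally show ?thesis by (simp add: saw_count_eq_card)
qed

sublocale submultiplicative_seq "\<lambda>n. real (max_saw_count n)"
proof
  show "0 < real (max_saw_count n)" for n
    using max_saw_count_attained[of n] saw_count_pos W_subset by (metis of_nat_0_less_iff subsetD)
  show "real (max_saw_count (m + n)) \<le> real (max_saw_count m) * real (max_saw_count n)" for m n
  proof -
    obtain u where u: "u \<in> W" "max_saw_count (m + n) = saw_count E u (m + n)"
      by (rule max_saw_count_attained)
    have uV: "u \<in> V" using u W_subset by auto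
    have "max_saw_count (m + n) \<le> max_saw_count m * max_saw_count n"
      unfolding u(2) using saw_count_add_le[OF uV] saw_count_le_max[OF uV, of m]
      by (meson mult_le_mono1 order_trans)
    then show ?thesis by (simp flip: of_nat_mult)
  qed
qed

abbreviation \<mu> :: real where "\<mu> \<equiv> growth_rate"

lemma mu_ge_1: "\<mu> \<ge> 1"
  unfolding growth_rate_def using seq_pos by (intro cINF_greatest) (auto simp: Suc_leI)

lemma mu_pos: "\<mu> > 0"
  using mu_ge_1 by simp

lemma saw_count_le_convolution:
  assumes P: "P \<in> saws_between E v u" and v: "v \<in> V"
  shows "saw_count E u n \<le>
    (\<Sum>i<length P. max_saw_count i * max_saw_count i) *
    (\<Sum>k\<le>n. saw_count E v k * saw_count E v (n - k))"
proof -
  let ?I = "{..<length P} \<times> {..n}"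
  let ?S = "\<lambda>(i, k). saws E v (i + k) \<times> saws E v (i + (n - k))"
  let ?join = "\<lambda>i (a, b). rev (drop i a) @ tl (drop i b)"
  have finite_S: "finite (?S ik)" for ik by (cases ik) (simp add: finite_saws v)
  have "saws E u n \<subseteq> (\<Union>ik\<in>?I. ?join (fst ik) ` ?S ik)"
  proof
    fix p assume "p \<in> saws E u n"
    then obtain i k a b where "i < length P" "k \<le> n" "a \<in> saws E v (i + k)"
      "b \<in> saws E v (i + (n - k))" "p = rev (drop i a) @ tl (drop i b)"
      by (rule saws_recut[OF simple P])
    then show "p \<in> (\<Union>ik\<in>?I. ?join (fst ik) ` ?S ik)"
      by (intro UN_I[of "(i, k)"] image_eqI[of _ _ "(a, b)"]) auto
  qed
  then have "saw_count E u n \<le> card (\<Union>ik\<in>?I. ?join (fst ik) ` ?S ik)"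
    unfolding saw_count_eq_card using finite_S by (intro card_mono) auto
  also have "\<dots> \<le> (\<Sum>ik\<in>?I. card (?S ik))"
    using finite_S by (intro order_trans[OF card_UN_le] sum_mono card_image_le) auto
  also have "\<dots> = (\<Sum>(i, k)\<in>?I. saw_count E v (i + k) * saw_count E v (i + (n - k)))"
    by (intro sum.cong) (auto simp: saw_count_eq_card card_cartesian_product)
  also have "\<dots> \<le> (\<Sum>(i, k)\<in>?I.
      (max_saw_count i * max_saw_count i) * (saw_count E v k * saw_count E v (n - k)))"
  proof (intro sum_mono, clarify)
    fix i k
    have "saw_count E v (k + i) * saw_count E v ((n - k) + i)
        \<le> (saw_count E v k * max_saw_count i) * (saw_count E v (n - k) * max_saw_count i)"
      by (intro mult_le_mono saw_count_add_le v)
    then show "saw_count E v (i + k) * saw_count E v (i + (n - k))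
        \<le> (max_saw_count i * max_saw_count i) * (saw_count E v k * saw_count E v (n - k))"
      by (simp add: ac_simps)
  qed
  also have "\<dots> = (\<Sum>i<length P. max_saw_count i * max_saw_count i) *
      (\<Sum>k\<le>n. saw_count E v k * saw_count E v (n - k))"
    by (simp add: sum_product sum.cartesian_product)
  finally show ?thesis .
qed

lemma max_saw_count_le_convolution:
  assumes v: "v \<in> V"
  obtains B where "\<And>n. max_saw_count n \<le> B * (\<Sum>k\<le>n. saw_count E v k * saw_count E v (n - k))"
proof -
  have "\<exists>P. P \<in> saws_between E v u" if "u \<in> W" for u
    using connected v W_subset that saws_between_nonempty[of v u E]
    by (auto simp: connected_graph_def)
  then obtain P where P: "\<And>u. u \<in> W \<Longrightarrow> P u \<in> saws_between E v u" by metis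
  define b where "b u = (\<Sum>i<length (P u). max_saw_count i * max_saw_count i)" for u
  have "max_saw_count n \<le> (\<Sum>u\<in>W. b u) * (\<Sum>k\<le>n. saw_count E v k * saw_count E v (n - k))" for n
  proof -
    obtain u where u: "u \<in> W" "max_saw_count n = saw_count E u n" by (rule max_saw_count_attained)
    have "max_saw_count n \<le> b u * (\<Sum>k\<le>n. saw_count E v k * saw_count E v (n - k))"
      unfolding u(2) b_def using P[OF u(1)] v by (rule saw_count_le_convolution)
    also have "\<dots> \<le> (\<Sum>u\<in>W. b u) * (\<Sum>k\<le>n. saw_count E v k * saw_count E v (n - k))"
      using u(1) finite_W by (intro mult_le_mono1 member_le_sum) auto
    finally show ?thesis .
  qed
  then show ?thesis using that by blast
qed

lemma saw_count_upper:
  assumes "v \<in> V" "\<mu> < l"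
  shows "\<exists>C>0. \<forall>n. real (saw_count E v n) \<le> C * l ^ n"
proof -
  obtain C where "C > 0" "\<And>n. real (max_saw_count n) \<le> C * l ^ n"
    using growth_bound[OF assms(2)] by blast
  then show ?thesis using saw_count_le_max[OF assms(1)] by (meson of_nat_le_iff order_trans)
qed

lemma saw_count_mult_le:
  assumes v: "v \<in> V" and C: "\<And>n. real (max_saw_count n) \<le> C * l ^ n" and k: "k \<le> 2 * m"
    and nonneg: "C \<ge> 0" "l \<ge> 0"
  shows "real (saw_count E v k * saw_count E v (2 * m - k))
      \<le> C * C * l ^ m * real (saw_count E v m)"
proof -
  have le: "real (saw_count E v j * saw_count E v (2 * m - j))
      \<le> C * C * l ^ m * real (saw_count E v m)"
    if j: "m \<le> j" "j \<le> 2 * m" for j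
  proof -
    have "saw_count E v j \<le> saw_count E v m * max_saw_count (j - m)"
      using saw_count_add_le[OF v, of m "j - m"] j by simp
    then have "saw_count E v j * saw_count E v (2 * m - j)
        \<le> (saw_count E v m * max_saw_count (j - m)) * max_saw_count (2 * m - j)"
      by (intro mult_le_mono saw_count_le_max v)
    then have "real (saw_count E v j * saw_count E v (2 * m - j))
        \<le> real (saw_count E v m) * real (max_saw_count (j - m)) * real (max_saw_count (2 * m - j))"
      by (simp flip: of_nat_mult)
    also have "\<dots> \<le> real (saw_count E v m) * (C * l ^ (j - m)) * (C * l ^ (2 * m - j))"
      using nonneg by (intro mult_mono C) auto
    also have "\<dots> = C * C * (l ^ (j - m) * l ^ (2 * m - j)) * real (saw_count E v m)" by simp
    also have "l ^ (j - m) * l ^ (2 * m - j) = l ^ m" using j by (simp flip: power_add)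
    finally show ?thesis .
  qed
  show ?thesis
  proof (cases "m \<le> k")
    case False
    then show ?thesis using le[of "2 * m - k"] k by (simp add: mult.commute)
  qed (use le k in blast)
qed

text \<open>Every term of the convolution bounding \<open>max_saw_count (2 * m) \<ge> \<mu> ^ (2 * m)\<close> has a factor of
  length at least \<open>m\<close>, which reduces it to \<open>saw_count E v m\<close> at the cost of a factor \<open>l ^ m\<close>.\<close>

lemma saw_count_lower:
  assumes v: "v \<in> V" and r: "0 < r" "r < \<mu>"
  shows "\<exists>K>0. \<forall>n. K * r ^ n \<le> real (saw_count E v n)"
proof -
  have "\<mu> < \<mu> * \<mu> / r" using r by (simp add: field_simps)
  then obtain l where l: "\<mu> < l" "l < \<mu> * \<mu> / r" using dense by blast
  have l0: "l > 0" using l(1) mu_pos by simp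
  define q where "q = \<mu> * \<mu> / (l * r)"
  have q: "q > 1" using l r l0 by (simp add: q_def field_simps)
  obtain C where C: "C > 0" "\<And>n. real (max_saw_count n) \<le> C * l ^ n"
    using growth_bound[OF l(1)] by blast
  obtain B where B: "\<And>n. max_saw_count n \<le> B * (\<Sum>k\<le>n. saw_count E v k * saw_count E v (n - k))"
    using max_saw_count_le_convolution[OF v] by blast
  define D where "D = (real B + 1) * (C * C) * (1 + 2 / (q - 1))"
  have D: "D > 0" using C(1) q by (simp add: D_def add_pos_pos)
  have "r ^ m \<le> D * real (saw_count E v m)" for m
  proof -
    let ?c = "real (saw_count E v m)"
    have "1 + real m * (q - 1) \<le> q ^ m" using Bernoulli_inequality[of "q - 1" m] q by simp
    then have "real m \<le> q ^ m / (q - 1)" using q by (simp add: field_simps)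
    moreover have "1 \<le> q ^ m" using q by simp
    ultimately have "real (2 * m + 1) \<le> q ^ m + 2 * (q ^ m / (q - 1))" by simp
    then have linear: "real (2 * m + 1) \<le> (1 + 2 / (q - 1)) * q ^ m" by (simp add: algebra_simps)
    have "(\<mu> * \<mu>) ^ m \<le> real (max_saw_count (2 * m))"
      using growth_rate_power_le[of "2 * m"] by (simp add: power_mult power2_eq_square)
    also have "\<dots> \<le> real B * (\<Sum>k\<le>2 * m. real (saw_count E v k * saw_count E v (2 * m - k)))"
      using B[of "2 * m"] by (simp flip: of_nat_mult of_nat_sum)
    also have "\<dots> \<le> real B * (\<Sum>k\<le>2 * m. C * C * l ^ m * ?c)"
      using C l0 by (intro mult_left_mono sum_mono saw_count_mult_le v) auto
    also have "\<dots> = real B * (C * C) * l ^ m * ?c * real (2 * m + 1)" by simp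
    also have "\<dots> \<le> (real B + 1) * (C * C) * l ^ m * ?c * ((1 + 2 / (q - 1)) * q ^ m)"
      using C(1) l0 q by (intro mult_mono linear) auto
    also have "\<dots> = D * ?c * (l * q) ^ m" by (simp add: D_def power_mult_distrib)
    also have "\<mu> * \<mu> = r * (l * q)" using l0 r by (simp add: q_def)
    finally have "r ^ m * (l * q) ^ m \<le> D * ?c * (l * q) ^ m"
      by (simp only: power_mult_distrib[of r])
    then show ?thesis by (rule mult_right_le_imp_le) (use l0 q in simp)
  qed
  then show ?thesis using D by (intro exI[of _ "1 / D"]) (auto simp: field_simps)
qed

theorem root_saw_count_tendsto: "v \<in> V \<Longrightarrow> (\<lambda>n. root n (real (saw_count E v n))) \<longlonglongrightarrow> \<mu>"
  using mu_pos saw_count_upper saw_count_lower by (intro root_tendsto_growthI) auto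

lemma conn_const_eq: "conn_const V E = \<mu>"
proof -
  obtain v where v: "v \<in> V" using infinite_verts by (metis finite.emptyI ex_in_conv)
  show ?thesis unfolding conn_const_def
    by (rule the_equality) (use v root_saw_count_tendsto LIMSEQ_unique in blast)+
qed

end

section \<open>Walks with mid-edges\<close>

lemma edge_setI: "E u v \<Longrightarrow> {u, v} \<in> edge_set E"
  by (auto simp: edge_set_def)

lemma edge_set_obtain_neighbour:
  assumes "simple_graph V E" "e \<in> edge_set E" "v \<in> e"
  obtains u where "e = {v, u}" "E v u"
proof -
  obtain a b where ab: "e = {a, b}" "E a b" using assms(2) by (auto simp: edge_set_def)
  then consider "v = a" | "v = b" using assms(3) by auto
  then show ?thesis
  proof cases
    case 2
    then show ?thesis using ab simple_graphD(3)[OF assms(1) ab(2)] by (intro that[of a]) auto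
  qed (use ab that in blast)
qed

lemma edge_set_cards:
  assumes "e \<in> edge_set E"
  shows "finite e" "e \<noteq> {}" "card e \<le> 2"
  using assms by (auto simp: edge_set_def card_insert_if)

lemma edge_subset_verts: "simple_graph V E \<Longrightarrow> e \<in> edge_set E \<Longrightarrow> e \<subseteq> V"
  by (auto simp: edge_set_def dest: simple_graphD)

lemma inc_edges_subset: "inc_edges E W \<subseteq> edge_set E"
  by (auto simp: inc_edges_def)

fun subdivide :: "'v list \<Rightarrow> 'v pos list" where
  "subdivide [] = []"
| "subdivide [v] = [Vx v]"
| "subdivide (u # v # vs) = Vx u # Md {u, v} # subdivide (v # vs)"

fun visited :: "'v pos list \<Rightarrow> 'v list" where
  "visited [] = []"
| "visited (Vx v # p) = v # visited p"
| "visited (Md e # p) = visited p"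

lemma wlen_simps [simp]:
  "wlen [] = 0" "wlen (Vx v # p) = Suc (wlen p)" "wlen (Md e # p) = wlen p"
  "wlen (p @ q) = wlen p + wlen q"
  by (auto simp: wlen_def)

lemma wlen_le_length: "wlen p \<le> length p"
  by (simp add: wlen_def)

lemma length_visited: "length (visited p) = wlen p"
  by (induction p rule: visited.induct) auto

lemma visited_subdivide [simp]: "visited (subdivide vs) = vs"
  by (induction vs rule: subdivide.induct) auto

lemma wlen_subdivide [simp]: "wlen (subdivide vs) = length vs"
  by (metis length_visited visited_subdivide)

lemma subdivide_eq_iff [simp]: "subdivide vs = subdivide ws \<longleftrightarrow> vs = ws"
  by (metis visited_subdivide)

lemma subdivide_eq_Nil_iff [simp]: "subdivide vs = [] \<longleftrightarrow> vs = []"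
  by (metis subdivide.simps(1) subdivide_eq_iff)

lemma hd_subdivide [simp]: "vs \<noteq> [] \<Longrightarrow> hd (subdivide vs) = Vx (hd vs)"
  by (cases vs rule: subdivide.cases) auto

lemma last_subdivide [simp]: "vs \<noteq> [] \<Longrightarrow> last (subdivide vs) = Vx (last vs)"
  by (induction vs rule: subdivide.induct) auto

lemma Vx_in_subdivide_iff [simp]: "Vx v \<in> set (subdivide vs) \<longleftrightarrow> v \<in> set vs"
  by (induction vs rule: subdivide.induct) auto

lemma Md_in_subdivide_subset: "Md e \<in> set (subdivide vs) \<Longrightarrow> e \<subseteq> set vs"
  by (induction vs rule: subdivide.induct) auto

lemma distinct_subdivide: "distinct vs \<Longrightarrow> distinct (subdivide vs)"
  by (induction vs rule: subdivide.induct) (auto dest: Md_in_subdivide_subset)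

lemma successively_subdivide: "successively E vs \<Longrightarrow> successively (step_ok E) (subdivide vs)"
  by (induction vs rule: subdivide.induct) (auto simp: successively_Cons intro: edge_setI)

lemma step_ok_sym: "step_ok E a b \<Longrightarrow> step_ok E b a"
  by (cases a; cases b) auto

lemma step_okE:
  assumes "step_ok E a b"
  obtains (leave) v e where "a = Vx v" "b = Md e" "e \<in> edge_set E" "v \<in> e"
    | (enter) e v where "a = Md e" "b = Vx v" "e \<in> edge_set E" "v \<in> e"
  using assms by (cases a; cases b) auto

fun pos_in_graph :: "'v set \<Rightarrow> ('v \<Rightarrow> 'v \<Rightarrow> bool) \<Rightarrow> 'v pos \<Rightarrow> bool" where
  "pos_in_graph V E (Vx v) \<longleftrightarrow> v \<in> V"
| "pos_in_graph V E (Md e) \<longleftrightarrow> e \<in> edge_set E"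

lemma mid_saw_in_graph:
  assumes "simple_graph V E" "mid_saw E p" "hd p = Md e" "e \<in> edge_set E"
  shows "\<forall>x\<in>set p. pos_in_graph V E x"
proof (rule successively_invariant)
  show "successively (step_ok E) p" using assms(2) by (simp add: mid_saw_def)
  show "pos_in_graph V E y" if "step_ok E x y" for x y
    using that edge_subset_verts[OF assms(1)] by (cases rule: step_okE) auto
qed (use assms(3,4) in simp)

definition optional_mid :: "('v \<Rightarrow> 'v \<Rightarrow> bool) \<Rightarrow> 'v \<Rightarrow> 'v pos list set" where
  "optional_mid E v = insert [] ((\<lambda>e. [Md e]) ` inc_edges E {v})"

lemma walk_from_vertex_decompose:
  assumes G: "simple_graph V E"
    and "successively (step_ok E) p" "distinct p" "p \<noteq> []" "hd p = Vx v"
  obtains u vs t where "vs \<in> saws_between E v u" "t \<in> optional_mid E u" "p = subdivide vs @ t"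
proof -
  have "\<exists>u. \<exists>vs\<in>saws_between E v u. \<exists>t\<in>optional_mid E u. p = subdivide vs @ t"
    using assms(2-)
  proof (induction p arbitrary: v rule: induct_list012)
    case (2 x)
    have "[v] \<in> saws_between E v v" "[] \<in> optional_mid E v"
      by (auto simp: saws_between_def optional_mid_def)
    then show ?case using 2 by (intro exI[of _ v] bexI[of _ "[v]"] bexI[of _ "[]"]) auto
  next
    case (3 x y zs)
    obtain f where f: "x = Vx v" "y = Md f" "f \<in> edge_set E" "v \<in> f"
      using "3.prems" by (cases y) auto
    show ?case
    proof (cases zs)
      case Nil
      have "[v] \<in> saws_between E v v" "[Md f] \<in> optional_mid E v"
        using f by (auto simp: saws_between_def optional_mid_def inc_edges_def)
      then show ?thesis using f Nil by (intro exI[of _ v] bexI[of _ "[v]"] bexI[of _ "[Md f]"]) auto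
    next
      case (Cons z zs')
      obtain w where w: "z = Vx w" "w \<in> f" "w \<noteq> v" using "3.prems" f Cons by (cases z) auto
      obtain w' where "f = {v, w'}" "E v w'" using edge_set_obtain_neighbour[OF G f(3,4)] .
      then have vw: "f = {v, w}" "E v w" using w by auto
      obtain u vs t where IH: "vs \<in> saws_between E w u" "t \<in> optional_mid E u"
        "zs = subdivide vs @ t"
        using "3.IH"(1)[of w] "3.prems" Cons w by (auto simp: successively_Cons)
      then have "v # vs \<in> saws_between E v u"
        using "3.prems"(2) f(1) vw(2) by (auto simp: saws_between_def successively_Cons)
      moreover have "x # y # zs = subdivide (v # vs) @ t"
        using IH f vw(1) by (cases vs) (auto simp: saws_between_def)
      ultimately show ?thesis using IH(2) by metis
    qed
  qed simp
  then show ?thesis using that by blast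
qed

lemma Sig_decompose:
  assumes G: "simple_graph V E" and p: "p \<in> Sig E W"
  obtains (mid) e where "e \<in> inc_edges E W" "p = [Md e]"
    | (walk) e v n vs t where "e \<in> inc_edges E W" "v \<in> e" "vs \<in> saws E v n"
        "t \<in> optional_mid E (last vs)" "p = Md e # subdivide vs @ t"
proof -
  obtain e q where e: "e \<in> inc_edges E W" "p = Md e # q" "mid_saw E p"
    using p by (cases p) (auto simp: Sig_def mid_saw_def)
  show ?thesis
  proof (cases q)
    case (Cons x r)
    then obtain v where v: "x = Vx v" "v \<in> e" using e by (cases x) (auto simp: mid_saw_def)
    have q: "successively (step_ok E) q" "distinct q" "q \<noteq> []" "hd q = Vx v"
      using e Cons v by (auto simp: mid_saw_def)
    obtain u vs t where vs: "vs \<in> saws_between E v u" "t \<in> optional_mid E u" "q = subdivide vs @ t"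
      using walk_from_vertex_decompose[OF G q] .
    moreover have "last vs = u" using vs(1) by (simp add: saws_between_def)
    ultimately show ?thesis using walk[OF e(1) v(2) saws_between_in_saws[OF vs(1)]] e(2) by simp
  qed (use e mid in blast)
qed

section \<open>Weighted sums over walks\<close>

text \<open>The maximum replaces the convention that the denominator is 1 for walks of length 0.\<close>

definition weight :: "real \<Rightarrow> real \<Rightarrow> nat \<Rightarrow> real" where
  "weight x y n = x ^ n * real (max 1 n) powr - y"

definition walk_sum :: "real \<Rightarrow> real \<Rightarrow> 'v pos list set \<Rightarrow> ennreal" where
  "walk_sum x y S = (\<Sum>\<^sub>\<infinity>p\<in>S. ennreal (weight x y (wlen p)))"

definition walks_between :: "('v \<Rightarrow> 'v \<Rightarrow> bool) \<Rightarrow> 'v set set \<Rightarrow> 'v set set \<Rightarrow> 'v pos list set" where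
  "walks_between E X T = {p. mid_saw E p \<and> hd p \<in> Md ` X \<and> last p \<in> Md ` T}"

lemma weight_nonneg: "0 \<le> x \<Longrightarrow> 0 \<le> weight x y n"
  by (simp add: weight_def)

lemma weight_0: "weight x 0 n = x ^ n"
  by (simp add: weight_def)

lemma walk_sum_mono: "S \<subseteq> T \<Longrightarrow> walk_sum x y S \<le> walk_sum x y T"
  unfolding walk_sum_def by (rule infsum_mono_set_ennreal)

lemma Yfun_eq_walk_sum: "Yfun E W x y = walk_sum x y (Sig E W)"
  unfolding Yfun_def walk_sum_def weight_def
  by (intro infsum_cong) (auto simp: powr_minus divide_inverse max_def)

lemma Zfun_eq_walk_sum:
  "Zfun E W \<alpha> x = walk_sum x 0 (walks_between E (inc_edges E W) ((`) \<alpha> ` inc_edges E W))"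
proof -
  have "{p \<in> Sig E W. \<exists>e\<in>inc_edges E W. last p = Md (\<alpha> ` e)}
    = walks_between E (inc_edges E W) ((`) \<alpha> ` inc_edges E W)"
    by (auto simp: Sig_def walks_between_def)
  then show ?thesis by (simp add: Zfun_def walk_sum_def weight_0)
qed

lemma walks_between_subset_Sig: "walks_between E (inc_edges E W) T \<subseteq> Sig E W"
  by (auto simp: walks_between_def Sig_def)

lemma powr_le_of_comparable:
  fixes a b K z :: real
  assumes "a > 0" "b > 0" "a \<le> K * b" "b \<le> K * a"
  shows "a powr z \<le> K powr \<bar>z\<bar> * b powr z"
proof -
  have K: "K > 0" using assms by (metis less_le_trans zero_less_mult_pos2)
  show ?thesis
  proof (cases "z \<ge> 0")
    case True
    have "a powr z \<le> (K * b) powr z" using assms True by (intro powr_mono2) auto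
    then show ?thesis using assms K True by (simp add: powr_mult)
  next
    case False
    have "a powr z \<le> (b / K) powr z"
      using assms K False by (intro powr_mono2') (auto simp: field_simps)
    also have "\<dots> = K powr \<bar>z\<bar> * b powr z"
      using assms K False by (simp add: powr_divide powr_minus field_simps)
    finally show ?thesis .
  qed
qed

lemma max_1_powr_le_of_comparable:
  assumes "m \<le> K * max 1 n" "n \<le> K * max 1 m" "K \<ge> 1"
  shows "real (max 1 m) powr z \<le> real K powr \<bar>z\<bar> * real (max 1 n) powr z"
proof (rule powr_le_of_comparable)
  have "1 \<le> K * max 1 k" for k using assms(3) by (metis max.cobounded1 mult_le_mono nat_mult_1)
  then have "max 1 m \<le> K * max 1 n" "max 1 n \<le> K * max 1 m"
    using assms(1,2) by (metis max.bounded_iff)+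
  then show "real (max 1 m) \<le> real K * real (max 1 n)" "real (max 1 n) \<le> real K * real (max 1 m)"
    by (simp_all only: of_nat_le_iff flip: of_nat_mult)
qed auto

definition weight_shift :: "real \<Rightarrow> real \<Rightarrow> nat \<Rightarrow> real" where
  "weight_shift x y L = max 1 x ^ L * real (1 + L) powr \<bar>y\<bar>"

lemma weight_shift_nonneg: "0 \<le> weight_shift x y L"
  by (simp add: weight_shift_def)

lemma weight_le_shift:
  assumes x: "x > 0" and mn: "m \<le> n" "n \<le> m + L"
  shows "weight x y n \<le> weight_shift x y L * weight x y m"
proof -
  obtain a where a: "n = m + a" "a \<le> L" using mn by (metis add_le_cancel_left le_iff_add)
  have "x ^ a \<le> max 1 x ^ a" using x by (intro power_mono) auto
  also have "\<dots> \<le> max 1 x ^ L" using a by (intro power_increasing) auto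
  finally have power_le: "x ^ n \<le> max 1 x ^ L * x ^ m"
    using a x by (simp add: power_add mult.commute)
  have "n \<le> max 1 m + L" using mn by simp
  also have "\<dots> \<le> (1 + L) * max 1 m" by simp
  finally have "m \<le> (1 + L) * max 1 n" "n \<le> (1 + L) * max 1 m" using mn by auto
  then have "real (max 1 n) powr - y \<le> real (1 + L) powr \<bar>- y\<bar> * real (max 1 m) powr - y"
    by (intro max_1_powr_le_of_comparable) auto
  then have "weight x y n
      \<le> (max 1 x ^ L * x ^ m) * (real (1 + L) powr \<bar>- y\<bar> * real (max 1 m) powr - y)"
    unfolding weight_def using power_le x by (intro mult_mono) auto
  then show ?thesis by (simp add: weight_def weight_shift_def ac_simps)
qed

lemma walk_sum_le_bounded_fibres:
  assumes x: "x > 0" and h: "h ` S \<subseteq> T"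
    and fibres: "\<And>q. q \<in> T \<Longrightarrow> finite {p \<in> S. h p = q}" "\<And>q. q \<in> T \<Longrightarrow> card {p \<in> S. h p = q} \<le> K"
    and wlen: "\<And>p. p \<in> S \<Longrightarrow> wlen (h p) \<le> wlen p" "\<And>p. p \<in> S \<Longrightarrow> wlen p \<le> wlen (h p) + L"
  shows "walk_sum x y S \<le> ennreal (real K * weight_shift x y L) * walk_sum x y T"
proof -
  have "walk_sum x y S \<le> of_nat K * ennreal (weight_shift x y L) * walk_sum x y T"
    unfolding walk_sum_def
  proof (rule infsum_le_bounded_fibres_ennreal[OF h fibres])
    fix p assume "p \<in> S"
    then show "ennreal (weight x y (wlen p))
        \<le> ennreal (weight_shift x y L) * ennreal (weight x y (wlen (h p)))"
      using x wlen weight_le_shift weight_shift_nonneg weight_nonneg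
      by (simp add: ennreal_mult[symmetric] ennreal_leI)
  qed
  also have "of_nat K * ennreal (weight_shift x y L) = ennreal (real K * weight_shift x y L)"
    using weight_shift_nonneg by (simp add: ennreal_mult ennreal_of_nat_eq_real_of_nat)
  finally show ?thesis .
qed

text \<open>A walk in \<open>Sig E W\<close> ends at a mid-edge or one step after one.\<close>

definition drop_last_vertex :: "'v pos list \<Rightarrow> 'v pos list" where
  "drop_last_vertex p = (if is_Vx (last p) then butlast p else p)"

lemma drop_last_vertex_in_walks_between:
  assumes G: "simple_graph V E" and p: "p \<in> Sig E W"
  obtains f where "f \<in> edge_set E" "last (drop_last_vertex p) = Md f"
    "drop_last_vertex p \<in> walks_between E (inc_edges E W) (edge_set E)"
    "p \<in> insert (drop_last_vertex p) ((\<lambda>u. drop_last_vertex p @ [Vx u]) ` f)"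
proof -
  have m: "mid_saw E p" "p \<noteq> []" using p by (auto simp: Sig_def mid_saw_def)
  obtain e where e: "e \<in> inc_edges E W" "hd p = Md e" using p by (auto simp: Sig_def)
  show ?thesis
  proof (cases "last p")
    case (Md f)
    then have "pos_in_graph V E (Md f)"
      using mid_saw_in_graph[OF G m(1) e(2)] e(1) inc_edges_subset last_in_set[OF m(2)] by fastforce
    then show ?thesis using Md m e
      by (intro that[of f]) (auto simp: drop_last_vertex_def walks_between_def)
  next
    case (Vx u)
    then obtain q where q: "p = q @ [Vx u]" using m(2) by (metis append_butlast_last_id)
    then have "q \<noteq> []" using e(2) by auto
    then have mid: "step_ok E (last q) (Vx u)" "mid_saw E q" "hd q = Md e"
      using m e(2) q by (auto simp: mid_saw_def successively_append_iff)
    from mid(1) show ?thesis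
    proof (cases rule: step_okE)
      case (enter f v)
      then show ?thesis using q e(1) mid(2,3)
        by (intro that[of f]) (auto simp: drop_last_vertex_def walks_between_def)
    qed simp
  qed
qed

lemma walk_sum_Sig_le:
  assumes G: "simple_graph V E" and x: "x > 0"
  shows "walk_sum x y (Sig E W)
    \<le> ennreal (3 * weight_shift x y 1) *
      walk_sum x y (walks_between E (inc_edges E W) (edge_set E))"
proof -
  have fibre: "finite {p \<in> Sig E W. drop_last_vertex p = q}
      \<and> card {p \<in> Sig E W. drop_last_vertex p = q} \<le> 3"
    if q: "q \<in> walks_between E (inc_edges E W) (edge_set E)" for q
  proof -
    obtain f where f: "f \<in> edge_set E" "last q = Md f" using q by (auto simp: walks_between_def)
    have "{p \<in> Sig E W. drop_last_vertex p = q} \<subseteq> insert q ((\<lambda>u. q @ [Vx u]) ` f)"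
      using f(2) by (auto elim: drop_last_vertex_in_walks_between[OF G])
    moreover have "card (insert q ((\<lambda>u. q @ [Vx u]) ` f)) \<le> 3"
      using edge_set_cards[OF f(1)] card_image_le[of f "\<lambda>u. q @ [Vx u]"]
      by (simp add: card_insert_if)
    ultimately show ?thesis using edge_set_cards(1)[OF f(1)]
      by (meson card_mono finite.insertI finite_imageI finite_subset order_trans)
  qed
  have wlen: "wlen (drop_last_vertex p) \<le> wlen p \<and> wlen p \<le> wlen (drop_last_vertex p) + 1"
    and mem: "drop_last_vertex p \<in> walks_between E (inc_edges E W) (edge_set E)"
      if p: "p \<in> Sig E W" for p
  proof -
    obtain f where "drop_last_vertex p \<in> walks_between E (inc_edges E W) (edge_set E)"
      "p \<in> insert (drop_last_vertex p) ((\<lambda>u. drop_last_vertex p @ [Vx u]) ` f)"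
      using drop_last_vertex_in_walks_between[OF G p] by metis
    moreover from this(2) have "wlen p \<in> {wlen (drop_last_vertex p), wlen (drop_last_vertex p) + 1}"
      by (auto dest: arg_cong[where f = wlen])
    ultimately show "wlen (drop_last_vertex p) \<le> wlen p \<and> wlen p \<le> wlen (drop_last_vertex p) + 1"
      "drop_last_vertex p \<in> walks_between E (inc_edges E W) (edge_set E)" by auto
  qed
  have "walk_sum x y (Sig E W) \<le> ennreal (real 3 * weight_shift x y 1) *
      walk_sum x y (walks_between E (inc_edges E W) (edge_set E))"
    by (rule walk_sum_le_bounded_fibres[OF x, where h = drop_last_vertex])
       (use fibre wlen mem in auto)
  then show ?thesis by simp
qed

section \<open>The radius of convergence\<close>

lemma card_Sigma_le:
  assumes "finite A" "\<And>a. a \<in> A \<Longrightarrow> finite (B a)" "\<And>a. a \<in> A \<Longrightarrow> card (B a) \<le> k"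
  shows "card (Sigma A B) \<le> card A * k"
  using assms sum_bounded_above[of A "\<lambda>a. card (B a)" k] by (simp add: card_SigmaI)

context quasi_transitive_graph begin

lemma inc_edges_singleton:
  assumes "v \<in> V"
  shows "finite (inc_edges E {v})" "card (inc_edges E {v}) \<le> max_saw_count 1"
proof -
  have "inc_edges E {v} \<subseteq> set ` saws E v 1"
  proof
    fix e assume "e \<in> inc_edges E {v}"
    then have e: "e \<in> edge_set E" "v \<in> e" by (auto simp: inc_edges_def)
    obtain u where u: "e = {v, u}" "E v u" using edge_set_obtain_neighbour[OF simple e] .
    then have "[v, u] \<in> saws E v 1" using simple_graphD(4)[OF simple] by (simp add: saws_def)
    then show "e \<in> set ` saws E v 1" using u(1) by (intro image_eqI[of _ _ "[v, u]"]) auto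
  qed
  then have "card (inc_edges E {v}) \<le> card (saws E v 1)" "finite (inc_edges E {v})"
    using finite_saws[OF assms]
    by (auto simp del: One_nat_def intro: surj_card_le dest: finite_subset)
  then show "finite (inc_edges E {v})" "card (inc_edges E {v}) \<le> max_saw_count 1"
    using saw_count_le_max[OF assms, of 1] by (simp_all add: saw_count_eq_card)
qed

lemma finite_inc_edges:
  assumes "finite A" "A \<subseteq> V"
  shows "finite (inc_edges E A)"
proof -
  have "inc_edges E A = (\<Union>v\<in>A. inc_edges E {v})" by (auto simp: inc_edges_def)
  then show ?thesis using assms inc_edges_singleton(1) by auto
qed

lemma optional_mid_bounds:
  assumes "v \<in> V"
  shows "finite (optional_mid E v)" "card (optional_mid E v) \<le> Suc (max_saw_count 1)"
proof -
  show "finite (optional_mid E v)"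
    using inc_edges_singleton(1)[OF assms] by (simp add: optional_mid_def)
  have "card ((\<lambda>e. [Md e]) ` inc_edges E {v}) \<le> max_saw_count 1"
    using inc_edges_singleton[OF assms] card_image_le order_trans by blast
  then show "card (optional_mid E v) \<le> Suc (max_saw_count 1)"
    using inc_edges_singleton(1)[OF assms] by (simp add: optional_mid_def card_insert_if)
qed

definition Sig_codes :: "nat \<Rightarrow> ('v set \<times> 'v list \<times> 'v pos list) set" where
  "Sig_codes n =
    (SIGMA e:inc_edges E W. SIGMA vs:(\<Union>v\<in>e. saws E v n). optional_mid E (last vs))"

lemma Sig_Suc_subset:
  "{p \<in> Sig E W. wlen p = Suc n} \<subseteq> (\<lambda>(e, vs, t). Md e # subdivide vs @ t) ` Sig_codes n"
proof
  fix p assume p: "p \<in> {p \<in> Sig E W. wlen p = Suc n}"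
  then have "p \<in> Sig E W" by simp
  with simple show "p \<in> (\<lambda>(e, vs, t). Md e # subdivide vs @ t) ` Sig_codes n"
  proof (cases rule: Sig_decompose)
    case (mid e)
    then show ?thesis using p by simp
  next
    case (walk e v m vs t)
    have "wlen t = 0" using walk(4) by (auto simp: optional_mid_def)
    then have "m = n" using p walk(3,5) by (simp add: saws_def)
    then show ?thesis
      using walk by (intro image_eqI[of _ _ "(e, vs, t)"]) (auto simp: Sig_codes_def)
  qed
qed

lemma Sig_codes_bounds:
  shows "finite (Sig_codes n)"
    and "card (Sig_codes n) \<le> card (inc_edges E W) * (2 * max_saw_count n * Suc (max_saw_count 1))"
proof -
  have codes_at: "finite (SIGMA vs:(\<Union>v\<in>e. saws E v n). optional_mid E (last vs)) \<and>
      card (SIGMA vs:(\<Union>v\<in>e. saws E v n). optional_mid E (last vs))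
      \<le> 2 * max_saw_count n * Suc (max_saw_count 1)" if "e \<in> inc_edges E W" for e
  proof -
    have e: "e \<in> edge_set E" using that inc_edges_subset by blast
    have eV: "e \<subseteq> V" by (rule edge_subset_verts[OF simple e])
    have saws: "finite (\<Union>v\<in>e. saws E v n)" using edge_set_cards(1)[OF e] finite_saws eV by auto
    have "card (\<Union>v\<in>e. saws E v n) \<le> (\<Sum>v\<in>e. saw_count E v n)"
      unfolding saw_count_eq_card using edge_set_cards(1)[OF e] by (rule card_UN_le)
    also have "\<dots> \<le> card e * max_saw_count n"
      using sum_bounded_above[of e "\<lambda>v. saw_count E v n"] saw_count_le_max eV
      by (simp add: subset_iff)
    also have "\<dots> \<le> 2 * max_saw_count n" using edge_set_cards(3)[OF e] by (rule mult_le_mono1)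
    finally have card_saws: "card (\<Union>v\<in>e. saws E v n) \<le> 2 * max_saw_count n" .
    have last_V: "last vs \<in> V" if "vs \<in> (\<Union>v\<in>e. saws E v n)" for vs
      using that last_saw_in_verts eV by auto
    have "card (SIGMA vs:(\<Union>v\<in>e. saws E v n). optional_mid E (last vs))
        \<le> card (\<Union>v\<in>e. saws E v n) * Suc (max_saw_count 1)"
      using saws optional_mid_bounds[OF last_V] by (rule card_Sigma_le)
    also have "\<dots> \<le> 2 * max_saw_count n * Suc (max_saw_count 1)"
      using card_saws by (rule mult_le_mono1)
    finally have "card (SIGMA vs:(\<Union>v\<in>e. saws E v n). optional_mid E (last vs))
        \<le> 2 * max_saw_count n * Suc (max_saw_count 1)" .
    moreover have "finite (SIGMA vs:(\<Union>v\<in>e. saws E v n). optional_mid E (last vs))"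
      using saws optional_mid_bounds(1)[OF last_V] by (rule finite_SigmaI)
    ultimately show ?thesis by (rule conjI[rotated])
  qed
  have X: "finite (inc_edges E W)" using finite_inc_edges finite_W W_subset by blast
  show "finite (Sig_codes n)"
    unfolding Sig_codes_def using X conjunct1[OF codes_at] by (rule finite_SigmaI)
  show "card (Sig_codes n) \<le> card (inc_edges E W) * (2 * max_saw_count n * Suc (max_saw_count 1))"
    unfolding Sig_codes_def using X conjunct1[OF codes_at] conjunct2[OF codes_at]
    by (rule card_Sigma_le)
qed

lemma Sig_length_0_subset: "{p \<in> Sig E W. wlen p = 0} \<subseteq> (\<lambda>e. [Md e]) ` inc_edges E W"
proof clarify
  fix p assume p: "p \<in> Sig E W" "wlen p = 0"
  from simple p(1) show "p \<in> (\<lambda>e. [Md e]) ` inc_edges E W"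
    by (cases rule: Sig_decompose) (use p(2) in \<open>auto simp: saws_def\<close>)
qed

lemma finite_Sig_length: "finite {p \<in> Sig E W. wlen p = n}"
proof (cases n)
  case 0
  then show ?thesis
    using finite_inc_edges finite_W W_subset by (auto intro: finite_subset[OF Sig_length_0_subset])
next
  case (Suc m)
  show ?thesis
    unfolding Suc by (rule finite_subset[OF Sig_Suc_subset finite_imageI[OF Sig_codes_bounds(1)]])
qed

lemma card_Sig_length_le:
  "\<exists>K. \<forall>n. card {p \<in> Sig E W. wlen p = n} \<le> K * max_saw_count (n - 1)"
proof -
  define K where "K = card (inc_edges E W) * (2 * Suc (max_saw_count 1))"
  have "card {p \<in> Sig E W. wlen p = n} \<le> K * max_saw_count (n - 1)" for n
  proof (cases n)
    case 0
    have "card {p \<in> Sig E W. wlen p = n} \<le> card (inc_edges E W)"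
      unfolding 0 using finite_W W_subset
      by (intro surj_card_le[OF _ Sig_length_0_subset] finite_inc_edges)
    also have "\<dots> \<le> K * 1" by (simp add: K_def)
    also have "\<dots> \<le> K * max_saw_count (n - 1)"
      using seq_pos[of "n - 1"] by (intro mult_le_mono2) simp
    finally show ?thesis .
  next
    case (Suc m)
    have "card {p \<in> Sig E W. wlen p = n} \<le> card (Sig_codes m)"
      unfolding Suc by (rule surj_card_le[OF Sig_codes_bounds(1) Sig_Suc_subset])
    also have "\<dots> \<le> K * max_saw_count (n - 1)"
      using Sig_codes_bounds(2)[of m] by (simp add: K_def Suc algebra_simps)
    finally show ?thesis .
  qed
  then show ?thesis by blast
qed

lemma Sig_growth:
  assumes "\<mu> < l"
  obtains C where "C > 0" "\<And>n. real (card {p \<in> Sig E W. wlen p = n}) \<le> C * l ^ n"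
proof -
  have l: "l > 0" using assms mu_pos by simp
  obtain C where C: "C > 0" "\<And>n. real (max_saw_count n) \<le> C * l ^ n"
    using growth_bound[OF assms] by blast
  obtain K where K: "\<And>n. card {p \<in> Sig E W. wlen p = n} \<le> K * max_saw_count (n - 1)"
    using card_Sig_length_le by blast
  have shifted: "real (max_saw_count (n - 1)) \<le> C * (1 + 1 / l) * l ^ n" for n
  proof (cases n)
    case 0
    then show ?thesis using C(2)[of 0] C(1) l by (simp add: distrib_left add_increasing2)
  next
    case (Suc m)
    have "real (max_saw_count (n - 1)) \<le> C * l ^ m" using C(2)[of m] Suc by simp
    also have "\<dots> \<le> C * (1 + 1 / l) * l ^ n" using C(1) l Suc by (simp add: field_simps)
    finally show ?thesis .
  qed
  have "real (card {p \<in> Sig E W. wlen p = n}) \<le> (real K + 1) * (C * (1 + 1 / l)) * l ^ n" for n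
  proof -
    have "real (card {p \<in> Sig E W. wlen p = n}) \<le> real K * real (max_saw_count (n - 1))"
      using K[of n] by (simp flip: of_nat_mult)
    also have "\<dots> \<le> (real K + 1) * (C * (1 + 1 / l) * l ^ n)"
      using shifted by (intro mult_mono) auto
    finally show ?thesis by (simp add: ac_simps)
  qed
  moreover have "(real K + 1) * (C * (1 + 1 / l)) > 0" using C(1) l by (simp add: add_pos_pos)
  ultimately show ?thesis using that by blast
qed

lemma Yfun_finite_below_radius:
  assumes x: "0 < x" "x < 1 / \<mu>"
  shows "Yfun E W x 0 < \<infinity>"
proof -
  have "\<mu> < 1 / x" using x mu_pos by (simp add: field_simps)
  then obtain l where l: "\<mu> < l" "l < 1 / x" using dense by blast
  have lx: "0 < l * x" "l * x < 1" using l x mu_pos by (simp_all add: field_simps)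
  obtain C where C: "C > 0" "\<And>n. real (card {p \<in> Sig E W. wlen p = n}) \<le> C * l ^ n"
    using Sig_growth[OF l(1)] by blast
  have fibre: "(\<Sum>\<^sub>\<infinity>p\<in>{p \<in> Sig E W. wlen p = n}. ennreal (weight x 0 (wlen p)))
      \<le> ennreal (C * (l * x) ^ n)" for n
  proof -
    have "(\<Sum>\<^sub>\<infinity>p\<in>{p \<in> Sig E W. wlen p = n}. ennreal (weight x 0 (wlen p)))
        = ennreal (real (card {p \<in> Sig E W. wlen p = n}) * x ^ n)"
      using x finite_Sig_length by (simp add: weight_0 ennreal_mult ennreal_of_nat_eq_real_of_nat)
    also have "\<dots> \<le> ennreal (C * l ^ n * x ^ n)"
      using C(2) x by (intro ennreal_leI mult_right_mono) auto
    finally show ?thesis by (simp add: power_mult_distrib ac_simps)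
  qed
  have "summable (\<lambda>n. norm (C * (l * x) ^ n))"
    using lx C(1) by (simp add: abs_mult power_abs summable_mult)
  then have geometric: "(\<lambda>n. C * (l * x) ^ n) summable_on UNIV"
    by (rule norm_summable_imp_summable_on)
  have "Yfun E W x 0 = (\<Sum>\<^sub>\<infinity>n. \<Sum>\<^sub>\<infinity>p\<in>{p \<in> Sig E W. wlen p = n}. ennreal (weight x 0 (wlen p)))"
    unfolding Yfun_eq_walk_sum walk_sum_def by (rule infsum_fibres_ennreal) simp
  also have "\<dots> \<le> (\<Sum>\<^sub>\<infinity>n. ennreal (C * (l * x) ^ n))" by (intro infsum_mono fibre) auto
  also have "\<dots> = ennreal (infsum (\<lambda>n. C * (l * x) ^ n) UNIV)"
    using geometric C(1) lx by (intro infsum_ennreal_eq) auto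
  finally show ?thesis by (simp add: le_less_trans)
qed

lemma tl_subdivide_in_Sig:
  assumes "w \<in> W" "vs \<in> saws E w n" "n \<ge> 1"
  shows "tl (subdivide vs) \<in> Sig E W" "wlen (tl (subdivide vs)) = n"
      "w # visited (tl (subdivide vs)) = vs"
proof -
  obtain u us where vs: "vs = w # u # us"
    using assms(2,3) by (cases vs; cases "tl vs") (auto simp: saws_def)
  have "distinct (subdivide vs)" "successively (step_ok E) (subdivide vs)"
    using assms(2) by (auto simp: saws_def intro: distinct_subdivide successively_subdivide)
  moreover have "{w, u} \<in> inc_edges E W"
    using assms(1,2) vs by (auto simp: inc_edges_def saws_def intro: edge_setI)
  ultimately show "tl (subdivide vs) \<in> Sig E W"
    using vs by (auto simp: Sig_def mid_saw_def successively_Cons)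
  show "w # visited (tl (subdivide vs)) = vs" "wlen (tl (subdivide vs)) = n"
    using vs assms(2) by (simp_all add: saws_def)
qed

lemma saw_count_power_le_Yfun:
  assumes w: "w \<in> W" and n: "n \<ge> 1" and x: "x \<ge> 0"
  shows "ennreal (real (saw_count E w n) * x ^ n) \<le> Yfun E W x 0"
proof -
  let ?f = "\<lambda>vs. tl (subdivide vs)"
  have inj: "inj_on ?f (saws E w n)"
    using tl_subdivide_in_Sig(3)[OF w _ n] by (intro inj_on_inverseI[where g = "\<lambda>p. w # visited p"])
  have "finite (saws E w n)" using w W_subset finite_saws by blast
  then have "ennreal (real (saw_count E w n) * x ^ n)
      = (\<Sum>\<^sub>\<infinity>vs\<in>saws E w n. ennreal (weight x 0 (wlen (?f vs))))"
    using x tl_subdivide_in_Sig(2)[OF w _ n]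
    by (simp add: weight_0 ennreal_mult ennreal_of_nat_eq_real_of_nat saw_count_eq_card)
  also have "\<dots> = walk_sum x 0 (?f ` saws E w n)"
    by (simp add: walk_sum_def infsum_reindex[OF inj] comp_def)
  also have "\<dots> \<le> Yfun E W x 0"
    unfolding Yfun_eq_walk_sum using tl_subdivide_in_Sig(1)[OF w _ n] by (intro walk_sum_mono) auto
  finally show ?thesis .
qed

lemma Yfun_infinite_above_radius:
  assumes x: "x > 1 / \<mu>"
  shows "Yfun E W x 0 = \<infinity>"
proof (rule ccontr)
  have x0: "x > 0" using x mu_pos by (meson divide_pos_pos less_trans zero_less_one)
  have "1 / x < \<mu>" using x x0 mu_pos by (simp add: field_simps)
  then obtain r where r: "1 / x < r" "r < \<mu>" using dense by blast
  have r0: "r > 0" using r x0 by (meson divide_pos_pos less_trans zero_less_one)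
  obtain w where w: "w \<in> W" using W_nonempty by blast
  then obtain K where K: "K > 0" "\<And>n. K * r ^ n \<le> real (saw_count E w n)"
    using saw_count_lower[OF _ r0 r(2), of w] W_subset by blast
  assume "Yfun E W x 0 \<noteq> \<infinity>"
  then obtain B where B: "Yfun E W x 0 = ennreal B" "B \<ge> 0"
    by (metis ennreal_cases infinity_ennreal_def)
  have "1 < r * x" using r x0 by (simp add: field_simps)
  then obtain m where "B / K < (r * x) ^ m" using real_arch_pow by blast
  also have "\<dots> \<le> (r * x) ^ Suc m" using \<open>1 < r * x\<close> by (intro power_increasing) auto
  finally have "B < K * r ^ Suc m * x ^ Suc m"
    using K(1) by (simp add: field_simps power_mult_distrib)
  also have "\<dots> \<le> real (saw_count E w (Suc m)) * x ^ Suc m"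
    by (rule mult_right_mono[OF K(2)]) (use x0 in simp)
  finally show False
    using saw_count_power_le_Yfun[OF w, of "Suc m" x] x0 B by simp
qed

end

section \<open>Path generating functions\<close>

definition path_gf :: "('v \<Rightarrow> 'v \<Rightarrow> bool) \<Rightarrow> real \<Rightarrow> 'v \<Rightarrow> 'v \<Rightarrow> real" where
  "path_gf E x u v = (\<Sum>p\<in>saws_between E u v. x ^ length p)"

lemma saws_between_subset_verts:
  assumes "simple_graph V E" "u \<in> V" "p \<in> saws_between E u v"
  shows "set p \<subseteq> V"
  using saws_subset_verts[OF assms(1) saws_between_in_saws[OF assms(3)] assms(2)] .

lemma length_saws_between:
  assumes "simple_graph V E" "finite V" "u \<in> V" "p \<in> saws_between E u v"
  shows "0 < length p" "length p \<le> card V"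
proof -
  have "length p = card (set p)" using assms(4) by (simp add: saws_between_def distinct_card)
  also have "\<dots> \<le> card V" by (intro card_mono saws_between_subset_verts[OF assms(1,3,4)] assms(2))
  finally show "length p \<le> card V" .
qed (use assms(4) in \<open>simp add: saws_between_def\<close>)

lemma finite_saws_between:
  assumes "simple_graph V E" "finite V" "u \<in> V"
  shows "finite (saws_between E u v)"
proof (rule finite_subset)
  show "saws_between E u v \<subseteq> {p. set p \<subseteq> V \<and> distinct p}"
    using saws_between_subset_verts[OF assms(1,3)] by (auto simp: saws_between_def)
qed (rule finite_subset_distinct[OF assms(2)])

lemma path_gf_sym:
  assumes "simple_graph V E"
  shows "path_gf E x u v = path_gf E x v u"
proof -
  have "rev p \<in> saws_between E v u" if "p \<in> saws_between E u v" for p u v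
  proof -
    have "successively (\<lambda>a b. E b a) p"
      using that by (auto simp: saws_between_def
        intro: successively_mono[of E] simple_graphD(3)[OF assms])
    then show ?thesis using that by (auto simp: saws_between_def hd_rev last_rev)
  qed
  then show ?thesis
    unfolding path_gf_def by (intro sum.reindex_bij_witness[of _ rev rev]) auto
qed

lemma aut_inv_into:
  assumes "aut V E f"
  shows "aut V E (inv_into V f)"
proof -
  have bij: "bij_betw f V V" using assms by (simp add: aut_def)
  have "E (inv_into V f u) (inv_into V f v) = E u v" if "u \<in> V" "v \<in> V" for u v
  proof -
    have "inv_into V f u \<in> V" "inv_into V f v \<in> V"
      using that bij_betwE[OF bij_betw_inv_into[OF bij]] by auto
    then have "E (f (inv_into V f u)) (f (inv_into V f v)) = E (inv_into V f u) (inv_into V f v)"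
      using assms by (simp add: aut_def)
    then show ?thesis using that by (simp add: bij_betw_inv_into_right[OF bij])
  qed
  then show ?thesis using bij_betw_inv_into[OF bij] by (simp add: aut_def)
qed

lemma map_aut_saws_between:
  assumes "simple_graph V E" "aut V E f" "u \<in> V" "p \<in> saws_between E u v"
  shows "map f p \<in> saws_between E (f u) (f v)"
  using assms(4) map_aut_saws[OF assms(1-3)] by (auto simp: saws_between_iff last_map)

lemma path_gf_aut:
  assumes G: "simple_graph V E" and f: "aut V E f" and uv: "u \<in> V" "v \<in> V"
  shows "path_gf E x (f u) (f v) = path_gf E x u v"
proof -
  let ?g = "inv_into V f"
  have bij: "bij_betw f V V" and fV: "f u \<in> V" using f uv by (auto simp: aut_def bij_betw_def)
  have g: "?g (f w) = w" if "w \<in> V" for w using bij that by (rule bij_betw_inv_into_left)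
  have "map ?g p \<in> saws_between E u v" if "p \<in> saws_between E (f u) (f v)" for p
    using map_aut_saws_between[OF G aut_inv_into[OF f] fV that] g uv by simp
  moreover have "map f (map ?g p) = p" if "p \<in> saws_between E (f u) (f v)" for p
    using saws_between_subset_verts[OF G fV that] bij_betw_inv_into_right[OF bij]
    by (auto intro!: map_idI)
  moreover have "map ?g (map f p) = p" if "p \<in> saws_between E u v" for p
    using saws_between_subset_verts[OF G uv(1) that] g by (auto intro!: map_idI)
  ultimately show ?thesis
    unfolding path_gf_def
    by (intro sum.reindex_bij_witness[of _ "map f" "map ?g"])
       (auto intro: map_aut_saws_between[OF G f uv(1)])
qed

text \<open>A pair of ports is determined by the third port, and a symmetry that moves \<open>a\<close> to \<open>b\<close> carries the
  pair opposite to \<open>a\<close> to the pair opposite to \<open>b\<close>.\<close>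

lemma transitive_on_triple_pairs_eq:
  fixes S :: "'a \<Rightarrow> 'a \<Rightarrow> 'b"
  assumes sym: "\<And>a b. S a b = S b a"
    and trans: "\<And>a b. a \<in> {t1, t2, t3} \<Longrightarrow> b \<in> {t1, t2, t3} \<Longrightarrow>
      \<exists>f. f a = b \<and> f ` {t1, t2, t3} = {t1, t2, t3} \<and>
        (\<forall>c\<in>{t1, t2, t3}. \<forall>d\<in>{t1, t2, t3}. S (f c) (f d) = S c d)"
    and ab: "a \<in> {t1, t2, t3}" "b \<in> {t1, t2, t3}" "a \<noteq> b"
    and distinct: "t1 \<noteq> t2" "t1 \<noteq> t3" "t2 \<noteq> t3"
  shows "S a b = S t1 t2"
proof -
  have opposite_eq: "S b c = S a c" if T: "{a, b, c} = {t1, t2, t3}" and "a \<noteq> b" "a \<noteq> c" "b \<noteq> c"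
    for a b c
  proof -
    obtain f where f: "f a = b" "f ` {a, b, c} = {a, b, c}" "S (f b) (f c) = S b c"
      using trans[of a b] unfolding T[symmetric] by auto
    have "inj_on f {a, b, c}" using f(2) by (intro finite_surj_inj) auto
    then have "f b \<noteq> b" "f c \<noteq> b" "f b \<noteq> f c" using f(1) that(2-4) by (auto simp: inj_on_def)
    moreover have "f b \<in> {a, b, c}" "f c \<in> {a, b, c}" using f(2) by blast+
    ultimately consider "f b = a" "f c = c" | "f b = c" "f c = a" by auto
    then show ?thesis using f(3) sym[of c a] by cases simp_all
  qed
  have "S t2 t3 = S t1 t3" "S t3 t1 = S t2 t1"
    using distinct opposite_eq[of t1 t2 t3] opposite_eq[of t2 t3 t1] by auto
  then show ?thesis using ab sym[of t2 t1] sym[of t3 t1] sym[of t3 t2] by auto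
qed

section \<open>The transformed graph\<close>

abbreviation passage :: "'v \<Rightarrow> 'g list \<Rightarrow> ('v \<times> 'g) pos list" where
  "passage v vs \<equiv> subdivide (map (Pair v) vs)"

text \<open>The image of an edge under \<open>fst\<close> is a singleton if and only if the edge lies inside a gadget.\<close>

fun collapse_pos :: "('v \<times> 'g) pos \<Rightarrow> 'v pos" where
  "collapse_pos (Vx y) = Vx (fst y)"
| "collapse_pos (Md e) = (if is_singleton (fst ` e) then Vx (the_elem (fst ` e)) else Md (fst ` e))"

declare collapse_pos.simps(2) [simp del]

abbreviation internal :: "('v \<times> 'g) pos \<Rightarrow> bool" where
  "internal x \<equiv> is_Vx (collapse_pos x)"

definition collapse :: "('v \<times> 'g) pos list \<Rightarrow> 'v pos list" where
  "collapse q = remdups_adj (map collapse_pos q)"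

lemma set_collapse: "set (collapse q) = collapse_pos ` set q"
  by (simp add: collapse_def)

lemma collapse_pos_Md_internal:
  assumes "internal (Md \<epsilon>)" "y \<in> \<epsilon>"
  shows "fst ` \<epsilon> = {fst y}" "collapse_pos (Md \<epsilon>) = Vx (fst y)"
proof -
  have singleton: "is_singleton (fst ` \<epsilon>)"
    using assms(1) by (auto simp: collapse_pos.simps(2) split: if_splits)
  then show "fst ` \<epsilon> = {fst y}" using assms(2) by (metis imageI is_singleton_def singletonD)
  then show "collapse_pos (Md \<epsilon>) = Vx (fst y)" using singleton by (simp add: collapse_pos.simps(2))
qed

lemma collapse_pos_passage: "x \<in> set (passage v vs) \<Longrightarrow> collapse_pos x = Vx v"
  by (induction vs rule: subdivide.induct) (auto simp: collapse_pos.simps(2) is_singleton_def)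

lemma collapse_passage:
  assumes "vs \<noteq> []" "q \<noteq> []" "collapse_pos x = Md e" "collapse_pos (hd q) \<noteq> Vx v"
  shows "collapse (x # passage v vs @ q) = Md e # Vx v # collapse q"
proof -
  obtain n where n: "length (passage v vs) = Suc n" using assms(1) by (cases "passage v vs") auto
  have passage: "map collapse_pos (passage v vs) = replicate (Suc n) (Vx v)"
    using n collapse_pos_passage[of _ v vs] by (intro replicate_eqI) auto
  have "collapse (x # passage v vs @ q)
      = remdups_adj ([Md e] @ replicate (Suc n) (Vx v) @ map collapse_pos q)"
    using assms(3) by (simp add: collapse_def passage)
  also have "\<dots> = [Md e] @ remdups_adj (replicate (Suc n) (Vx v)) @ remdups_adj (map collapse_pos q)"
    using assms(2,4)
      remdups_adj_append'[of "[Md e]" "replicate (Suc n) (Vx v) @ map collapse_pos q"]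
      remdups_adj_append'[of "replicate (Suc n) (Vx v)" "map collapse_pos q"]
    by (simp add: hd_map last_replicate)
  also have "\<dots> = Md e # Vx v # collapse q"
    by (simp only: remdups_adj_replicate) (simp add: collapse_def)
  finally show ?thesis .
qed

locale local_transformation =
  fixes V0 :: "'v set" and E0 :: "'v \<Rightarrow> 'v \<Rightarrow> bool"
    and Gv :: "'g set" and Ge :: "'g \<Rightarrow> 'g \<Rightarrow> bool" and w1 w2 w3 :: 'g
    and \<sigma> :: "'v \<Rightarrow> 'v \<Rightarrow> 'g" and W0 :: "'v set"
  assumes G0: "simple_graph V0 E0" "infinite V0" "connected_graph V0 E0" "cubic V0 E0"
    and gadget: "gadget Gv Ge w1 w2 w3"
    and ports_bij: "\<And>v. v \<in> V0 \<Longrightarrow> bij_betw (\<sigma> v) {u. E0 v u} {w1, w2, w3}"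
    and aut_lift: "\<And>\<alpha>. aut V0 E0 \<alpha> \<Longrightarrow>
      \<exists>\<beta>. aut (phi_V V0 Gv) (phi_E V0 E0 Ge \<sigma>) \<beta> \<and> (\<forall>x\<in>phi_V V0 Gv. fst (\<beta> x) = \<alpha> (fst x))"
    and connected_transformed: "connected_graph (phi_V V0 Gv) (phi_E V0 E0 Ge \<sigma>)"
    and fund_domain0: "fund_domain V0 E0 W0"
begin

abbreviation "V1 \<equiv> phi_V V0 Gv"
abbreviation "E1 \<equiv> phi_E V0 E0 Ge \<sigma>"
abbreviation "W1 \<equiv> W0 \<times> Gv"
abbreviation "ports \<equiv> {w1, w2, w3}"

lemma finite_gadget: "finite Gv" and simple_gadget: "simple_graph Gv Ge"
  and connected_gadget: "connected_graph Gv Ge" and ports_subset: "ports \<subseteq> Gv"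
  and ports_distinct: "w1 \<noteq> w2" "w1 \<noteq> w3" "w2 \<noteq> w3"
  using gadget by (auto simp: gadget_def)

lemma card_gadget_pos: "card Gv \<ge> 1"
  using finite_gadget ports_subset by (auto simp: Suc_le_eq card_gt_0_iff)

sublocale G0: quasi_transitive_graph V0 E0 W0
  using G0 fund_domain0 by unfold_locales (auto simp: cubic_def)

lemma sigma_in_ports: "E0 v u \<Longrightarrow> \<sigma> v u \<in> ports"
  using bij_betwE[OF ports_bij] G0.adj_verts by blast

lemma sigma_in_gadget: "E0 v u \<Longrightarrow> \<sigma> v u \<in> Gv"
  using sigma_in_ports ports_subset by blast

lemma sigma_inj: "E0 v u \<Longrightarrow> E0 v u' \<Longrightarrow> \<sigma> v u = \<sigma> v u' \<Longrightarrow> u = u'"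
  using ports_bij[of v] G0.adj_verts(1)[of v u] by (auto simp: bij_betw_def inj_on_def)

lemma E1_cases [consumes 1, case_names within between]:
  assumes "E1 x y"
  obtains v a b where "x = (v, a)" "y = (v, b)" "v \<in> V0" "Ge a b"
    | u v where "E0 u v" "x = (u, \<sigma> u v)" "y = (v, \<sigma> v u)"
  using assms by (cases x; cases y) (auto simp: phi_E_def)

lemma simple_transformed: "simple_graph V1 E1"
  unfolding simple_graph_def
proof (intro conjI allI impI)
  fix x y assume "E1 x y"
  then have "x \<in> V1 \<and> y \<in> V1 \<and> E1 y x"
  proof (cases rule: E1_cases)
    case (within v a b)
    then show ?thesis
      using simple_graphD[OF simple_gadget within(4)] by (simp add: phi_V_def phi_E_def)
  next
    case (between u v)
    then show ?thesis
      using G0.adj_verts[OF between(1)] G0.adj_sym[OF between(1)] sigma_in_gadget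
      by (simp add: phi_V_def phi_E_def)
  qed
  then show "x \<in> V1" "y \<in> V1" "E1 y x" by auto
next
  show "\<not> E1 x x" for x
    using simple_graphD(4)[OF simple_gadget] simple_graphD(4)[OF G0(1)] by (auto simp: phi_E_def)
qed

lemma fund_domain_transformed: "fund_domain V1 E1 W1"
  unfolding fund_domain_def
proof (intro conjI ballI)
  show "finite W1" using G0.finite_W finite_gadget by simp
  show "W1 \<subseteq> V1" using G0.W_subset by (auto simp: phi_V_def)
  fix x assume x: "x \<in> V1"
  then have "fst x \<in> V0" by (auto simp: phi_V_def)
  then obtain \<alpha> where \<alpha>: "aut V0 E0 \<alpha>" "\<alpha> (fst x) \<in> W0"
    using fund_domain0 by (auto simp: fund_domain_def)
  obtain \<beta> where \<beta>: "aut V1 E1 \<beta>" "\<forall>x\<in>V1. fst (\<beta> x) = \<alpha> (fst x)" using aut_lift[OF \<alpha>(1)] by blast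
  have "\<beta> x \<in> V1" using \<beta>(1) x by (auto simp: aut_def bij_betw_def)
  then have "\<beta> x \<in> W1" using \<alpha>(2) \<beta>(2) x by (cases "\<beta> x") (force simp: phi_V_def)
  then show "\<exists>f. aut V1 E1 f \<and> f x \<in> W1" using \<beta>(1) by (intro exI[of _ \<beta>] conjI)
qed

lemma locally_finite_transformed:
  assumes "x \<in> V1"
  shows "finite {y. E1 x y}"
proof (rule finite_subset)
  show "{y. E1 x y} \<subseteq> ({fst x} \<times> Gv) \<union> (\<lambda>v. (v, \<sigma> v (fst x))) ` {v. E0 (fst x) v}"
    by (auto elim!: E1_cases dest: simple_graphD(2)[OF simple_gadget])
  show "finite (({fst x} \<times> Gv) \<union> (\<lambda>v. (v, \<sigma> v (fst x))) ` {v. E0 (fst x) v})"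
    using assms finite_gadget G0.locally_finite by (auto simp: phi_V_def)
qed

sublocale G1: quasi_transitive_graph V1 E1 W1
proof
  have "Gv \<noteq> {}" using ports_subset by auto
  then show "infinite V1" using G0(2) by (auto simp: phi_V_def finite_cartesian_product_iff)
qed (use simple_transformed fund_domain_transformed locally_finite_transformed connected_transformed in auto)

definition gadget_gf :: "real \<Rightarrow> real" where
  "gadget_gf x = path_gf Ge x w1 w2"

lemma path_gf_ports:
  assumes "a \<in> ports" "b \<in> ports" "a \<noteq> b"
  shows "path_gf Ge x a b = gadget_gf x"
  unfolding gadget_gf_def
proof (rule transitive_on_triple_pairs_eq[OF _ _ assms ports_distinct])
  show "path_gf Ge x c d = path_gf Ge x d c" for c d using simple_gadget by (rule path_gf_sym)
  show "\<exists>f. f c = d \<and> f ` ports = ports \<and>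
      (\<forall>c\<in>ports. \<forall>d\<in>ports. path_gf Ge x (f c) (f d) = path_gf Ge x c d)"
    if cd: "c \<in> ports" "d \<in> ports" for c d
  proof -
    obtain f where f: "aut Gv Ge f" "f ` ports = ports" "f c = d"
      using gadget cd unfolding gadget_def by blast
    moreover have "path_gf Ge x (f a) (f b) = path_gf Ge x a b" if "a \<in> ports" "b \<in> ports" for a b
      using that ports_subset by (intro path_gf_aut[OF simple_gadget f(1)]) auto
    ultimately show ?thesis by blast
  qed
qed

lemma gadget_saws_nonempty:
  assumes "a \<in> Gv" "b \<in> Gv"
  shows "saws_between Ge a b \<noteq> {}"
  using connected_gadget assms unfolding connected_graph_def by (intro saws_between_nonempty) blast

lemma finite_gadget_saws: "a \<in> Gv \<Longrightarrow> finite (saws_between Ge a b)"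
  using simple_gadget finite_gadget by (rule finite_saws_between)

lemma gadget_gf_pos: "x > 0 \<Longrightarrow> gadget_gf x > 0"
  unfolding gadget_gf_def path_gf_def
  using finite_gadget_saws gadget_saws_nonempty ports_subset by (intro sum_pos) auto

lemma isCont_gadget_gf: "isCont gadget_gf x"
  unfolding gadget_gf_def path_gf_def by (intro continuous_intros)

definition port :: "'v \<Rightarrow> 'v set \<Rightarrow> 'g" where
  "port v e = \<sigma> v (THE u. e = {v, u})"

definition connector :: "'v set \<Rightarrow> ('v \<times> 'g) set" where
  "connector e = (\<lambda>v. (v, port v e)) ` e"

lemma port_doubleton: "port v {v, u} = \<sigma> v u"
proof -
  have "(THE u'. {v, u} = {v, u'}) = u" by (rule the_equality) (auto simp: doubleton_eq_iff)
  then show ?thesis by (simp add: port_def)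
qed

lemma port_in_ports:
  assumes "e \<in> edge_set E0" "v \<in> e"
  shows "port v e \<in> ports"
proof -
  obtain u where "e = {v, u}" "E0 v u" using edge_set_obtain_neighbour[OF G0(1) assms] .
  then show ?thesis using sigma_in_ports by (simp add: port_doubleton)
qed

lemma port_in_gadget: "e \<in> edge_set E0 \<Longrightarrow> v \<in> e \<Longrightarrow> port v e \<in> Gv"
  using port_in_ports ports_subset by blast

lemma port_inj:
  assumes "e \<in> edge_set E0" "f \<in> edge_set E0" "v \<in> e" "v \<in> f" "port v e = port v f"
  shows "e = f"
proof -
  obtain a where "e = {v, a}" "E0 v a" using edge_set_obtain_neighbour[OF G0(1) assms(1,3)] .
  moreover obtain b where "f = {v, b}" "E0 v b"
    using edge_set_obtain_neighbour[OF G0(1) assms(2,4)] .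
  ultimately show ?thesis using sigma_inj[of v a b] assms(5) by (simp add: port_doubleton)
qed

lemma fst_connector [simp]: "fst ` connector e = e"
  by (simp add: connector_def image_image)

lemma in_connector_iff [simp]: "(v, a) \<in> connector e \<longleftrightarrow> v \<in> e \<and> a = port v e"
  by (auto simp: connector_def)

lemma connector_inj: "connector e = connector f \<longleftrightarrow> e = f"
  by (metis fst_connector)

lemma connector_doubleton: "connector {u, v} = {(u, \<sigma> u v), (v, \<sigma> v u)}"
  using port_doubleton[of v u] by (simp add: connector_def port_doubleton insert_commute)

lemma connector_edge:
  assumes "e \<in> edge_set E0"
  shows "connector e \<in> edge_set E1"
proof -
  obtain u v where "e = {u, v}" "E0 u v" using assms by (auto simp: edge_set_def)
  then show ?thesis by (auto simp: connector_doubleton phi_E_def intro: edge_setI)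
qed

lemma collapse_pos_connector: "e \<in> edge_set E0 \<Longrightarrow> collapse_pos (Md (connector e)) = Md e"
  using simple_graphD(4)[OF G0(1)]
  by (auto simp: collapse_pos.simps(2) edge_set_def is_singleton_def doubleton_eq_iff)

lemma collapse_pos_eq_Md:
  assumes "\<epsilon> \<in> edge_set E1" "collapse_pos (Md \<epsilon>) = Md e"
  shows "e \<in> edge_set E0" "\<epsilon> = connector e"
proof -
  obtain x y where xy: "\<epsilon> = {x, y}" "E1 x y" using assms(1) by (auto simp: edge_set_def)
  from xy(2) have "e \<in> edge_set E0 \<and> \<epsilon> = connector e"
  proof (cases rule: E1_cases)
    case (within v a b)
    then show ?thesis using assms(2) xy(1) by (simp add: collapse_pos.simps(2) is_singleton_def)
  next
    case (between u v)
    then have "\<epsilon> = connector {u, v}" "{u, v} \<in> edge_set E0"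
      using xy(1) by (auto simp: connector_doubleton intro: edge_setI)
    then show ?thesis using assms(2) collapse_pos_connector by auto
  qed
  then show "e \<in> edge_set E0" "\<epsilon> = connector e" by auto
qed

lemma connector_inc_edges:
  assumes "e \<in> inc_edges E0 U"
  shows "connector e \<in> inc_edges E1 (U \<times> Gv)"
proof -
  obtain w where w: "e \<in> edge_set E0" "w \<in> U" "w \<in> e" using assms by (auto simp: inc_edges_def)
  then have "(w, port w e) \<in> connector e" "(w, port w e) \<in> U \<times> Gv" using port_in_gadget by auto
  then show ?thesis using connector_edge[OF w(1)] by (auto simp: inc_edges_def)
qed

end

section \<open>Expanding walks through the gadgets\<close>

inductive mid_to_mid :: "('v \<Rightarrow> 'v \<Rightarrow> bool) \<Rightarrow> 'v pos list \<Rightarrow> bool" for E where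
  mid: "e \<in> edge_set E \<Longrightarrow> mid_to_mid E [Md e]"
| step: "mid_to_mid E (Md f # p) \<Longrightarrow> e \<in> edge_set E \<Longrightarrow> f \<in> edge_set E \<Longrightarrow> v \<in> e \<Longrightarrow> v \<in> f \<Longrightarrow>
    Md e \<notin> set (Md f # p) \<Longrightarrow> Vx v \<notin> set (Md f # p) \<Longrightarrow> mid_to_mid E (Md e # Vx v # Md f # p)"

lemma mid_to_midI:
  assumes "mid_saw E p" "hd p \<in> Md ` edge_set E" "last p \<in> Md ` edge_set E"
  shows "mid_to_mid E p"
  using assms
proof (induction p rule: induct_list012)
  case (2 x)
  then show ?case by (auto intro: mid_to_mid.mid)
next
  case (3 x y zs)
  obtain e v where xy: "x = Md e" "e \<in> edge_set E" "y = Vx v" "v \<in> e"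
    using "3.prems" by (cases y) (auto simp: mid_saw_def)
  then obtain z zs' where zs: "zs = z # zs'" using "3.prems"(3) by (cases zs) auto
  then obtain f where f: "z = Md f" "f \<in> edge_set E" "v \<in> f"
    using "3.prems"(1) xy by (cases z) (auto simp: mid_saw_def)
  have "mid_to_mid E zs" using "3.prems" zs f by (intro "3.IH"(1)) (auto simp: mid_saw_def)
  then show ?case using "3.prems"(1) xy zs f by (auto simp: mid_saw_def intro!: mid_to_mid.step)
qed (simp add: mid_saw_def)

lemma mid_to_mid_iff: "mid_to_mid E p \<longleftrightarrow> p \<in> walks_between E (edge_set E) (edge_set E)"
proof
  show "p \<in> walks_between E (edge_set E) (edge_set E)" if "mid_to_mid E p"
    using that by (induction rule: mid_to_mid.induct) (auto simp: walks_between_def mid_saw_def)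
qed (auto simp: walks_between_def intro: mid_to_midI)

lemma walks_between_mono: "X \<subseteq> X' \<Longrightarrow> T \<subseteq> T' \<Longrightarrow> walks_between E X T \<subseteq> walks_between E X' T'"
  by (auto simp: walks_between_def)

lemma walks_between_mid_to_mid:
  "X \<subseteq> edge_set E \<Longrightarrow> T \<subseteq> edge_set E \<Longrightarrow> p \<in> walks_between E X T \<Longrightarrow> mid_to_mid E p"
  using walks_between_mono[of X "edge_set E" T "edge_set E" E] by (auto simp: mid_to_mid_iff)

context local_transformation begin

inductive expands :: "'v pos list \<Rightarrow> ('v \<times> 'g) pos list \<Rightarrow> bool" where
  mid: "e \<in> edge_set E0 \<Longrightarrow> expands [Md e] [Md (connector e)]"
| step: "expands (Md f # p) q \<Longrightarrow> e \<in> edge_set E0 \<Longrightarrow> f \<in> edge_set E0 \<Longrightarrow> v \<in> e \<Longrightarrow> v \<in> f \<Longrightarrow>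
    Md e \<notin> set (Md f # p) \<Longrightarrow> Vx v \<notin> set (Md f # p) \<Longrightarrow>
    vs \<in> saws_between Ge (port v e) (port v f) \<Longrightarrow>
    expands (Md e # Vx v # Md f # p) (Md (connector e) # passage v vs @ q)"

definition expansions :: "'v pos list \<Rightarrow> ('v \<times> 'g) pos list set" where
  "expansions p = {q. expands p q}"

lemma expands_mid_to_mid: "expands p q \<Longrightarrow> mid_to_mid E0 p"
  by (induction rule: expands.induct) (auto intro: mid_to_mid.intros)

lemma expands_hd:
  "expands p q \<Longrightarrow>
    \<exists>e\<in>edge_set E0. hd p = Md e \<and> hd q = Md (connector e) \<and> p \<noteq> [] \<and> q \<noteq> []"
  by (induction rule: expands.induct) auto

lemma expands_last: "expands p q \<Longrightarrow> \<exists>f\<in>edge_set E0. last p = Md f \<and> last q = Md (connector f)"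
  by (induction rule: expands.induct) (auto dest: expands_hd)

lemma expands_Md: "expands p q \<Longrightarrow> Md e \<in> set p \<Longrightarrow> Md (connector e) \<in> set q"
  by (induction rule: expands.induct) auto

lemma expands_collapse: "expands p q \<Longrightarrow> collapse q = p"
proof (induction rule: expands.induct)
  case (mid e)
  then show ?case using collapse_pos_connector by (simp add: collapse_def)
next
  case (step f p q e v vs)
  have "hd q = Md (connector f)" "q \<noteq> []" using expands_hd[OF step.hyps(1)] by auto
  then show ?case
    using step collapse_pos_connector
    by (subst collapse_passage[where e = e]) (auto simp: saws_between_def)
qed

lemma expands_wlen: "expands p q \<Longrightarrow> wlen p \<le> wlen q \<and> wlen q \<le> card Gv * wlen p"
proof (induction rule: expands.induct)
  case (step f p q e v vs)
  have "port v e \<in> Gv" using step.hyps by (intro port_in_gadget)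
  then have "0 < length vs" "length vs \<le> card Gv"
    using length_saws_between[OF simple_gadget finite_gadget] step.hyps(8) by blast+
  then obtain k where "length vs = Suc k" "Suc k \<le> card Gv" by (cases vs) auto
  then show ?case using step.IH by simp
qed simp

lemma successively_copy:
  assumes "v \<in> V0" "vs \<in> saws_between Ge a b"
  shows "successively E1 (map (Pair v) vs)"
  unfolding successively_map
  by (rule successively_mono[of Ge]) (use assms in \<open>auto simp: saws_between_def phi_E_def\<close>)

lemma passage_walk:
  assumes v: "v \<in> V0" and vs: "vs \<in> saws_between Ge a b"
  shows "distinct (passage v vs)" "successively (step_ok E1) (passage v vs)" "passage v vs \<noteq> []"
    "hd (passage v vs) = Vx (v, a)" "last (passage v vs) = Vx (v, b)"
proof -
  show "successively (step_ok E1) (passage v vs)"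
    using successively_copy[OF v vs] by (rule successively_subdivide)
  show "distinct (passage v vs)"
    using vs by (intro distinct_subdivide) (auto simp: saws_between_def distinct_map inj_on_def)
  show "passage v vs \<noteq> []" "hd (passage v vs) = Vx (v, a)" "last (passage v vs) = Vx (v, b)"
    using vs by (auto simp: saws_between_def hd_map last_map)
qed

lemma expands_mid_saw: "expands p q \<Longrightarrow> mid_saw E1 q"
proof (induction rule: expands.induct)
  case (mid e)
  then show ?case by (simp add: mid_saw_def)
next
  case (step f p q e v vs)
  have q: "hd q = Md (connector f)" "q \<noteq> []" using expands_hd[OF step.hyps(1)] by auto
  have v: "v \<in> V0" using step.hyps(2,4) edge_subset_verts[OF G0(1)] by blast
  note passage = passage_walk[OF v step.hyps(8)]
  have positions: "collapse_pos ` set q = set (Md f # p)"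
    using expands_collapse[OF step.hyps(1)] set_collapse[of q] by simp
  have e: "collapse_pos (Md (connector e)) = Md e"
    using step.hyps(2) by (rule collapse_pos_connector)
  have "collapse_pos x \<noteq> Vx v" if "x \<in> set q" for x
    using positions step.hyps(7) that by (metis imageI)
  then have disjoint: "set (passage v vs) \<inter> set q = {}"
    using collapse_pos_passage[of _ v vs] by blast
  have "Md (connector e) \<notin> set q" using e positions step.hyps(6) by (metis imageI)
  moreover have "Md (connector e) \<notin> set (passage v vs)"
    using e collapse_pos_passage[of "Md (connector e)" v vs] by auto
  ultimately have "distinct (Md (connector e) # passage v vs @ q)"
    using disjoint passage(1) step.IH by (simp add: mid_saw_def)
  moreover have "step_ok E1 (Md (connector e)) (hd (passage v vs))"
    using step.hyps(2,4) connector_edge passage(4) by simp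
  moreover have "step_ok E1 (last (passage v vs)) (hd q)"
    using step.hyps(3,5) connector_edge passage(5) q(1) by simp
  ultimately show ?case
    using passage(2,3) step.IH by (auto simp: mid_saw_def successively_Cons successively_append_iff)
qed

text \<open>Each passage of a walk through a gadget uses two of its three ports, so there is at most one.\<close>

lemma expands_two_ports:
  assumes "expands p q" "Vx v \<in> set p"
  shows "\<exists>a\<in>ports. \<exists>b\<in>ports. a \<noteq> b \<and> Vx (v, a) \<in> set q \<and> Vx (v, b) \<in> set q"
  using assms
proof (induction rule: expands.induct)
  case (step f p q e u vs)
  show ?case
  proof (cases "u = v")
    case True
    have "e \<noteq> f" using step.hyps(6) by auto
    then have "port v e \<noteq> port v f" using port_inj step.hyps(2-5) True by blast
    moreover have "port v e \<in> set vs" "port v f \<in> set vs"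
      using step.hyps(8) True hd_in_set[of vs] last_in_set[of vs] by (auto simp: saws_between_def)
    moreover have "port v e \<in> ports" "port v f \<in> ports"
      using port_in_ports step.hyps(2-5) True by blast+
    ultimately show ?thesis
      using True by (intro bexI[of _ "port v e"] bexI[of _ "port v f"]) auto
  next
    case False
    then have "Vx v \<in> set (Md f # p)" using step.prems by auto
    then show ?thesis using step.IH by auto
  qed
qed auto

lemma expands_no_return:
  assumes p: "expands p q" and walk: "mid_saw E1 (Md (connector e) # passage v vs @ q)"
    and e: "e \<in> edge_set E0" "v \<in> e" and g: "g \<in> edge_set E0" "v \<in> g" "e \<noteq> g"
    and vs: "vs \<in> saws_between Ge (port v e) (port v g)"
  shows "Md e \<notin> set p" "Vx v \<notin> set p"
proof -
  show "Md e \<notin> set p" using expands_Md[OF p] walk by (auto simp: mid_saw_def)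
  show "Vx v \<notin> set p"
  proof
    assume "Vx v \<in> set p"
    then obtain a b where ab: "a \<in> ports" "b \<in> ports" "a \<noteq> b" "Vx (v, a) \<in> set q"
      "Vx (v, b) \<in> set q"
      using expands_two_ports[OF p] by blast
    have "set (passage v vs) \<inter> set q = {}" using walk by (simp add: mid_saw_def)
    moreover have "Vx (v, port v e) \<in> set (passage v vs)" "Vx (v, port v g) \<in> set (passage v vs)"
      using vs hd_in_set[of vs] last_in_set[of vs] by (auto simp: saws_between_def)
    ultimately have "{a, b} \<inter> {port v e, port v g} = {}" using ab(4,5) by blast
    moreover have "port v e \<noteq> port v g" using port_inj e g by blast
    moreover have "port v e \<in> ports" "port v g \<in> ports" using port_in_ports e g by blast+
    ultimately show False using ab(1-3) by auto
  qed
qed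

lemma within_of_internal:
  assumes "E1 x y" "internal (Md {x, y})"
  shows "fst y = fst x" "Ge (snd x) (snd y)"
proof -
  from assms(1) have "fst y = fst x \<and> Ge (snd x) (snd y)"
  proof (cases rule: E1_cases)
    case (between u v)
    then have "collapse_pos (Md {x, y}) = Md {u, v}"
      using collapse_pos_connector[of "{u, v}"] edge_setI[of E0 u v]
      by (simp add: connector_doubleton)
    then show ?thesis using assms(2) by simp
  qed simp
  then show "fst y = fst x" "Ge (snd x) (snd y)" by auto
qed

lemma internal_saw_is_passage:
  assumes us: "us \<in> saws_between E1 (v, a) y" and inner: "\<forall>x\<in>set (subdivide us). internal x"
  obtains vs where "us = map (Pair v) vs" "fst y = v" "vs \<in> saws_between Ge a (snd y)"
proof -
  have "successively E1 us" "hd us = (v, a)" "us \<noteq> []" using us by (auto simp: saws_between_def)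
  from this(1) have internal: "successively (\<lambda>x y. E1 x y \<and> internal (Md {x, y})) us"
    using inner by (induction us rule: subdivide.induct) auto
  then have fst: "\<forall>x\<in>set us. fst x = v"
    by (rule successively_invariant) (use \<open>hd us = (v, a)\<close> within_of_internal in auto)
  have "us = map (Pair v) (map snd us)" using fst by (induction us) auto
  then obtain vs where vs: "us = map (Pair v) vs" by blast
  have "successively Ge vs"
    using internal unfolding vs successively_map
    by (rule successively_mono) (use within_of_internal(2)[of "(v, _)" "(v, _)"] in auto)
  moreover have "distinct vs" "vs \<noteq> []" "hd vs = a" "y = (v, last vs)"
    using us by (auto simp: vs saws_between_def distinct_map hd_map last_map)
  ultimately show ?thesis using vs by (intro that[of vs]) (auto simp: saws_between_def)
qed

lemma leading_passage:
  assumes r: "successively (step_ok E1) r" "distinct r" "hd r = Vx (v, a)"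
    and external: "x \<in> set r" "\<not> internal x"
  obtains vs b \<epsilon> q where "r = passage v vs @ Md \<epsilon> # q" "vs \<in> saws_between Ge a b"
    "\<epsilon> \<in> edge_set E1" "(v, b) \<in> \<epsilon>" "\<not> internal (Md \<epsilon>)"
proof -
  define P where "P = takeWhile internal r"
  have "dropWhile internal r \<noteq> []" using external by (auto simp: dropWhile_eq_Nil_conv)
  then obtain z q where zq: "dropWhile internal r = z # q" "\<not> internal z"
    using hd_dropWhile[of internal r] by (cases "dropWhile internal r") auto
  have P: "r = P @ z # q" "\<forall>x\<in>set P. internal x"
    using zq(1) takeWhile_dropWhile_id[of internal r] by (auto simp: P_def dest: set_takeWhileD)
  have P_hd: "P \<noteq> []" "hd P = Vx (v, a)"
    using r(3) external zq(2) P by (cases P; auto)+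
  have walk: "successively (step_ok E1) P" "step_ok E1 (last P) z"
    using r(1) P(1) P_hd(1) by (auto simp: successively_append_iff)
  have "distinct P" using r(2) P(1) by simp
  then obtain y us t where us: "us \<in> saws_between E1 (v, a) y" "t \<in> optional_mid E1 y"
    "P = subdivide us @ t"
    using walk_from_vertex_decompose[OF simple_transformed walk(1) _ P_hd] by metis
  from walk(2) obtain \<epsilon> where \<epsilon>: "z = Md \<epsilon>" "last P = Vx y" "\<epsilon> \<in> edge_set E1" "y \<in> \<epsilon>"
  proof (cases rule: step_okE)
    case (leave u e)
    then have "t = []" using us(2,3) by (auto simp: optional_mid_def)
    then show ?thesis using leave us that[of e] by (auto simp: saws_between_def)
  qed (use zq(2) in simp)
  have "t = []" using us(2,3) \<epsilon>(2) by (auto simp: optional_mid_def)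
  then obtain vs where "us = map (Pair v) vs" "fst y = v" "vs \<in> saws_between Ge a (snd y)"
    using internal_saw_is_passage[OF us(1)] us(3) P(2) by auto
  then show ?thesis
    using that[of vs \<epsilon> q "snd y"] P(1) us(3) \<open>t = []\<close> \<epsilon> zq(2) by (cases y) simp
qed

lemma mid_saw_is_expansion:
  assumes "mid_saw E1 q" "hd q = Md (connector e)" "e \<in> edge_set E0"
    and "last q = Md (connector f)" "f \<in> edge_set E0"
  shows "\<exists>p. expands p q"
  using assms(1-4)
proof (induction "length q" arbitrary: q e rule: less_induct)
  case less
  obtain r where q: "q = Md (connector e) # r"
    using less.prems(1,2) by (cases q) (auto simp: mid_saw_def)
  show ?case
  proof (cases "r = []")
    case True
    then show ?thesis using q expands.mid less.prems(3) by blast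
  next
    case False
    have walk: "successively (step_ok E1) r" "distinct r" "step_ok E1 (Md (connector e)) (hd r)"
      using less.prems(1) q False by (auto simp: mid_saw_def successively_Cons)
    then obtain v where v: "hd r = Vx (v, port v e)" "v \<in> e" by (cases "hd r") auto
    have "last r \<in> set r" using False by (rule last_in_set)
    moreover have "last r = Md (connector f)" using less.prems(4) q False by simp
    ultimately obtain vs b \<epsilon> r' where r: "r = passage v vs @ Md \<epsilon> # r'"
      "vs \<in> saws_between Ge (port v e) b"
      "\<epsilon> \<in> edge_set E1" "(v, b) \<in> \<epsilon>" "\<not> internal (Md \<epsilon>)"
      using leading_passage[OF walk(1,2) v(1)] collapse_pos_connector[OF assms(5)]
      by (metis is_Vx.simps(2))
    obtain g where g: "g \<in> edge_set E0" "\<epsilon> = connector g"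
      using collapse_pos_eq_Md[OF r(3)] r(5) by (cases "collapse_pos (Md \<epsilon>)") auto
    then have vg: "v \<in> g" "vs \<in> saws_between Ge (port v e) (port v g)" using r(2,4) by auto
    have "mid_saw E1 (Md (connector g) # r')" "last (Md (connector g) # r') = Md (connector f)"
      using less.prems(1,4) q r(1) g(2)
      by (auto simp: mid_saw_def successively_Cons successively_append_iff)
    then obtain p where p: "expands p (Md (connector g) # r')"
      using less.hyps[of "Md (connector g) # r'" g] g(1) q r(1) by auto
    obtain p' where p': "p = Md g # p'"
      using expands_hd[OF p] connector_inj by (cases p) auto
    have "e \<noteq> g" using less.prems(1) q r(1) g(2) by (auto simp: mid_saw_def)
    then have "Md e \<notin> set p" "Vx v \<notin> set p"
      using expands_no_return[OF p _ less.prems(3) v(2) g(1) vg(1) _ vg(2)] less.prems(1) q r(1) g(2)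
      by auto
    then have "expands (Md e # Vx v # Md g # p')
        (Md (connector e) # passage v vs @ Md (connector g) # r')"
      using p p' less.prems(3) g(1) v(2) vg by (intro expands.step) auto
    then show ?thesis using q r(1) g(2) by auto
  qed
qed

lemma walks_between_connectors:
  assumes X: "X \<subseteq> edge_set E0" and T: "T \<subseteq> edge_set E0"
  shows "walks_between E1 (connector ` X) (connector ` T) = (\<Union>p\<in>walks_between E0 X T. expansions p)"
proof (intro equalityI subsetI)
  fix q assume "q \<in> walks_between E1 (connector ` X) (connector ` T)"
  then obtain e f where ef: "mid_saw E1 q" "hd q = Md (connector e)" "e \<in> X"
    "last q = Md (connector f)" "f \<in> T"
    by (auto simp: walks_between_def)
  then obtain p where p: "expands p q" using mid_saw_is_expansion X T by blast
  have "hd p = Md e" "last p = Md f"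
    using expands_hd[OF p] expands_last[OF p] ef by (auto simp: connector_inj)
  then have "p \<in> walks_between E0 X T"
    using expands_mid_to_mid[OF p] ef(3,5) by (auto simp: mid_to_mid_iff walks_between_def)
  then show "q \<in> (\<Union>p\<in>walks_between E0 X T. expansions p)" using p by (auto simp: expansions_def)
next
  fix q assume "q \<in> (\<Union>p\<in>walks_between E0 X T. expansions p)"
  then obtain p where p: "p \<in> walks_between E0 X T" "expands p q" by (auto simp: expansions_def)
  then show "q \<in> walks_between E1 (connector ` X) (connector ` T)"
    using expands_hd[OF p(2)] expands_last[OF p(2)] expands_mid_saw[OF p(2)]
    by (auto simp: walks_between_def)
qed

lemma disjoint_expansions: "disjoint_family_on expansions S"
  using expands_collapse by (auto simp: disjoint_family_on_def expansions_def)

lemma takeWhile_passage: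
  assumes "f \<in> edge_set E0" "hd q = Md (connector f)" "q \<noteq> []"
  shows "takeWhile (\<lambda>x. collapse_pos x = Vx v) (passage v vs @ q) = passage v vs"
proof -
  have "\<not> collapse_pos (hd q) = Vx v" using assms collapse_pos_connector by simp
  then have "takeWhile (\<lambda>x. collapse_pos x = Vx v) q = []" using assms(3) by (cases q) auto
  then show ?thesis using collapse_pos_passage by (subst takeWhile_append2) auto
qed

lemma expansions_step:
  assumes "mid_to_mid E0 (Md e # Vx v # Md f # p)"
  shows "expansions (Md e # Vx v # Md f # p) =
    (\<lambda>(vs, q). Md (connector e) # passage v vs @ q) `
      (saws_between Ge (port v e) (port v f) \<times> expansions (Md f # p))"
  using assms by (auto simp: expansions_def elim: expands.cases mid_to_mid.cases
    intro: expands.step)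

lemma inj_on_expansion_step:
  "inj_on (\<lambda>(vs, q). Md (connector e) # passage v vs @ q) (S \<times> expansions (Md f # p))"
proof (rule inj_onI, clarify)
  fix vs q vs' q'
  assume q: "q \<in> expansions (Md f # p)" "q' \<in> expansions (Md f # p)"
    and eq: "passage v vs @ q = passage v vs' @ q'"
  have "takeWhile (\<lambda>x. collapse_pos x = Vx v) (passage v us @ r) = passage v us"
    if "r \<in> expansions (Md f # p)" for us r
    using that takeWhile_passage expands_hd unfolding expansions_def by blast
  then have "passage v vs = passage v vs'" using q eq by metis
  then show "vs = vs' \<and> q = q'" using eq by (auto simp: inj_map_eq_map inj_def)
qed

lemma expansions_gf:
  assumes "mid_to_mid E0 p"
  shows "finite (expansions p)" "(\<Sum>q\<in>expansions p. x ^ wlen q) = gadget_gf x ^ wlen p"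
proof -
  from assms have "finite (expansions p) \<and> (\<Sum>q\<in>expansions p. x ^ wlen q) = gadget_gf x ^ wlen p"
  proof (induction rule: mid_to_mid.induct)
    case (mid e)
    then have "expansions [Md e] = {[Md (connector e)]}"
      by (auto simp: expansions_def elim: expands.cases intro: expands.mid)
    then show ?case by simp
  next
    case (step f p e v)
    let ?paths = "saws_between Ge (port v e) (port v f)"
    let ?join = "\<lambda>(vs, q). Md (connector e) # passage v vs @ q"
    have "mid_to_mid E0 (Md e # Vx v # Md f # p)" using step.hyps by (intro mid_to_mid.step)
    note expansions = expansions_step[OF this]
    have "port v e \<noteq> port v f" using port_inj step.hyps by auto
    then have paths_gf: "(\<Sum>vs\<in>?paths. x ^ length vs) = gadget_gf x"
      using path_gf_ports[of "port v e" "port v f" x] port_in_ports step.hyps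
      by (simp add: path_gf_def)
    have "(\<Sum>q\<in>expansions (Md e # Vx v # Md f # p). x ^ wlen q)
        = (\<Sum>z\<in>?paths \<times> expansions (Md f # p). x ^ wlen (?join z))"
      unfolding expansions by (simp add: sum.reindex[OF inj_on_expansion_step] del: wlen_simps)
    also have "\<dots> = (\<Sum>(vs, q)\<in>?paths \<times> expansions (Md f # p). x ^ length vs * x ^ wlen q)"
      by (intro sum.cong) (auto simp: power_add)
    also have "\<dots> = (\<Sum>vs\<in>?paths. x ^ length vs) * (\<Sum>q\<in>expansions (Md f # p). x ^ wlen q)"
      by (simp add: sum_product sum.cartesian_product)
    also have "\<dots> = gadget_gf x ^ wlen (Md e # Vx v # Md f # p)" using paths_gf step.IH by simp
    finally show ?case
      using step.IH finite_gadget_saws[OF port_in_gadget[OF step.hyps(2,4)]]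
      by (simp add: expansions)
  qed
  then show "finite (expansions p)" "(\<Sum>q\<in>expansions p. x ^ wlen q) = gadget_gf x ^ wlen p" by auto
qed

end

section \<open>Comparison of the walk sums\<close>

lemma distinct_lists_bounds:
  assumes "finite S" "card S \<le> n"
  shows "finite {xs. distinct xs \<and> set xs \<subseteq> S}"
    and "card {xs. distinct xs \<and> set xs \<subseteq> S} \<le> (\<Sum>i\<le>n. n ^ i)"
    and "distinct xs \<Longrightarrow> set xs \<subseteq> S \<Longrightarrow> length xs \<le> n"
proof -
  show length: "length xs \<le> n" if "distinct xs" "set xs \<subseteq> S" for xs
    using card_mono[OF assms(1) that(2)] assms(2) distinct_card[OF that(1)] by simp
  have sub: "{xs. distinct xs \<and> set xs \<subseteq> S} \<subseteq> {xs. set xs \<subseteq> S \<and> length xs \<le> n}"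
    using length by blast
  have fin: "finite {xs. set xs \<subseteq> S \<and> length xs \<le> n}"
    using assms(1) by (rule finite_lists_length_le)
  show "finite {xs. distinct xs \<and> set xs \<subseteq> S}" using sub fin by (rule finite_subset)
  have "card {xs. distinct xs \<and> set xs \<subseteq> S} \<le> (\<Sum>i\<le>n. card S ^ i)"
    using card_mono[OF fin sub] by (simp add: card_lists_length_le[OF assms(1)])
  also have "\<dots> \<le> (\<Sum>i\<le>n. n ^ i)" using assms(2) by (intro sum_mono power_mono) auto
  finally show "card {xs. distinct xs \<and> set xs \<subseteq> S} \<le> (\<Sum>i\<le>n. n ^ i)" .
qed

context local_transformation begin

lemma expansion_weight_bounds:
  assumes p: "mid_to_mid E0 p" and x: "x > 0"
  shows "(\<Sum>q\<in>expansions p. weight x y (wlen q))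
      \<le> real (card Gv) powr \<bar>y\<bar> * weight (gadget_gf x) y (wlen p)" (is ?upper)
    and "weight (gadget_gf x) y (wlen p)
      \<le> real (card Gv) powr \<bar>y\<bar> * (\<Sum>q\<in>expansions p. weight x y (wlen q))" (is ?lower)
proof -
  let ?D = "real (card Gv) powr \<bar>y\<bar>" and ?m = "\<lambda>n. real (max 1 n) powr - y"
  have weight_p: "weight (gadget_gf x) y (wlen p) = (\<Sum>q\<in>expansions p. x ^ wlen q * ?m (wlen p))"
    by (simp add: weight_def expansions_gf(2)[OF p] flip: sum_distrib_right)
  have m_le: "?m (wlen q) \<le> ?D * ?m (wlen p) \<and> ?m (wlen p) \<le> ?D * ?m (wlen q)"
    if q: "q \<in> expansions p" for q
  proof -
    have wlen: "wlen p \<le> wlen q" "wlen q \<le> card Gv * wlen p"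
      using q expands_wlen by (auto simp: expansions_def)
    have "card Gv * wlen p \<le> card Gv * max 1 (wlen p)" "max 1 (wlen q) \<le> card Gv * max 1 (wlen q)"
      using mult_le_mono1[OF card_gadget_pos, of "max 1 (wlen q)"] by simp_all
    then have "wlen q \<le> card Gv * max 1 (wlen p)" "wlen p \<le> card Gv * max 1 (wlen q)"
      using wlen by linarith+
    then show ?thesis
      using card_gadget_pos max_1_powr_le_of_comparable[of _ "card Gv" _ "- y"] by simp
  qed
  have "weight x y (wlen q) \<le> ?D * (x ^ wlen q * ?m (wlen p)) \<and>
      x ^ wlen q * ?m (wlen p) \<le> ?D * weight x y (wlen q)" if "q \<in> expansions p" for q
    using m_le[OF that] x mult_left_mono[of _ _ "x ^ wlen q"]
    unfolding weight_def mult.left_commute[of ?D] by (intro conjI mult_left_mono) auto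
  then show ?upper ?lower
    unfolding weight_p sum_distrib_left by (intro sum_mono; blast)+
qed

lemma walk_sum_connectors:
  assumes X: "X \<subseteq> edge_set E0" and T: "T \<subseteq> edge_set E0" and x: "x > 0"
  shows "walk_sum x y (walks_between E1 (connector ` X) (connector ` T)) =
    (\<Sum>\<^sub>\<infinity>p\<in>walks_between E0 X T. ennreal (\<Sum>q\<in>expansions p. weight x y (wlen q)))"
proof -
  have "(\<Sum>\<^sub>\<infinity>q\<in>expansions p. ennreal (weight x y (wlen q)))
      = ennreal (\<Sum>q\<in>expansions p. weight x y (wlen q))"
    if "p \<in> walks_between E0 X T" for p
    using expansions_gf(1)[OF walks_between_mid_to_mid[OF X T that]] x by (simp add: weight_nonneg)
  then show ?thesis
    unfolding walk_sum_def walks_between_connectors[OF X T]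
    by (subst infsum_UN_disjoint_ennreal[OF disjoint_expansions]) (rule infsum_cong)
qed

lemma walk_sum_connectors_bounds:
  assumes X: "X \<subseteq> edge_set E0" and T: "T \<subseteq> edge_set E0" and x: "x > 0"
  shows "walk_sum x y (walks_between E1 (connector ` X) (connector ` T))
      \<le> ennreal (real (card Gv) powr \<bar>y\<bar>) * walk_sum (gadget_gf x) y (walks_between E0 X T)"
      (is ?upper)
    and "walk_sum (gadget_gf x) y (walks_between E0 X T)
      \<le> ennreal (real (card Gv) powr \<bar>y\<bar>) *
        walk_sum x y (walks_between E1 (connector ` X) (connector ` T))"
      (is ?lower)
proof -
  have nonneg: "0 \<le> weight (gadget_gf x) y n" "0 \<le> (\<Sum>q\<in>expansions p. weight x y (wlen q))" for n p
    using x gadget_gf_pos[OF x] by (auto intro!: weight_nonneg sum_nonneg)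
  note bounds = expansion_weight_bounds[OF walks_between_mid_to_mid[OF X T] x]
  show ?upper
    unfolding walk_sum_connectors[OF assms] unfolding walk_sum_def infsum_cmult_ennreal[symmetric]
    using bounds(1) nonneg(1) by (intro infsum_mono)
      (auto simp: ennreal_leI simp flip: ennreal_mult)
  show ?lower
    unfolding walk_sum_connectors[OF assms] unfolding walk_sum_def infsum_cmult_ennreal[symmetric]
    using bounds(2) nonneg(2) by (intro infsum_mono)
      (auto simp: ennreal_leI simp flip: ennreal_mult)
qed

definition gadget_pos :: "'v \<Rightarrow> ('v \<times> 'g) pos set" where
  "gadget_pos v = Vx ` ({v} \<times> Gv) \<union> Md ` Pow ({v} \<times> Gv)"

definition internal_lists :: "'v set \<Rightarrow> ('v \<times> 'g) pos list set" where
  "internal_lists U = {xs. distinct xs \<and> set xs \<subseteq> (\<Union>v\<in>U. gadget_pos v)}"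

definition max_internal :: "nat \<Rightarrow> nat" where
  "max_internal k = k * (card Gv + 2 ^ card Gv)"

definition internal_lists_bound :: "nat \<Rightarrow> nat" where
  "internal_lists_bound k = (\<Sum>i\<le>max_internal k. max_internal k ^ i)"

lemma gadget_pos_bounds: "finite (gadget_pos v)" "card (gadget_pos v) \<le> card Gv + 2 ^ card Gv"
proof -
  show "finite (gadget_pos v)" using finite_gadget by (simp add: gadget_pos_def)
  have "card (gadget_pos v) \<le> card (Vx ` ({v} \<times> Gv)) + card (Md ` Pow ({v} \<times> Gv))"
    unfolding gadget_pos_def by (rule card_Un_le)
  also have "\<dots> \<le> card ({v} \<times> Gv) + card (Pow ({v} \<times> Gv))"
    using finite_gadget by (intro add_mono card_image_le) auto
  finally show "card (gadget_pos v) \<le> card Gv + 2 ^ card Gv"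
    using finite_gadget by (simp add: card_Pow card_cartesian_product)
qed

lemma internal_lists_bounds:
  assumes "finite U" "card U \<le> k"
  shows "finite (internal_lists U)" "card (internal_lists U) \<le> internal_lists_bound k"
    and "xs \<in> internal_lists U \<Longrightarrow> length xs \<le> max_internal k"
proof -
  have "card (\<Union>v\<in>U. gadget_pos v) \<le> (\<Sum>v\<in>U. card (gadget_pos v))" using assms(1) by (rule card_UN_le)
  also have "\<dots> \<le> card U * (card Gv + 2 ^ card Gv)"
    using sum_bounded_above[of U "\<lambda>v. card (gadget_pos v)"] gadget_pos_bounds(2) by simp
  also have "\<dots> \<le> max_internal k" unfolding max_internal_def using assms(2) by (rule mult_le_mono1)
  finally have card: "card (\<Union>v\<in>U. gadget_pos v) \<le> max_internal k" .
  have fin: "finite (\<Union>v\<in>U. gadget_pos v)" using assms(1) gadget_pos_bounds(1) by blast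
  show "finite (internal_lists U)" "card (internal_lists U) \<le> internal_lists_bound k"
    and "xs \<in> internal_lists U \<Longrightarrow> length xs \<le> max_internal k"
    using distinct_lists_bounds[OF fin card]
    by (auto simp: internal_lists_def internal_lists_bound_def)
qed

lemma Md_in_gadget_pos: "Md \<epsilon> \<in> gadget_pos v \<Longrightarrow> y \<in> \<epsilon> \<Longrightarrow> fst y = v"
  by (auto simp: gadget_pos_def)

lemma in_gadget_posI:
  assumes "pos_in_graph V1 E1 x" "collapse_pos x = Vx v"
  shows "x \<in> gadget_pos v"
proof (cases x)
  case (Vx y)
  then show ?thesis using assms by (auto simp: gadget_pos_def phi_V_def)
next
  case (Md \<epsilon>)
  then have \<epsilon>: "\<epsilon> \<in> edge_set E1" using assms(1) by simp
  then obtain y where y: "y \<in> \<epsilon>" using edge_set_cards(2) by blast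
  have "fst ` \<epsilon> = {v}" using collapse_pos_Md_internal[OF _ y] assms(2) Md by simp
  moreover have "\<epsilon> \<subseteq> V1" using simple_transformed \<epsilon> by (rule edge_subset_verts)
  ultimately have "\<epsilon> \<subseteq> {v} \<times> Gv" by (force simp: phi_V_def)
  then show ?thesis using Md by (simp add: gadget_pos_def)
qed

lemma external_is_connector:
  assumes "pos_in_graph V1 E1 x" "\<not> internal x"
  obtains e where "e \<in> edge_set E0" "x = Md (connector e)"
proof (cases x)
  case (Md \<epsilon>)
  then obtain e where "collapse_pos (Md \<epsilon>) = Md e"
    using assms(2) by (cases "collapse_pos (Md \<epsilon>)") auto
  then show ?thesis using collapse_pos_eq_Md[of \<epsilon> e] assms(1) Md that by auto
qed (use assms(2) in simp)

lemma internal_step_collapse_eq: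
  assumes "step_ok E1 a b" "internal a" "internal b"
  shows "collapse_pos a = collapse_pos b"
  using assms(1)
proof (cases rule: step_okE)
  case (leave v e)
  then show ?thesis using assms(3) collapse_pos_Md_internal(2)[of e v] by simp
next
  case (enter e v)
  then show ?thesis using assms(2) collapse_pos_Md_internal(2)[of e v] by simp
qed

lemma internal_walk_in_gadget:
  assumes "successively (step_ok E1) xs" "\<forall>x\<in>set xs. internal x \<and> pos_in_graph V1 E1 x"
    and "xs \<noteq> [] \<Longrightarrow> collapse_pos (hd xs) = Vx v"
  shows "set xs \<subseteq> gadget_pos v"
proof -
  have "\<forall>x\<in>set xs. collapse_pos x = Vx v"
  proof (rule successively_invariant[OF assms(1)])
    show "collapse_pos y = Vx v"
      if "x \<in> set xs" "y \<in> set xs" "step_ok E1 x y" "collapse_pos x = Vx v" for x y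
      using internal_step_collapse_eq[OF that(3)] that assms(2) by simp
  qed (rule assms(3))
  then show ?thesis using assms(2) in_gadget_posI by blast
qed

lemma internal_tail_in_gadget:
  assumes walk: "successively (step_ok E1) (Md (connector f) # B)" and f: "f \<in> edge_set E0"
    and inner: "\<forall>x\<in>set B. internal x \<and> pos_in_graph V1 E1 x"
  shows "\<exists>v\<in>f. set B \<subseteq> gadget_pos v"
proof (cases "B = []")
  case True
  then show ?thesis using edge_set_cards(2)[OF f] by auto
next
  case False
  then have "step_ok E1 (Md (connector f)) (hd B)" using walk by (simp add: successively_Cons)
  then obtain y where y: "hd B = Vx y" "y \<in> connector f" by (cases "hd B") auto
  then have "fst y \<in> f" by (auto simp: connector_def)
  moreover have "set B \<subseteq> gadget_pos (fst y)"
    using walk inner y(1) by (intro internal_walk_in_gadget) (auto simp: successively_Cons)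
  ultimately show ?thesis by blast
qed

lemma internal_tail_end:
  assumes "successively (step_ok E1) (Md (connector f) # B)" "f \<in> edge_set E0"
    "\<forall>x\<in>set B. internal x \<and> pos_in_graph V1 E1 x"
    and last: "last (Md (connector f) # B) = Md \<epsilon>" "y \<in> \<epsilon>"
  shows "fst y \<in> f" "set B \<subseteq> gadget_pos (fst y)"
proof -
  obtain v where v: "v \<in> f" "set B \<subseteq> gadget_pos v"
    using internal_tail_in_gadget[OF assms(1-3)] by blast
  have "fst y \<in> f \<and> set B \<subseteq> gadget_pos (fst y)"
  proof (cases "B = []")
    case True
    then have "y \<in> connector f" using last by simp
    then show ?thesis using True by (auto simp: connector_def)
  next
    case False
    then have "Md \<epsilon> \<in> gadget_pos v" using last(1) v(2) last_in_set[of B] by auto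
    then have "fst y = v" using last(2) by (rule Md_in_gadget_pos)
    then show ?thesis using v by simp
  qed
  then show "fst y \<in> f" "set B \<subseteq> gadget_pos (fst y)" by auto
qed

lemma Sig_pos_in_graph: "p \<in> Sig E1 W1 \<Longrightarrow> x \<in> set p \<Longrightarrow> pos_in_graph V1 E1 x"
  using mid_saw_in_graph[OF simple_transformed] by (auto simp: Sig_def inc_edges_def)

lemma internal_Sig_in_gadget:
  assumes p: "p \<in> Sig E1 W1" and inner: "\<forall>x\<in>set p. internal x"
  obtains w where "w \<in> W0" "set p \<subseteq> gadget_pos w"
proof -
  obtain \<epsilon> w where \<epsilon>: "hd p = Md \<epsilon>" "w \<in> W1" "w \<in> \<epsilon>" using p by (auto simp: Sig_def inc_edges_def)
  have walk: "p \<noteq> []" "successively (step_ok E1) p" using p by (auto simp: Sig_def mid_saw_def)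
  then have "internal (Md \<epsilon>)" using inner \<epsilon>(1) hd_in_set by metis
  then have "collapse_pos (hd p) = Vx (fst w)" using collapse_pos_Md_internal(2) \<epsilon> by simp
  then have "set p \<subseteq> gadget_pos (fst w)"
    using walk(2) inner Sig_pos_in_graph[OF p] by (intro internal_walk_in_gadget) auto
  then show ?thesis using that \<epsilon>(2) by auto
qed

lemma finite_internal_Sig: "finite {p \<in> Sig E1 W1. \<forall>x\<in>set p. internal x}"
proof (rule finite_subset)
  show "{p \<in> Sig E1 W1. \<forall>x\<in>set p. internal x} \<subseteq> internal_lists W0"
  proof clarify
    fix p assume p: "p \<in> Sig E1 W1" "\<forall>x\<in>set p. internal x"
    then obtain w where "w \<in> W0" "set p \<subseteq> gadget_pos w" by (rule internal_Sig_in_gadget)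
    moreover have "distinct p" using p(1) by (simp add: Sig_def mid_saw_def)
    ultimately show "p \<in> internal_lists W0" by (auto simp: internal_lists_def)
  qed
qed (rule internal_lists_bounds(1)[OF G0.finite_W order_refl])

text \<open>The part of a walk between its first and last connectors.\<close>

definition core :: "('v \<times> 'g) pos list \<Rightarrow> ('v \<times> 'g) pos list" where
  "core p = rev (dropWhile internal (rev (dropWhile internal p)))"

lemma core_split:
  assumes "\<exists>x\<in>set p. \<not> internal x"
  obtains A B where "p = A @ core p @ B" "core p \<noteq> []" "\<forall>x\<in>set A \<union> set B. internal x"
    "\<not> internal (hd (core p))" "\<not> internal (last (core p))"
proof -
  define p' where "p' = dropWhile internal p"
  define A where "A = takeWhile internal p"
  define B where "B = rev (takeWhile internal (rev p'))"
  have core: "core p = rev (dropWhile internal (rev p'))" by (simp add: core_def p'_def)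
  have p': "p' \<noteq> []" "\<not> internal (hd p')"
    using assms hd_dropWhile[of internal p] by (auto simp: p'_def dropWhile_eq_Nil_conv)
  then have core_ne: "dropWhile internal (rev p') \<noteq> []" by (auto simp: dropWhile_eq_Nil_conv)
  have p'_split: "p' = core p @ B"
    unfolding core B_def by (metis rev_append rev_rev_ident takeWhile_dropWhile_id)
  have "p = A @ core p @ B" unfolding p'_split[symmetric] by (simp add: A_def p'_def)
  moreover have "\<not> internal (last (core p))"
    using hd_dropWhile[OF core_ne] by (simp add: core last_rev)
  moreover have "core p \<noteq> []" using core_ne by (simp add: core)
  moreover from this have "\<not> internal (hd (core p))" using p'(2) p'_split by (metis hd_append2)
  moreover have "\<forall>x\<in>set A \<union> set B. internal x" by (auto simp: A_def B_def dest: set_takeWhileD)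
  ultimately show ?thesis using that by blast
qed

lemma core_between_connectors:
  assumes p: "p \<in> Sig E1 W1" and external: "\<exists>x\<in>set p. \<not> internal x"
  obtains A B e f where "p = A @ core p @ B" "e \<in> edge_set E0" "f \<in> edge_set E0"
    "core p \<in> walks_between E1 {connector e} {connector f}" "\<forall>x\<in>set A \<union> set B. internal x"
proof -
  obtain A B where split: "p = A @ core p @ B" "core p \<noteq> []" "\<forall>x\<in>set A \<union> set B. internal x"
    "\<not> internal (hd (core p))" "\<not> internal (last (core p))" using core_split[OF external] .
  define C where "C = core p"
  note split = split[folded C_def]
  have ends: "hd C \<in> set p" "last C \<in> set p"
    using split(1,2) by (metis Un_iff hd_in_set last_in_set set_append)+
  obtain e where e: "e \<in> edge_set E0" "hd C = Md (connector e)"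
    using external_is_connector[OF Sig_pos_in_graph[OF p ends(1)] split(4)] .
  obtain f where f: "f \<in> edge_set E0" "last C = Md (connector f)"
    using external_is_connector[OF Sig_pos_in_graph[OF p ends(2)] split(5)] .
  have "mid_saw E1 C"
    using p split(1,2) by (auto simp: Sig_def mid_saw_def successively_append_iff)
  then have "C \<in> walks_between E1 {connector e} {connector f}"
    using e(2) f(2) by (simp add: walks_between_def)
  then show ?thesis using that[of A B e f, folded C_def] split(1,3) e(1) f(1) by blast
qed

lemma core_decompose:
  assumes p: "p \<in> Sig E1 W1" and external: "\<exists>x\<in>set p. \<not> internal x"
  obtains A B e f where "p = A @ core p @ B" "e \<in> inc_edges E0 W0" "f \<in> edge_set E0"
    "core p \<in> walks_between E1 {connector e} {connector f}"
    "A \<in> internal_lists W0" "B \<in> internal_lists f"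
    "\<forall>\<epsilon>. last p = Md \<epsilon> \<longrightarrow> fst ` \<epsilon> \<subseteq> f"
proof -
  obtain A B e f where split: "p = A @ core p @ B" "e \<in> edge_set E0" "f \<in> edge_set E0"
    "core p \<in> walks_between E1 {connector e} {connector f}" "\<forall>x\<in>set A \<union> set B. internal x"
    using core_between_connectors[OF p external] .
  define C where "C = core p"
  note split = split[folded C_def]
  have C: "C \<noteq> []" "hd C = Md (connector e)" "last C = Md (connector f)"
    using split(4) by (auto simp: walks_between_def mid_saw_def)
  have walk: "successively (step_ok E1) (A @ C @ B)" "distinct (A @ C @ B)"
    using p split(1) by (auto simp: Sig_def mid_saw_def)
  have inner: "\<forall>x\<in>set A. internal x \<and> pos_in_graph V1 E1 x"
    "\<forall>x\<in>set B. internal x \<and> pos_in_graph V1 E1 x"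
    using split(1,5) Sig_pos_in_graph[OF p] by (metis Un_iff set_append)+
  have "successively (step_ok E1) (A @ [Md (connector e)])"
    using walk(1) C(1,2) by (auto simp: successively_append_iff)
  then have "successively (step_ok E1) (rev (A @ [Md (connector e)]))"
    unfolding successively_rev by (rule successively_mono) (rule step_ok_sym)
  then have rev_A: "successively (step_ok E1) (Md (connector e) # rev A)" by simp
  obtain \<epsilon> w where w: "hd p = Md \<epsilon>" "w \<in> W1" "w \<in> \<epsilon>" using p by (auto simp: Sig_def inc_edges_def)
  have "last (Md (connector e) # rev A) = Md \<epsilon>" using split(1) C(1,2) w(1) by (cases A) auto
  then have A: "fst w \<in> e" "set A \<subseteq> gadget_pos (fst w)"
    using internal_tail_end[OF rev_A split(2) _ _ w(3)] inner(1) by simp_all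
  have tail: "successively (step_ok E1) (Md (connector f) # B)"
    using walk(1) C(1,3) by (auto simp: successively_append_iff successively_Cons)
  have last_p: "last (Md (connector f) # B) = last p"
    using split(1) C(1,3) by (auto simp: last_append)
  obtain v where v: "v \<in> f" "set B \<subseteq> gadget_pos v"
    using internal_tail_in_gadget[OF tail split(3) inner(2)] by blast
  show ?thesis
  proof (rule that[of A B e f, folded C_def])
    show "e \<in> inc_edges E0 W0" using split(2) A w(2) by (auto simp: inc_edges_def)
    show "A \<in> internal_lists W0" "B \<in> internal_lists f"
      using walk(2) A(2) w(2) v unfolding internal_lists_def by force+
    show "\<forall>\<epsilon>. last p = Md \<epsilon> \<longrightarrow> fst ` \<epsilon> \<subseteq> f"
      using internal_tail_end(1)[OF tail split(3) inner(2)] unfolding last_p by blast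
  qed (use split(1,3,4) in auto)
qed

abbreviation connector_walks :: "'v set set \<Rightarrow> ('v \<times> 'g) pos list set" where
  "connector_walks T \<equiv> walks_between E1 (connector ` inc_edges E0 W0) (connector ` T)"

definition core_factor :: "real \<Rightarrow> real \<Rightarrow> real" where
  "core_factor x y = real (internal_lists_bound (card W0) * internal_lists_bound 2) *
    weight_shift x y (max_internal (card W0) + max_internal 2)"

lemma core_factor_nonneg: "0 \<le> core_factor x y"
  using weight_shift_nonneg by (simp add: core_factor_def)

lemma core_fibre:
  assumes S: "S \<subseteq> Sig E1 W1" "\<And>p. p \<in> S \<Longrightarrow> \<exists>x\<in>set p. \<not> internal x"
    and f: "f \<in> edge_set E0" "last q = Md (connector f)"
  shows "finite {p \<in> S. core p = q}"
    and "card {p \<in> S. core p = q} \<le> internal_lists_bound (card W0) * internal_lists_bound 2"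
proof -
  have fibre: "{p \<in> S. core p = q} \<subseteq> (\<lambda>(A, B). A @ q @ B) ` (internal_lists W0 \<times> internal_lists f)"
  proof clarify
    fix p assume p: "p \<in> S" and q: "q = core p"
    obtain A B e f' where d: "p = A @ core p @ B"
      "core p \<in> walks_between E1 {connector e} {connector f'}"
      "A \<in> internal_lists W0" "B \<in> internal_lists f'"
      by (rule core_decompose[OF subsetD[OF S(1) p] S(2)[OF p]]) (rule that)
    then have "f' = f" using f(2) q by (simp add: walks_between_def connector_inj)
    then show "p \<in> (\<lambda>(A, B). A @ core p @ B) ` (internal_lists W0 \<times> internal_lists f)"
      using d by (intro image_eqI[of _ _ "(A, B)"]) auto
  qed
  note initial = internal_lists_bounds[OF G0.finite_W order_refl]
    and final = internal_lists_bounds[OF edge_set_cards(1,3)[OF f(1)]]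
  have fin: "finite (internal_lists W0 \<times> internal_lists f)"
    using initial(1) final(1) by (rule finite_cartesian_product)
  show "finite {p \<in> S. core p = q}" using fibre fin by (blast intro: finite_subset)
  have "card {p \<in> S. core p = q} \<le> card (internal_lists W0) * card (internal_lists f)"
    using surj_card_le[OF fin fibre] by (simp add: card_cartesian_product)
  also have "\<dots> \<le> internal_lists_bound (card W0) * internal_lists_bound 2"
    using initial(2) final(2) by (rule mult_le_mono)
  finally show "card {p \<in> S. core p = q}
      \<le> internal_lists_bound (card W0) * internal_lists_bound 2" .
qed

lemma walk_sum_le_core:
  assumes x: "x > 0" and T: "T \<subseteq> edge_set E0" and S: "S \<subseteq> Sig E1 W1"
    and external: "\<And>p. p \<in> S \<Longrightarrow> \<exists>x\<in>set p. \<not> internal x" and core: "core ` S \<subseteq> connector_walks T"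
  shows "walk_sum x y S \<le> ennreal (core_factor x y) * walk_sum x y (connector_walks T)"
  unfolding core_factor_def
proof (rule walk_sum_le_bounded_fibres[OF x core])
  fix q assume "q \<in> connector_walks T"
  then obtain f where "f \<in> edge_set E0" "last q = Md (connector f)"
    using T by (auto simp: walks_between_def)
  then show "finite {p \<in> S. core p = q}"
    and "card {p \<in> S. core p = q} \<le> internal_lists_bound (card W0) * internal_lists_bound 2"
    using core_fibre[OF S external] by blast+
next
  fix p assume p: "p \<in> S"
  obtain A B f where d: "p = A @ core p @ B" "f \<in> edge_set E0" "A \<in> internal_lists W0"
    "B \<in> internal_lists f"
    by (rule core_decompose[OF subsetD[OF S p] external[OF p]]) (rule that)
  have "wlen A \<le> max_internal (card W0)"
    using internal_lists_bounds(3)[OF G0.finite_W order_refl d(3)] wlen_le_length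
    by (rule order_trans[rotated])
  moreover have "wlen B \<le> max_internal 2"
    using internal_lists_bounds(3)[OF edge_set_cards(1,3)[OF d(2)] d(4)] wlen_le_length
    by (rule order_trans[rotated])
  moreover have "wlen p = wlen A + wlen (core p) + wlen B" using arg_cong[OF d(1), of wlen] by simp
  ultimately show "wlen (core p) \<le> wlen p"
    "wlen p \<le> wlen (core p) + (max_internal (card W0) + max_internal 2)" by auto
qed

section \<open>The exponent gamma\<close>

lemma connector_walks_subset_Sig: "connector_walks T \<subseteq> Sig E1 W1"
  using connector_inc_edges by (auto simp: walks_between_def Sig_def)

lemma walk_sum_Sig_finite_iff:
  assumes "simple_graph V E" "x > 0"
  shows "walk_sum x y (Sig E W) < \<infinity>
      \<longleftrightarrow> walk_sum x y (walks_between E (inc_edges E W) (edge_set E)) < \<infinity>"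
proof
  assume "walk_sum x y (walks_between E (inc_edges E W) (edge_set E)) < \<infinity>"
  then show "walk_sum x y (Sig E W) < \<infinity>"
    using walk_sum_Sig_le[OF assms, of y W] by (simp add: ennreal_mult_less_top le_less_trans)
qed (use walk_sum_mono[OF walks_between_subset_Sig] in \<open>rule le_less_trans\<close>)

lemma walk_sum_Sig_transformed_finite_iff:
  assumes x: "x > 0"
  shows "walk_sum x y (Sig E1 W1) < \<infinity> \<longleftrightarrow> walk_sum x y (connector_walks (edge_set E0)) < \<infinity>"
proof
  let ?S = "{p \<in> Sig E1 W1. \<exists>z\<in>set p. \<not> internal z}"
    and ?I = "{p \<in> Sig E1 W1. \<forall>z\<in>set p. internal z}"
  assume finite: "walk_sum x y (connector_walks (edge_set E0)) < \<infinity>"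
  have "core ` ?S \<subseteq> connector_walks (edge_set E0)"
  proof clarify
    fix p z assume p: "p \<in> Sig E1 W1" "z \<in> set p" "\<not> internal z"
    then have "\<exists>x\<in>set p. \<not> internal x" by blast
    with p(1) obtain e f where "e \<in> inc_edges E0 W0" "f \<in> edge_set E0"
      "core p \<in> walks_between E1 {connector e} {connector f}" by (rule core_decompose)
    then show "core p \<in> connector_walks (edge_set E0)" by (auto simp: walks_between_def)
  qed
  then have "walk_sum x y ?S
      \<le> ennreal (core_factor x y) * walk_sum x y (connector_walks (edge_set E0))"
    by (intro walk_sum_le_core x) auto
  then have "walk_sum x y ?S < \<infinity>"
    using finite by (simp add: ennreal_mult_less_top le_less_trans)
  moreover have "walk_sum x y ?I < \<infinity>"
    using finite_internal_Sig by (simp add: walk_sum_def)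
  moreover have "walk_sum x y (?S \<union> ?I) = walk_sum x y ?S + walk_sum x y ?I"
    unfolding walk_sum_def by (rule infsum_Un_disjoint) auto
  moreover have "Sig E1 W1 = ?S \<union> ?I" by blast
  ultimately show "walk_sum x y (Sig E1 W1) < \<infinity>" by simp
qed (use walk_sum_mono[OF connector_walks_subset_Sig] in \<open>rule le_less_trans\<close>)

theorem Yfun_finite_iff:
  assumes x: "x > 0"
  shows "Yfun E1 W1 x y < \<infinity> \<longleftrightarrow> Yfun E0 W0 (gadget_gf x) y < \<infinity>"
proof -
  let ?S0 = "walks_between E0 (inc_edges E0 W0) (edge_set E0)"
  note bounds = walk_sum_connectors_bounds[OF inc_edges_subset order_refl x, where y = y]
  have "walk_sum x y (connector_walks (edge_set E0)) < \<infinity> \<longleftrightarrow> walk_sum (gadget_gf x) y ?S0 < \<infinity>"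
    using le_less_trans[OF bounds(1)] le_less_trans[OF bounds(2)]
    by (auto simp: ennreal_mult_less_top)
  then show ?thesis
    unfolding Yfun_eq_walk_sum walk_sum_Sig_transformed_finite_iff[OF x]
      walk_sum_Sig_finite_iff[OF G0(1) gadget_gf_pos[OF x]] .
qed

lemma gadget_gf_le_radius:
  assumes "0 < x" "x < 1 / G1.\<mu>"
  shows "gadget_gf x \<le> 1 / G0.\<mu>"
proof (rule ccontr)
  assume "\<not> gadget_gf x \<le> 1 / G0.\<mu>"
  then have "Yfun E0 W0 (gadget_gf x) 0 = \<infinity>" by (intro G0.Yfun_infinite_above_radius) simp
  then show False using G1.Yfun_finite_below_radius[OF assms] Yfun_finite_iff[OF assms(1), of 0]
    by simp
qed

lemma gadget_gf_ge_radius: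
  assumes "x > 1 / G1.\<mu>"
  shows "gadget_gf x \<ge> 1 / G0.\<mu>"
proof (rule ccontr)
  have x: "x > 0" using assms G1.mu_pos by (meson less_trans zero_less_divide_1_iff)
  assume "\<not> gadget_gf x \<ge> 1 / G0.\<mu>"
  then have "Yfun E0 W0 (gadget_gf x) 0 < \<infinity>"
    by (intro G0.Yfun_finite_below_radius gadget_gf_pos x) simp
  then show False using G1.Yfun_infinite_above_radius[OF assms] Yfun_finite_iff[OF x, of 0] by simp
qed

theorem gadget_gf_conn_const: "gadget_gf (1 / conn_const V1 E1) = 1 / conn_const V0 E0"
  unfolding G0.conn_const_eq G1.conn_const_eq
proof (rule antisym)
  let ?x = "1 / G1.\<mu>"
  have lim: "(gadget_gf \<longlongrightarrow> gadget_gf ?x) (at_left ?x)" "(gadget_gf \<longlongrightarrow> gadget_gf ?x) (at_right ?x)"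
    using isCont_gadget_gf[of ?x] by (auto simp: isCont_def filterlim_at_split)
  have "\<forall>\<^sub>F x in at_left ?x. 0 < x \<and> x < ?x"
    using eventually_at_left_real[of 0 ?x] G1.mu_pos by (simp add: eventually_mono)
  then show "gadget_gf ?x \<le> 1 / G0.\<mu>"
    by (intro tendsto_upperbound[OF lim(1)])
       (auto elim!: eventually_mono intro: gadget_gf_le_radius)
  show "1 / G0.\<mu> \<le> gadget_gf ?x"
    by (intro tendsto_lowerbound[OF lim(2)])
       (auto intro: eventually_mono[OF eventually_at_right_less] gadget_gf_ge_radius)
qed

theorem gamma_exp_transformed:
  assumes "gamma_exp V0 E0 W0 g"
  shows "gamma_exp V1 E1 W1 g"
proof -
  have "1 / conn_const V1 E1 > 0" using G1.mu_pos by (simp add: G1.conn_const_eq)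
  then have "Yfun E1 W1 (1 / conn_const V1 E1) y < \<infinity> \<longleftrightarrow> Yfun E0 W0 (1 / conn_const V0 E0) y < \<infinity>"
    for y
    using Yfun_finite_iff[of "1 / conn_const V1 E1" y] by (simp add: gadget_gf_conn_const)
  then show ?thesis
    using assms unfolding gamma_exp_def
    by (metis infinity_ennreal_def less_irrefl top.not_eq_extremum)
qed

end

section \<open>Automorphisms and graph distance\<close>

lemma image_edge_aut:
  assumes "simple_graph V E" "aut V E f" "e \<in> edge_set E"
  shows "f ` e \<in> edge_set E"
proof -
  obtain u v where uv: "e = {u, v}" "E u v" using assms(3) by (auto simp: edge_set_def)
  then have "E (f u) (f v)" using assms(2) simple_graphD(1,2)[OF assms(1) uv(2)]
    by (simp add: aut_def)
  then show ?thesis using edge_setI uv(1) by fastforce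
qed

lemma image_inc_edges_aut:
  assumes G: "simple_graph V E" and f: "aut V E f" and W: "W \<subseteq> V"
  shows "(`) f ` inc_edges E W = inc_edges E (f ` W)"
proof (intro equalityI subsetI)
  fix e assume "e \<in> (`) f ` inc_edges E W"
  then show "e \<in> inc_edges E (f ` W)" using image_edge_aut[OF G f] by (auto simp: inc_edges_def)
next
  fix e assume "e \<in> inc_edges E (f ` W)"
  then obtain w where w: "e \<in> edge_set E" "w \<in> W" "f w \<in> e" by (auto simp: inc_edges_def)
  obtain u where u: "e = {f w, u}" "E (f w) u" using edge_set_obtain_neighbour[OF G w(1,3)] .
  then obtain u' where u': "u' \<in> V" "u = f u'"
    using f simple_graphD(2)[OF G] by (metis aut_def bij_betw_def imageE)
  then have "E w u'" using f u(2) w(2) W by (auto simp: aut_def)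
  then have "{w, u'} \<in> inc_edges E W" using w(2) by (auto simp: inc_edges_def intro: edge_setI)
  then show "e \<in> (`) f ` inc_edges E W" using u(1) u'(2) by (intro image_eqI[of _ _ "{w, u'}"]) auto
qed

lemma gdist_le: "(u, v) \<in> {(a, b). E a b} ^^ n \<Longrightarrow> gdist E u v \<le> n"
  unfolding gdist_def by (rule Least_le)

lemma gdist_relpow:
  assumes "connected_graph V E" "u \<in> V" "v \<in> V"
  shows "(u, v) \<in> {(a, b). E a b} ^^ gdist E u v"
proof -
  have "(u, v) \<in> {(a, b). E a b}\<^sup>*" using assms by (auto simp: connected_graph_def)
  then show ?thesis unfolding gdist_def by (rule LeastI_ex[OF rtrancl_imp_relpow])
qed

lemma setdist_le: "u \<in> A \<Longrightarrow> v \<in> B \<Longrightarrow> setdist E A B \<le> gdist E u v"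
  unfolding setdist_def by (intro cInf_lower) auto

lemma setdist_attained:
  assumes "A \<noteq> {}" "B \<noteq> {}"
  obtains u v where "u \<in> A" "v \<in> B" "setdist E A B = gdist E u v"
proof -
  have "setdist E A B \<in> {gdist E u v | u v. u \<in> A \<and> v \<in> B}"
    unfolding setdist_def using assms by (intro Inf_nat_def1) auto
  then show ?thesis using that by blast
qed

lemma disjoint_of_setdist_pos:
  assumes "setdist E A B \<ge> 1"
  shows "A \<inter> B = {}"
proof (rule ccontr)
  assume "A \<inter> B \<noteq> {}"
  then obtain u where "u \<in> A" "u \<in> B" by blast
  then have "setdist E A B \<le> gdist E u u" by (rule setdist_le)
  also have "\<dots> \<le> 0" by (rule gdist_le) simp
  finally show False using assms by simp
qed

lemma successively_relpow:
  "successively E p \<Longrightarrow> p \<noteq> [] \<Longrightarrow> (hd p, last p) \<in> {(a, b). E a b} ^^ (length p - 1)"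
proof (induction p rule: induct_list012)
  case (3 x y zs)
  then have "(y, last (y # zs)) \<in> {(a, b). E a b} ^^ length zs" by simp
  then have "(x, last (y # zs)) \<in> {(a, b). E a b} ^^ Suc (length zs)"
    using "3.prems"(1) by (intro relpow_Suc_I2) auto
  then show ?case by simp
qed auto

context local_transformation begin

lemma relpow_collapse:
  assumes "(x, y) \<in> {(a, b). E1 a b} ^^ m"
  shows "\<exists>n\<le>m. (fst x, fst y) \<in> {(a, b). E0 a b} ^^ n"
  using assms
proof (induction m arbitrary: y)
  case (Suc m)
  then obtain z where z: "(x, z) \<in> {(a, b). E1 a b} ^^ m" "E1 z y" by auto
  obtain n where n: "n \<le> m" "(fst x, fst z) \<in> {(a, b). E0 a b} ^^ n" using Suc.IH[OF z(1)] by blast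
  from z(2) show ?case
  proof (cases rule: E1_cases)
    case (within v a b)
    then show ?thesis using n by (intro exI[of _ n]) auto
  next
    case (between u v)
    then have "(fst x, fst y) \<in> {(a, b). E0 a b} ^^ Suc n"
      using n by (intro relpow_Suc_I[of _ "fst z"]) auto
    then show ?thesis using n by (intro exI[of _ "Suc n"]) auto
  qed
qed auto

lemma relpow_within_gadget:
  assumes "v \<in> V0" "a \<in> Gv" "b \<in> Gv"
  shows "\<exists>m<card Gv. ((v, a), (v, b)) \<in> {(a, b). E1 a b} ^^ m"
proof -
  obtain vs where vs: "vs \<in> saws_between Ge a b" using gadget_saws_nonempty assms(2,3) by blast
  have "successively E1 (map (Pair v) vs)" using assms(1) vs by (rule successively_copy)
  then have "((v, a), (v, b)) \<in> {(a, b). E1 a b} ^^ (length vs - 1)"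
    using successively_relpow[of E1 "map (Pair v) vs"] vs
    by (auto simp: saws_between_def hd_map last_map)
  moreover have "length vs - 1 < card Gv"
    using length_saws_between[OF simple_gadget finite_gadget assms(2) vs] by linarith
  ultimately show ?thesis by blast
qed

lemma relpow_expand:
  assumes "(u, v) \<in> {(a, b). E0 a b} ^^ n" "a \<in> Gv"
  shows "\<exists>b\<in>Gv. \<exists>m\<le>card Gv * n. ((u, a), (v, b)) \<in> {(a, b). E1 a b} ^^ m"
  using assms(1)
proof (induction n arbitrary: v)
  case 0
  then show ?case using assms(2) by auto
next
  case (Suc n)
  then obtain z where z: "(u, z) \<in> {(a, b). E0 a b} ^^ n" "E0 z v" by auto
  obtain b m where b: "b \<in> Gv" "m \<le> card Gv * n" "((u, a), (z, b)) \<in> {(a, b). E1 a b} ^^ m"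
    using Suc.IH[OF z(1)] by blast
  obtain m' where m': "m' < card Gv" "((z, b), (z, \<sigma> z v)) \<in> {(a, b). E1 a b} ^^ m'"
    using relpow_within_gadget[OF G0.adj_verts(1)[OF z(2)] b(1) sigma_in_gadget[OF z(2)]] by blast
  have "((u, a), (z, \<sigma> z v)) \<in> {(a, b). E1 a b} ^^ (m + m')" using b(3) m'(2) by (rule relpow_trans)
  moreover have "E1 (z, \<sigma> z v) (v, \<sigma> v z)" using z(2) by (simp add: phi_E_def)
  ultimately have "((u, a), (v, \<sigma> v z)) \<in> {(a, b). E1 a b} ^^ Suc (m + m')"
    by (intro relpow_Suc_I) auto
  moreover have "\<sigma> v z \<in> Gv" using G0.adj_sym[OF z(2)] by (rule sigma_in_gadget)
  moreover have "Suc (m + m') \<le> card Gv * Suc n" using b(2) m'(1) by simp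
  ultimately show ?case by blast
qed

lemma setdist_transformed_bounds:
  assumes A: "A \<subseteq> V0" "A \<noteq> {}" and B: "B \<subseteq> V0" "B \<noteq> {}"
  shows "setdist E0 A B \<le> setdist E1 (A \<times> Gv) (B \<times> Gv)"
    and "setdist E1 (A \<times> Gv) (B \<times> Gv) \<le> card Gv * setdist E0 A B"
proof -
  have w1: "w1 \<in> Gv" using ports_subset by simp
  then have "A \<times> Gv \<noteq> {}" "B \<times> Gv \<noteq> {}" using A B by auto
  then obtain x y where xy: "x \<in> A \<times> Gv" "y \<in> B \<times> Gv"
    "setdist E1 (A \<times> Gv) (B \<times> Gv) = gdist E1 x y" by (rule setdist_attained)
  then have "x \<in> V1" "y \<in> V1" using A(1) B(1) by (auto simp: phi_V_def)
  then obtain n where n: "n \<le> gdist E1 x y" "(fst x, fst y) \<in> {(a, b). E0 a b} ^^ n"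
    using relpow_collapse[OF gdist_relpow[OF connected_transformed]] by blast
  have "setdist E0 A B \<le> gdist E0 (fst x) (fst y)" using xy by (intro setdist_le) auto
  also have "\<dots> \<le> n" using n(2) by (rule gdist_le)
  finally show "setdist E0 A B \<le> setdist E1 (A \<times> Gv) (B \<times> Gv)" using n(1) xy(3) by simp
  obtain u v where uv: "u \<in> A" "v \<in> B" "setdist E0 A B = gdist E0 u v"
    using setdist_attained[OF A(2) B(2)] .
  then have "(u, v) \<in> {(a, b). E0 a b} ^^ gdist E0 u v"
    using A(1) B(1) by (intro gdist_relpow[OF G0(3)]) auto
  then obtain b m where b: "b \<in> Gv" "m \<le> card Gv * gdist E0 u v"
    "((u, w1), (v, b)) \<in> {(a, b). E1 a b} ^^ m"
    using relpow_expand w1 by blast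
  have "setdist E1 (A \<times> Gv) (B \<times> Gv) \<le> gdist E1 (u, w1) (v, b)"
    using uv w1 b(1) by (intro setdist_le) auto
  also have "\<dots> \<le> m" using b(3) by (rule gdist_le)
  finally show "setdist E1 (A \<times> Gv) (B \<times> Gv) \<le> card Gv * setdist E0 A B" using b(2) uv(3) by simp
qed

end

section \<open>The exponent eta\<close>

definition scaled_Z :: "'v set \<Rightarrow> ('v \<Rightarrow> 'v \<Rightarrow> bool) \<Rightarrow> 'v set \<Rightarrow> ('v \<Rightarrow> 'v) \<Rightarrow> real \<Rightarrow> ennreal" where
  "scaled_Z V E W \<alpha> w =
    Zfun E W \<alpha> (1 / conn_const V E) * ennreal (real (setdist E W (\<alpha> ` W)) powr w)"

lemma mult_powr_le_of_comparable:
  fixes z z' :: ennreal and a b c K w :: real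
  assumes "z \<le> ennreal c * z'" "c \<ge> 0" "a > 0" "b > 0" "a \<le> K * b" "b \<le> K * a"
  shows "z * ennreal (a powr w) \<le> ennreal (c * K powr \<bar>w\<bar>) * (z' * ennreal (b powr w))"
proof -
  have "z * ennreal (a powr w) \<le> (ennreal c * z') * ennreal (K powr \<bar>w\<bar> * b powr w)"
    using assms powr_le_of_comparable[of a b K w] by (intro mult_mono ennreal_leI) auto
  then show ?thesis using assms(2) by (simp add: ennreal_mult ac_simps)
qed

context local_transformation begin

definition covers :: "('v \<times> 'g \<Rightarrow> 'v \<times> 'g) \<Rightarrow> ('v \<Rightarrow> 'v) \<Rightarrow> bool" where
  "covers \<beta> \<alpha> \<longleftrightarrow> aut V0 E0 \<alpha> \<and> aut V1 E1 \<beta> \<and> (\<forall>x\<in>V1. fst (\<beta> x) = \<alpha> (fst x))"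

lemma covers_image_times:
  assumes "covers \<beta> \<alpha>" and U: "U \<subseteq> V0"
  shows "\<beta> ` (U \<times> Gv) = \<alpha> ` U \<times> Gv"
proof (intro equalityI subsetI)
  have \<alpha>: "bij_betw \<alpha> V0 V0" and \<beta>: "bij_betw \<beta> V1 V1" and fst: "\<And>x. x \<in> V1 \<Longrightarrow> fst (\<beta> x) = \<alpha> (fst x)"
    using assms(1) by (auto simp: covers_def aut_def)
  show "y \<in> \<alpha> ` U \<times> Gv" if "y \<in> \<beta> ` (U \<times> Gv)" for y
  proof -
    obtain x where x: "y = \<beta> x" "x \<in> U \<times> Gv" using \<open>y \<in> \<beta> ` (U \<times> Gv)\<close> by blast
    then have "x \<in> V1" using U by (auto simp: phi_V_def)
    then have "y \<in> V1" "fst y = \<alpha> (fst x)" using x(1) bij_betwE[OF \<beta>] fst by auto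
    then show ?thesis using x(2) by (cases y) (auto simp: phi_V_def)
  qed
  show "y \<in> \<beta> ` (U \<times> Gv)" if "y \<in> \<alpha> ` U \<times> Gv" for y
  proof -
    obtain u where u: "u \<in> U" "fst y = \<alpha> u" "snd y \<in> Gv" using \<open>y \<in> \<alpha> ` U \<times> Gv\<close> by auto
    then have "u \<in> V0" "y \<in> V1" using U bij_betwE[OF \<alpha>] by (cases y; auto simp: phi_V_def)+
    then obtain z where z: "z \<in> V1" "\<beta> z = y" using \<beta> by (metis bij_betw_def imageE)
    then have "\<alpha> (fst z) = \<alpha> u" "fst z \<in> V0" using fst u(2) by (auto simp: phi_V_def)
    then have "fst z = u" using \<alpha> \<open>u \<in> V0\<close> by (auto simp: bij_betw_def dest: inj_onD)
    then show ?thesis using z u(1) by (cases z) (auto simp: phi_V_def)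
  qed
qed

abbreviation base_walks_to :: "'v set \<Rightarrow> 'v pos list set" where
  "base_walks_to U \<equiv> walks_between E0 (inc_edges E0 W0) (inc_edges E0 U)"

abbreviation transformed_walks_to :: "'v set \<Rightarrow> ('v \<times> 'g) pos list set" where
  "transformed_walks_to U \<equiv> walks_between E1 (inc_edges E1 W1) (inc_edges E1 (U \<times> Gv))"

lemma connector_walks_subset: "connector_walks (inc_edges E0 U) \<subseteq> transformed_walks_to U"
  using connector_inc_edges by (intro walks_between_mono) auto

lemma transformed_walks_to_external:
  assumes p: "p \<in> transformed_walks_to U" and disjoint: "W0 \<inter> U = {}"
  shows "\<exists>x\<in>set p. \<not> internal x"
proof (rule ccontr)
  assume "\<not> (\<exists>x\<in>set p. \<not> internal x)"
  moreover have "p \<in> Sig E1 W1" using p walks_between_subset_Sig by blast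
  ultimately obtain w where w: "w \<in> W0" "set p \<subseteq> gadget_pos w"
    using internal_Sig_in_gadget[of p] by blast
  obtain \<epsilon> y where y: "last p = Md \<epsilon>" "y \<in> \<epsilon>" "y \<in> U \<times> Gv"
    using p by (auto simp: walks_between_def inc_edges_def)
  have "last p \<in> set p" using p by (auto simp: walks_between_def mid_saw_def)
  then have "Md \<epsilon> \<in> gadget_pos w" using w(2) y(1) by auto
  then have "fst y = w" using y(2) by (rule Md_in_gadget_pos)
  then show False using w(1) y(3) disjoint by auto
qed

lemma core_transformed_walks_to:
  assumes p: "p \<in> transformed_walks_to U" and disjoint: "W0 \<inter> U = {}"
  shows "core p \<in> connector_walks (inc_edges E0 U)"
proof -
  have "p \<in> Sig E1 W1" using p walks_between_subset_Sig by blast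
  then obtain e f where ef: "e \<in> inc_edges E0 W0" "f \<in> edge_set E0"
    "core p \<in> walks_between E1 {connector e} {connector f}"
    and end_in_f: "\<forall>\<epsilon>. last p = Md \<epsilon> \<longrightarrow> fst ` \<epsilon> \<subseteq> f"
    using transformed_walks_to_external[OF p disjoint] by (rule core_decompose)
  obtain \<epsilon> y where y: "last p = Md \<epsilon>" "y \<in> \<epsilon>" "y \<in> U \<times> Gv"
    using p by (auto simp: walks_between_def inc_edges_def)
  then have "fst y \<in> f" "fst y \<in> U" using end_in_f by auto
  then have "f \<in> inc_edges E0 U" using ef(2) by (auto simp: inc_edges_def)
  then show ?thesis using ef(1,3) by (auto simp: walks_between_def)
qed

lemma walk_sum_to_bounds:
  assumes x: "x > 0"
  shows "walk_sum (gadget_gf x) y (base_walks_to U)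
      \<le> ennreal (real (card Gv) powr \<bar>y\<bar>) * walk_sum x y (transformed_walks_to U)"
    and "W0 \<inter> U = {} \<Longrightarrow> walk_sum x y (transformed_walks_to U)
      \<le> ennreal (core_factor x y * real (card Gv) powr \<bar>y\<bar>) *
        walk_sum (gadget_gf x) y (base_walks_to U)"
proof -
  let ?D = "real (card Gv) powr \<bar>y\<bar>"
  note bounds = walk_sum_connectors_bounds[OF inc_edges_subset inc_edges_subset x]
  have "walk_sum (gadget_gf x) y (base_walks_to U)
      \<le> ennreal ?D * walk_sum x y (connector_walks (inc_edges E0 U))" by (rule bounds(2))
  also have "\<dots> \<le> ennreal ?D * walk_sum x y (transformed_walks_to U)"
    by (intro mult_left_mono walk_sum_mono connector_walks_subset) simp
  finally show "walk_sum (gadget_gf x) y (base_walks_to U)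
      \<le> ennreal ?D * walk_sum x y (transformed_walks_to U)" .
  assume disjoint: "W0 \<inter> U = {}"
  have "walk_sum x y (transformed_walks_to U)
      \<le> ennreal (core_factor x y) * walk_sum x y (connector_walks (inc_edges E0 U))"
    using transformed_walks_to_external[OF _ disjoint] core_transformed_walks_to[OF _ disjoint]
    by (intro walk_sum_le_core x inc_edges_subset walks_between_subset_Sig) auto
  also have "\<dots> \<le> ennreal (core_factor x y) *
      (ennreal ?D * walk_sum (gadget_gf x) y (base_walks_to U))"
    by (intro mult_left_mono bounds(1)) simp
  finally show "walk_sum x y (transformed_walks_to U)
      \<le> ennreal (core_factor x y * ?D) * walk_sum (gadget_gf x) y (base_walks_to U)"
    using core_factor_nonneg by (simp add: ennreal_mult mult.assoc)
qed

lemma Zfun_eq_base_walks: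
  assumes "aut V0 E0 \<alpha>"
  shows "Zfun E0 W0 \<alpha> x = walk_sum x 0 (base_walks_to (\<alpha> ` W0))"
  by (simp add: Zfun_eq_walk_sum image_inc_edges_aut[OF G0(1) assms G0.W_subset])

lemma Zfun_eq_transformed_walks:
  assumes "covers \<beta> \<alpha>"
  shows "Zfun E1 W1 \<beta> x = walk_sum x 0 (transformed_walks_to (\<alpha> ` W0))"
proof -
  have "aut V1 E1 \<beta>" using assms by (simp add: covers_def)
  then show ?thesis
    by (simp add: Zfun_eq_walk_sum image_inc_edges_aut[OF simple_transformed _ G1.W_subset]
        covers_image_times[OF assms G0.W_subset])
qed

lemma setdist_covers_bounds:
  assumes "covers \<beta> \<alpha>"
  shows "setdist E0 W0 (\<alpha> ` W0) \<le> setdist E1 W1 (\<beta> ` W1)"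
    and "setdist E1 W1 (\<beta> ` W1) \<le> card Gv * setdist E0 W0 (\<alpha> ` W0)"
proof -
  have "\<alpha> ` V0 = V0" using assms by (simp add: covers_def aut_def bij_betw_def)
  then have "\<alpha> ` W0 \<subseteq> V0" "\<alpha> ` W0 \<noteq> {}" using G0.W_subset G0.W_nonempty by auto
  then show "setdist E0 W0 (\<alpha> ` W0) \<le> setdist E1 W1 (\<beta> ` W1)"
    "setdist E1 W1 (\<beta> ` W1) \<le> card Gv * setdist E0 W0 (\<alpha> ` W0)"
    unfolding covers_image_times[OF assms G0.W_subset]
    using setdist_transformed_bounds G0.W_subset G0.W_nonempty by blast+
qed

lemma Zfun_critical_bounds:
  assumes cov: "covers \<beta> \<alpha>" and far: "setdist E0 W0 (\<alpha> ` W0) \<ge> 1"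
  defines "x0 \<equiv> 1 / conn_const V0 E0" and "x1 \<equiv> 1 / conn_const V1 E1"
  shows "Zfun E0 W0 \<alpha> x0 \<le> ennreal 1 * Zfun E1 W1 \<beta> x1"
    and "Zfun E1 W1 \<beta> x1 \<le> ennreal (core_factor x1 0) * Zfun E0 W0 \<alpha> x0"
proof -
  have "aut V0 E0 \<alpha>" using cov by (simp add: covers_def)
  moreover have x1: "x1 > 0" using G1.mu_pos by (simp add: x1_def G1.conn_const_eq)
  moreover have "W0 \<inter> \<alpha> ` W0 = {}" using far by (rule disjoint_of_setdist_pos)
  moreover have "x0 = gadget_gf x1" by (simp add: x0_def x1_def gadget_gf_conn_const)
  ultimately show "Zfun E0 W0 \<alpha> x0 \<le> ennreal 1 * Zfun E1 W1 \<beta> x1"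
    "Zfun E1 W1 \<beta> x1 \<le> ennreal (core_factor x1 0) * Zfun E0 W0 \<alpha> x0"
    using walk_sum_to_bounds[OF x1, where y = 0 and U = "\<alpha> ` W0"] card_gadget_pos
    by (simp_all add: Zfun_eq_base_walks Zfun_eq_transformed_walks[OF cov])
qed

lemma scaled_Z_bounds:
  assumes cov: "covers \<beta> \<alpha>" and far: "setdist E0 W0 (\<alpha> ` W0) \<ge> 1"
  shows "scaled_Z V0 E0 W0 \<alpha> w
      \<le> ennreal (1 * real (card Gv) powr \<bar>w\<bar>) * scaled_Z V1 E1 W1 \<beta> w"
    and "scaled_Z V1 E1 W1 \<beta> w
      \<le> ennreal (core_factor (1 / conn_const V1 E1) 0 * real (card Gv) powr \<bar>w\<bar>) *
        scaled_Z V0 E0 W0 \<alpha> w"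
proof -
  define d0 d1 where "d0 = setdist E0 W0 (\<alpha> ` W0)" and "d1 = setdist E1 W1 (\<beta> ` W1)"
  have d: "d0 \<ge> 1" "d0 \<le> d1" "d1 \<le> card Gv * d0"
    using setdist_covers_bounds[OF cov] far by (simp_all add: d0_def d1_def)
  moreover have "d1 \<le> card Gv * d1" using card_gadget_pos by simp
  then have "d0 \<le> card Gv * d1" using d(2) by (rule order_trans[rotated])
  ultimately have comparable: "0 < real d0" "0 < real d1" "real d0 \<le> real (card Gv) * real d1"
    "real d1 \<le> real (card Gv) * real d0"
    by (simp_all flip: of_nat_mult)
  show "scaled_Z V0 E0 W0 \<alpha> w
      \<le> ennreal (1 * real (card Gv) powr \<bar>w\<bar>) * scaled_Z V1 E1 W1 \<beta> w"
    unfolding scaled_Z_def d0_def[symmetric] d1_def[symmetric]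
    by (rule mult_powr_le_of_comparable[OF Zfun_critical_bounds(1)[OF cov far] _ comparable]) simp
  show "scaled_Z V1 E1 W1 \<beta> w
      \<le> ennreal (core_factor (1 / conn_const V1 E1) 0 * real (card Gv) powr \<bar>w\<bar>) *
        scaled_Z V0 E0 W0 \<alpha> w"
    unfolding scaled_Z_def d0_def[symmetric] d1_def[symmetric]
    by (rule mult_powr_le_of_comparable[OF Zfun_critical_bounds(2)[OF cov far] core_factor_nonneg
          comparable(2,1,4,3)])
qed

theorem eta_exp_transformed:
  assumes eta: "eta_exp V1 E1 W1 \<eta>"
  shows "eta_exp V0 E0 W0 \<eta>"
  unfolding eta_exp_def scaled_Z_def[symmetric]
proof (intro allI impI)
  fix \<alpha> :: "nat \<Rightarrow> 'v \<Rightarrow> 'v"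
  assume "(\<forall>k. aut V0 E0 (\<alpha> k))
      \<and> filterlim (\<lambda>k. real (setdist E0 W0 (\<alpha> k ` W0))) at_top sequentially"
  then have \<alpha>: "\<And>k. aut V0 E0 (\<alpha> k)"
    and dist0: "filterlim (\<lambda>k. real (setdist E0 W0 (\<alpha> k ` W0))) at_top sequentially" by auto
  have "\<exists>\<beta>. covers \<beta> (\<alpha> k)" for k using aut_lift[OF \<alpha>, of k] \<alpha> unfolding covers_def by blast
  then obtain \<beta> where \<beta>: "\<And>k. covers (\<beta> k) (\<alpha> k)" by metis
  have "filterlim (\<lambda>k. real (setdist E1 W1 (\<beta> k ` W1))) at_top sequentially"
    using setdist_covers_bounds(1)[OF \<beta>] by (intro filterlim_at_top_mono[OF dist0]) simp
  then have lims: "\<forall>w. ereal w < \<eta> \<longrightarrow> (\<lambda>k. scaled_Z V1 E1 W1 (\<beta> k) w) \<longlonglongrightarrow> 0"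
    "\<forall>w. \<eta> < ereal w \<longrightarrow> (\<lambda>k. scaled_Z V1 E1 W1 (\<beta> k) w) \<longlonglongrightarrow> \<infinity>"
    using eta \<beta> unfolding eta_exp_def scaled_Z_def[symmetric] covers_def by blast+
  have "\<forall>\<^sub>F k in sequentially. 1 \<le> real (setdist E0 W0 (\<alpha> k ` W0))"
    using dist0 unfolding filterlim_at_top by blast
  then have far: "\<forall>\<^sub>F k in sequentially. 1 \<le> setdist E0 W0 (\<alpha> k ` W0)" by simp
  show "(\<forall>w. ereal w < \<eta> \<longrightarrow> (\<lambda>k. scaled_Z V0 E0 W0 (\<alpha> k) w) \<longlonglongrightarrow> 0) \<and>
      (\<forall>w. \<eta> < ereal w \<longrightarrow> (\<lambda>k. scaled_Z V0 E0 W0 (\<alpha> k) w) \<longlonglongrightarrow> \<infinity>)"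
  proof (intro conjI allI impI)
    fix w assume "ereal w < \<eta>"
    then have "(\<lambda>k. scaled_Z V1 E1 W1 (\<beta> k) w) \<longlonglongrightarrow> 0" using lims(1) by blast
    then show "(\<lambda>k. scaled_Z V0 E0 W0 (\<alpha> k) w) \<longlonglongrightarrow> 0"
      by (rule ennreal_tendsto_0_le) (rule eventually_mono[OF far scaled_Z_bounds(1)[OF \<beta>]])
  next
    fix w assume "\<eta> < ereal w"
    then have "(\<lambda>k. scaled_Z V1 E1 W1 (\<beta> k) w) \<longlonglongrightarrow> \<infinity>" using lims(2) by blast
    moreover have "\<forall>\<^sub>F k in sequentially. scaled_Z V1 E1 W1 (\<beta> k) w
        \<le> ennreal (core_factor (1 / conn_const V1 E1) 0 * real (card Gv) powr \<bar>w\<bar>) *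
          scaled_Z V0 E0 W0 (\<alpha> k) w"
      using far by (rule eventually_mono) (rule scaled_Z_bounds(2)[OF \<beta>])
    moreover have "0 \<le> core_factor (1 / conn_const V1 E1) 0 * real (card Gv) powr \<bar>w\<bar>"
      using core_factor_nonneg by simp
    ultimately show "(\<lambda>k. scaled_Z V0 E0 W0 (\<alpha> k) w) \<longlonglongrightarrow> \<infinity>" by (rule ennreal_tendsto_top_ge)
  qed
qed

end

theorem theorem3p4:
  fixes V0 :: "'v set" and E0 :: "'v \<Rightarrow> 'v \<Rightarrow> bool"
    and Gv :: "'g set" and Ge :: "'g \<Rightarrow> 'g \<Rightarrow> bool" and w1 w2 w3 :: 'g
    and \<sigma> :: "'v \<Rightarrow> 'v \<Rightarrow> 'g"
    and W0 :: "'v set" and W1 :: "('v \<times> 'g) set" and g :: ereal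
  assumes G0: "simple_graph V0 E0" "infinite V0" "connected_graph V0 E0"
              "quasi_transitive V0 E0" "cubic V0 E0"
    and gad: "gadget Gv Ge w1 w2 w3"
    and att: "\<forall>v\<in>V0. bij_betw (\<sigma> v) {u. E0 v u} {w1, w2, w3}"
    and lift: "\<forall>\<alpha>. aut V0 E0 \<alpha> \<longrightarrow>
                 (\<exists>\<beta>. aut (phi_V V0 Gv) (phi_E V0 E0 Ge \<sigma>) \<beta> \<and>
                      (\<forall>x\<in>phi_V V0 Gv. fst (\<beta> x) = \<alpha> (fst x)))"
    and G1conn: "connected_graph (phi_V V0 Gv) (phi_E V0 E0 Ge \<sigma>)"
    and W0: "min_fund_domain V0 E0 W0"
    and W1: "W1 = W0 \<times> Gv"
    and gam: "gamma_exp V0 E0 W0 g" and fin: "\<bar>g\<bar> \<noteq> \<infinity>"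
  shows "gamma_exp (phi_V V0 Gv) (phi_E V0 E0 Ge \<sigma>) W1 g \<and>
         (\<forall>\<eta>. eta_exp (phi_V V0 Gv) (phi_E V0 E0 Ge \<sigma>) W1 \<eta> \<longrightarrow> eta_exp V0 E0 W0 \<eta>)"
proof -
  interpret local_transformation V0 E0 Gv Ge w1 w2 w3 \<sigma> W0
  proof
    show "bij_betw (\<sigma> v) {u. E0 v u} {w1, w2, w3}" if "v \<in> V0" for v using att that by blast
    show "\<exists>\<beta>. aut (phi_V V0 Gv) (phi_E V0 E0 Ge \<sigma>) \<beta> \<and> (\<forall>x\<in>phi_V V0 Gv. fst (\<beta> x) = \<alpha> (fst x))"
      if "aut V0 E0 \<alpha>" for \<alpha> using lift that by blast
    show "fund_domain V0 E0 W0" using W0 by (simp add: min_fund_domain_def)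
  qed (rule G0(1) G0(2) G0(3) G0(5) gad G1conn)+
  show ?thesis
    unfolding W1 using gamma_exp_transformed[OF gam] eta_exp_transformed by blast
qed

end
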